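(* There exists an absolute constant $c>0$ such that the following holds. Let $n\in\mathbb{Z}_{>0}$, let $\Sigma$ be an $n\times n$ symmetric positive definite matrix and let $\mu=\mathcal{N}(0,\Sigma)$. Also, let $\sqrt{\Sigma}$ be a symmetric square root of $\Sigma$ and write $\|\sqrt{\Sigma}\|_{\infty,op}$ for the operator norm of $\sqrt{\Sigma}$ for the infinite norm on $\mathbb{R}^n$. For every monotonic Borel subset $A$ of $\mathbb{R}^n$ we have $$\sum_{i=1}^n I_{i,\mu}(A)\ \geq\ c\,\|\sqrt{\Sigma}\|_{\infty,op}^{-1}\,\mu(A)\,(1-\mu(A))\,\sqrt{\log_+\left(\frac{1}{\|\sqrt{\Sigma}\|_{\infty,op}\cdot\max_{i\in\{1,\dots,n\}}I_{i,\mu}(A)}\right)}\,.$$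
   Context: Positive definite matrices are invertible by convention. $\|\sqrt{\Sigma}\|_{\infty,op}=\sup_{x\neq 0}\frac{|\sqrt{\Sigma}x|_\infty}{|x|_\infty}=\max_i\sum_{j=1}^n|\sqrt{\Sigma}(i,j)|$. For a finite Borel measure $\mu$ on $\mathbb{R}^n$, $v\in\mathbb{R}^n$ and a Borel set $A\subseteq\mathbb{R}^n$, the influence of $v$ on $A$ under $\mu$ is $I_{v,\mu}(A):=\liminf_{r\downarrow 0}\frac{\mu(A+[-r,r]v)-\mu(A)}{r}\in[0,+\infty]$, where $A+[-r,r]v=\{a+tv: a\in A,\ t\in[-r,r]\}$, and $I_{i,\mu}(A):=I_{e_i,\mu}(A)$ where $(e_1,\dots,e_n)$ is the canonical basis of $\mathbb{R}^n$. A set $A\subseteq\mathbb{R}^n$ is increasing if $x\in A$ and $y_i\geq x_i$ for all $i$ imply $y\in A$; it is decreasing if its complement is increasing; it is monotonic if it is increasing or decreasing. $\log_+(t)=\max(\log t,0)$, with the usual conventions $\log_+(0)=0$, $1/0=+\infty$, $1/(+\infty)=0$, $0\cdot(+\infty)=0$. *)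

theory Defs
  imports
    "HOL-Probability.Probability"
    "Jordan_Normal_Form.Gauss_Jordan_Elimination"
    "Jordan_Normal_Form.Determinant"
begin

unbundle no vec_syntax

text \<open>
  The dimension \<open>n\<close> is quantified inside the final statement (below the absolute constant), so it
  cannot be a type. Points of \<open>\<real>\<^sup>n\<close> are therefore the extensional functions on \<open>{..<n}\<close>, that is, the
  elements of the space of \<open>Rn n\<close>, whose product sigma-algebra is the Borel one; coordinates are
  numbered from \<open>0\<close>. Matrices are those of \<open>Jordan_Normal_Form\<close>, and \<open>vec n x\<close> is the column
  vector with the entries \<open>x 0, ..., x (n - 1)\<close>.
\<close>

definition Rn :: "nat \<Rightarrow> (nat \<Rightarrow> real) measure" where
  "Rn n = Pi\<^sub>M {..<n} (\<lambda>_. borel)"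

definition basis_vector :: "nat \<Rightarrow> nat \<Rightarrow> (nat \<Rightarrow> real)" where
  "basis_vector n i = (\<lambda>j\<in>{..<n}. if j = i then 1 else 0)"

definition symmetric_mat :: "real mat \<Rightarrow> bool" where
  "symmetric_mat A \<longleftrightarrow> transpose_mat A = A"

definition positive_definite :: "nat \<Rightarrow> real mat \<Rightarrow> bool" where
  "positive_definite n A \<longleftrightarrow>
     (\<forall>x\<in>carrier_vec n. x \<noteq> 0\<^sub>v n \<longrightarrow> scalar_prod x (A *\<^sub>v x) > 0)"

text \<open>
  The centred Gaussian measure with covariance \<open>\<Sigma>\<close>, by its density with respect to Lebesgue measure.
  It is only meaningful for symmetric positive definite \<open>\<Sigma>\<close>, for which \<open>mat_inverse \<Sigma>\<close> is not \<open>None\<close>.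
\<close>

definition gaussian_density :: "nat \<Rightarrow> real mat \<Rightarrow> (nat \<Rightarrow> real) \<Rightarrow> real" where
  "gaussian_density n \<Sigma> x =
     exp (- scalar_prod (vec n x) (the (mat_inverse \<Sigma>) *\<^sub>v vec n x) / 2) / sqrt ((2 * pi) ^ n * det \<Sigma>)"

definition gaussian_measure :: "nat \<Rightarrow> real mat \<Rightarrow> (nat \<Rightarrow> real) measure" where
  "gaussian_measure n \<Sigma> =
     density (Pi\<^sub>M {..<n} (\<lambda>_. lborel)) (\<lambda>x. ennreal (gaussian_density n \<Sigma> x))"

definition linf_norm :: "real vec \<Rightarrow> real" where
  "linf_norm x = Max ((\<lambda>i. \<bar>x $ i\<bar>) ` {..<dim_vec x})"

definition linf_op_norm :: "nat \<Rightarrow> real mat \<Rightarrow> real" where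
  "linf_op_norm n A =
     (SUP x\<in>{x \<in> carrier_vec n. x \<noteq> 0\<^sub>v n}. linf_norm (A *\<^sub>v x) / linf_norm x)"

text \<open>The set \<open>A + [-r, r] v\<close>.\<close>

definition thicken :: "nat \<Rightarrow> (nat \<Rightarrow> real) \<Rightarrow> real \<Rightarrow> (nat \<Rightarrow> real) set \<Rightarrow> (nat \<Rightarrow> real) set" where
  "thicken n v r A = {(\<lambda>j\<in>{..<n}. a j + t * v j) | a t. a \<in> A \<and> t \<in> {-r..r}}"

text \<open>
  For a general Borel set \<open>A\<close> the set \<open>A + [-r, r] v\<close> is analytic but possibly not Borel, whereas
  \<open>emeasure\<close> is \<open>0\<close> on nonmeasurable sets; hence the completion. As \<open>A\<close> is contained in
  \<open>A + [-r, r] v\<close>, the truncated subtraction of \<open>ennreal\<close> is the genuine one here.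
\<close>

definition influence ::
  "nat \<Rightarrow> (nat \<Rightarrow> real) measure \<Rightarrow> (nat \<Rightarrow> real) \<Rightarrow> (nat \<Rightarrow> real) set \<Rightarrow> ennreal" where
  "influence n \<mu> v A =
     Liminf (at_right 0) (\<lambda>r.
       (emeasure (completion \<mu>) (thicken n v r A) - emeasure (completion \<mu>) A) / ennreal r)"

definition coord_influence ::
  "nat \<Rightarrow> (nat \<Rightarrow> real) measure \<Rightarrow> nat \<Rightarrow> (nat \<Rightarrow> real) set \<Rightarrow> ennreal" where
  "coord_influence n \<mu> i A = influence n \<mu> (basis_vector n i) A"

definition increasing_set :: "nat \<Rightarrow> (nat \<Rightarrow> real) set \<Rightarrow> bool" where
  "increasing_set n A \<longleftrightarrow>
     (\<forall>x\<in>A. \<forall>y\<in>space (Rn n). (\<forall>i<n. x i \<le> y i) \<longrightarrow> y \<in> A)"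

definition decreasing_set :: "nat \<Rightarrow> (nat \<Rightarrow> real) set \<Rightarrow> bool" where
  "decreasing_set n A \<longleftrightarrow> increasing_set n (space (Rn n) - A)"

definition monotonic_set :: "nat \<Rightarrow> (nat \<Rightarrow> real) set \<Rightarrow> bool" where
  "monotonic_set n A \<longleftrightarrow> increasing_set n A \<or> decreasing_set n A"

text \<open>
  Extended versions with \<open>log_plus \<infinity> = \<infinity>\<close> and \<open>sqrt \<infinity> = \<infinity>\<close>; \<open>log_plus 0 = 0\<close> because \<open>ln 0 = 0\<close> in HOL.
  The conventions \<open>1 / 0 = \<infinity>\<close>, \<open>1 / \<infinity> = 0\<close> and \<open>0 * \<infinity> = 0\<close> are those of \<open>ennreal\<close>.
\<close>

definition log_plus :: "ennreal \<Rightarrow> ennreal" where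
  "log_plus t = (if t = \<infinity> then \<infinity> else ennreal (max (ln (enn2real t)) 0))"

definition sqrt_ennreal :: "ennreal \<Rightarrow> ennreal" where
  "sqrt_ennreal t = (if t = \<infinity> then \<infinity> else ennreal (sqrt (enn2real t)))"

end

theory Submission
  imports Defs
begin

text \<open>
  Pull the increasing set \<open>A\<close> back to \<open>F = 1\<^sub>A \<circ> S\<close> on standard Gaussian space and put \<open>w\<^sub>j = S\<^sup>-\<^sup>1 e\<^sub>j\<close>.
  By the Cameron--Martin formula \<open>J\<^sub>j = E (F(Z) \<langle>w\<^sub>j, Z\<rangle>)\<close> is nonnegative and at most the \<open>j\<close>-th influence of
  \<open>A\<close>. Since \<open>e\<^sub>i = \<Sum>\<^sub>j S\<^sub>j\<^sub>i w\<^sub>j\<close> and the derivative of the semigroup \<open>P\<^sub>t F\<close> in each direction \<open>w\<^sub>j\<close> is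
  nonnegative with mean at most \<open>J\<^sub>j\<close>, the \<open>L\<^sup>1\<close> norm of \<open>\<partial>\<^sub>i P\<^sub>t F\<close> is at most \<open>a\<^sub>i = \<Sum>\<^sub>j |S\<^sub>j\<^sub>i| J\<^sub>j\<close>.

  It remains to run the argument of Cordero-Erausquin and Ledoux. As \<open>\<partial>\<^sub>i P\<^sub>t F\<close> is bounded by
  \<open>t\<^bsup>-1/2\<^esup>\<close>, hypercontractivity improves the trivial bound \<open>t\<^bsup>-1/2\<^esup> a\<^sub>i\<close> on its squared \<open>L\<^sup>2\<close> norm by a factor
  \<open>\<delta>\<^bsup>c t\<^esup>\<close> when all \<open>a\<^sub>i\<close> are at most \<open>\<delta>\<close>. The variance of \<open>F\<close> is the integral over \<open>t\<close> of the energies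
  \<open>\<Sum>\<^sub>i |\<partial>\<^sub>i P\<^sub>t F|\<^sup>2\<close>, hence of order \<open>(\<Sum>\<^sub>i a\<^sub>i) / \<surd>(log (1/\<delta>))\<close>. The integral is replaced by a sum over the
  times \<open>4\<^bsup>-k\<^esup>\<close>, and the decrease of \<open>|P\<^sub>t F|\<^sup>2\<close> between two of them is bounded by rotating a pair of
  independent Gaussian vectors in small steps.
\<close>

section \<open>Gaussian product measures\<close>

definition gauss1 :: "real measure" where
  "gauss1 = density lborel (\<lambda>x. ennreal (std_normal_density x))"

definition gauss :: "'i set \<Rightarrow> ('i \<Rightarrow> real) measure" where
  "gauss I = Pi\<^sub>M I (\<lambda>_. gauss1)"

lemma sets_gauss1 [measurable_cong, simp]: "sets gauss1 = sets borel"
  by (simp add: gauss1_def)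

lemma space_gauss1 [simp]: "space gauss1 = UNIV"
  by (simp add: gauss1_def)

lemma prob_space_gauss1: "prob_space gauss1"
  unfolding gauss1_def by (rule prob_space_normal_density) simp

lemma sets_gauss [measurable_cong]: "sets (gauss I) = sets (Pi\<^sub>M I (\<lambda>_. borel))"
  unfolding gauss_def by (rule sets_PiM_cong) auto

lemma space_gauss: "space (gauss I) = extensional I"
  by (auto simp: gauss_def space_PiM PiE_def)

lemma measurable_gauss1_iff [simp]: "measurable gauss1 M = measurable borel M"
  by (rule measurable_cong_sets) auto

interpretation gauss1: prob_space gauss1
  by (rule prob_space_gauss1)

interpretation gauss1_prod: product_sigma_finite "\<lambda>_. gauss1"
  by standard

interpretation gauss1_pair: pair_prob_space gauss1 gauss1
  by standard

lemma prob_space_gauss: "prob_space (gauss I)"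
  unfolding gauss_def by (rule prob_space_PiM) (rule prob_space_gauss1)

interpretation gauss: prob_space "gauss I" for I :: "'i set"
  by (rule prob_space_gauss)

interpretation gauss_pair: pair_prob_space "gauss I" "gauss J" for I :: "'i set" and J :: "'j set"
  by standard

interpretation gauss_gauss1: pair_prob_space "gauss I" gauss1 for I :: "'i set"
  by standard

lemma nn_integral_gauss1:
  assumes [measurable]: "f \<in> borel_measurable borel"
  shows "(\<integral>\<^sup>+x. f x \<partial>gauss1) = (\<integral>\<^sup>+x. ennreal (std_normal_density x) * f x \<partial>lborel)"
  unfolding gauss1_def by (subst nn_integral_density) auto

lemma integral_gauss1:
  fixes f :: "real \<Rightarrow> real"
  assumes [measurable]: "f \<in> borel_measurable borel"
  shows "(\<integral>x. f x \<partial>gauss1) = (\<integral>x. std_normal_density x * f x \<partial>lborel)"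
  unfolding gauss1_def by (subst integral_density) auto

lemma integrable_gauss1_iff:
  fixes f :: "real \<Rightarrow> real"
  assumes [measurable]: "f \<in> borel_measurable borel"
  shows "integrable gauss1 f \<longleftrightarrow> integrable lborel (\<lambda>x. std_normal_density x * f x)"
  unfolding gauss1_def by (subst integrable_density) auto

lemma nn_integral_gauss_insert:
  assumes "finite I" "i \<notin> I"
    and [measurable]: "f \<in> borel_measurable (Pi\<^sub>M (insert i I) (\<lambda>_. borel))"
  shows "(\<integral>\<^sup>+x. f x \<partial>gauss (insert i I)) = (\<integral>\<^sup>+x. \<integral>\<^sup>+u. f (x(i := u)) \<partial>gauss1 \<partial>gauss I)"
proof -
  have "f \<in> borel_measurable (Pi\<^sub>M (insert i I) (\<lambda>_. gauss1))"
    using sets_gauss[of "insert i I"] unfolding gauss_def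
    by (simp cong: measurable_cong_sets)
  then show ?thesis
    unfolding gauss_def using assms
    by (simp add: gauss1_prod.product_nn_integral_insert)
qed

lemma measurable_upd [measurable]:
  assumes [measurable]: "f \<in> measurable M (Pi\<^sub>M I (\<lambda>_. borel))" "g \<in> borel_measurable M"
  shows "(\<lambda>x. (f x)(i := g x)) \<in> measurable M (Pi\<^sub>M (insert i I) (\<lambda>_. borel))"
  by (rule measurable_fun_upd[where J=I]) auto

lemma nn_integral_gauss1_reflect_aux:
  assumes "c\<^sup>2 + s\<^sup>2 = 1" "c \<noteq> 0" and [measurable]: "f \<in> borel_measurable (borel \<Otimes>\<^sub>M borel)"
  shows "(\<integral>\<^sup>+u. \<integral>\<^sup>+v. f (c * u + s * v, s * u - c * v) \<partial>gauss1 \<partial>gauss1)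
       = (\<integral>\<^sup>+u. \<integral>\<^sup>+v. f (u, v) \<partial>gauss1 \<partial>gauss1)"
proof -
  define k where "k = (\<lambda>(u, v). ennreal (std_normal_density u * std_normal_density v) * f (u, v))"
  have k[measurable]: "k \<in> borel_measurable (borel \<Otimes>\<^sub>M borel)"
    unfolding k_def by measurable
  have inv: "std_normal_density (c * u + s * v) * std_normal_density (s * u - c * v)
      = std_normal_density u * std_normal_density v" for u v
  proof -
    have "(c * u + s * v)\<^sup>2 + (s * u - c * v)\<^sup>2 = (c\<^sup>2 + s\<^sup>2) * (u\<^sup>2 + v\<^sup>2)"
      by (simp add: power2_eq_square algebra_simps)
    then have "(c * u + s * v)\<^sup>2 + (s * u - c * v)\<^sup>2 = u\<^sup>2 + v\<^sup>2" using assms by simp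
    then have "exp (- ((c * u + s * v)\<^sup>2) / 2) * exp (- ((s * u - c * v)\<^sup>2) / 2) = exp (- (u\<^sup>2) / 2) * exp (- (v\<^sup>2) / 2)"
      by (simp add: exp_add [symmetric] add_divide_distrib [symmetric])
    then show ?thesis
      by (simp add: std_normal_density_def)
  qed
  have to_k: "(\<integral>\<^sup>+u. \<integral>\<^sup>+v. g u v \<partial>gauss1 \<partial>gauss1)
     = (\<integral>\<^sup>+u. \<integral>\<^sup>+v. ennreal (std_normal_density u * std_normal_density v) * g u v \<partial>lborel \<partial>lborel)"
    if [measurable]: "case_prod g \<in> borel_measurable (borel \<Otimes>\<^sub>M borel)" for g
  proof -
    have "(\<integral>\<^sup>+u. \<integral>\<^sup>+v. g u v \<partial>gauss1 \<partial>gauss1) = (\<integral>\<^sup>+u. ennreal (std_normal_density u) * (\<integral>\<^sup>+v. g u v \<partial>gauss1) \<partial>lborel)"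
      by (rule nn_integral_gauss1) measurable
    also have "\<dots> = (\<integral>\<^sup>+u. \<integral>\<^sup>+v. ennreal (std_normal_density u * std_normal_density v) * g u v \<partial>lborel \<partial>lborel)"
      by (rule nn_integral_cong)
        (simp add: nn_integral_gauss1 nn_integral_cmult[symmetric] ennreal_mult' mult.assoc)
    finally show ?thesis .
  qed
  have sq: "c * c + s * s = 1" using assms by (simp add: power2_eq_square)
  have "(\<integral>\<^sup>+u. \<integral>\<^sup>+v. f (c * u + s * v, s * u - c * v) \<partial>gauss1 \<partial>gauss1)
      = (\<integral>\<^sup>+u. \<integral>\<^sup>+v. k (c * u + s * v, s * u - c * v) \<partial>lborel \<partial>lborel)"
    by (subst to_k) (simp_all add: k_def inv)
  also have "\<dots> = (\<integral>\<^sup>+u. ennreal \<bar>1/c\<bar> * (\<integral>\<^sup>+q. k (c * u + s * (s/c * u + (-1/c) * q), s * u - c * (s/c*u + (-1/c) * q)) \<partial>lborel) \<partial>lborel)"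
    by (intro nn_integral_cong, subst nn_integral_real_affine[where c="-1/c" and t="s/c * u" for u]) (use assms in auto)
  also have "\<dots> = (\<integral>\<^sup>+u. ennreal \<bar>1/c\<bar> * (\<integral>\<^sup>+q. k (1/c * u - s/c * q, q) \<partial>lborel) \<partial>lborel)"
  proof -
    have "c + s * (s / c) = 1 / c"
      using assms(2) sq by (simp add: field_simps)
    moreover have "c * u + s * (s/c * u + (-1/c) * q) = (c + s * (s / c)) * u - s/c * q" for u q
      by (simp add: algebra_simps)
    ultimately have "c * u + s * (s/c * u + (-1/c) * q) = 1/c * u - s/c * q" for u q
      by simp
    moreover have "s * u - c * (s/c*u + (-1/c) * q) = q" for u q
      using assms(2) by (simp add: field_simps)
    ultimately show ?thesis by simp
  qed
  also have "\<dots> = ennreal \<bar>1/c\<bar> * (\<integral>\<^sup>+u. (\<integral>\<^sup>+q. k (1/c * u - s/c * q, q) \<partial>lborel) \<partial>lborel)"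
    by (rule nn_integral_cmult) measurable
  also have "\<dots> = ennreal \<bar>1/c\<bar> * (\<integral>\<^sup>+q. (\<integral>\<^sup>+u. k (1/c * u - s/c * q, q) \<partial>lborel) \<partial>lborel)"
    by (subst lborel_pair.Fubini') auto
  also have "\<dots> = ennreal \<bar>1/c\<bar> * (\<integral>\<^sup>+q. ennreal \<bar>c\<bar> * (\<integral>\<^sup>+p. k (1/c * (s * q + c * p) - s/c * q, q) \<partial>lborel) \<partial>lborel)"
    by (intro arg_cong2[where f="(*)"] refl nn_integral_cong, subst nn_integral_real_affine[where c="c" and t="s * q" for q]) (use assms in auto)
  also have "\<dots> = ennreal \<bar>1/c\<bar> * (\<integral>\<^sup>+q. ennreal \<bar>c\<bar> * (\<integral>\<^sup>+p. k (p, q) \<partial>lborel) \<partial>lborel)"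
    using assms(2) by (simp add: field_simps)
  also have "\<dots> = ennreal \<bar>1/c\<bar> * (ennreal \<bar>c\<bar> * (\<integral>\<^sup>+q. \<integral>\<^sup>+p. k (p, q) \<partial>lborel \<partial>lborel))"
    by (subst nn_integral_cmult) auto
  also have "\<dots> = (\<integral>\<^sup>+q. \<integral>\<^sup>+p. k (p, q) \<partial>lborel \<partial>lborel)"
    using assms(2) by (simp add: mult.assoc[symmetric] ennreal_mult'[symmetric])
  also have "\<dots> = (\<integral>\<^sup>+p. \<integral>\<^sup>+q. k (p, q) \<partial>lborel \<partial>lborel)"
    by (subst lborel_pair.Fubini') auto
  also have "\<dots> = (\<integral>\<^sup>+u. \<integral>\<^sup>+v. f (u, v) \<partial>gauss1 \<partial>gauss1)"
    by (subst to_k) (simp_all add: k_def)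
  finally show ?thesis .
qed

lemma nn_integral_gauss1_reflect:
  assumes cs: "c\<^sup>2 + s\<^sup>2 = 1" and [measurable]: "f \<in> borel_measurable (borel \<Otimes>\<^sub>M borel)"
  shows "(\<integral>\<^sup>+u. \<integral>\<^sup>+v. f (c * u + s * v, s * u - c * v) \<partial>gauss1 \<partial>gauss1)
       = (\<integral>\<^sup>+u. \<integral>\<^sup>+v. f (u, v) \<partial>gauss1 \<partial>gauss1)"
proof (cases "c = 0")
  case False
  then show ?thesis using nn_integral_gauss1_reflect_aux assms by blast
next
  case True
  then have s: "s = 1 \<or> s = -1" using cs by (simp add: power2_eq_1_iff)
  have flip: "(\<integral>\<^sup>+u. \<integral>\<^sup>+v. g (-u, v) \<partial>gauss1 \<partial>gauss1) = (\<integral>\<^sup>+u. \<integral>\<^sup>+v. g (u, v) \<partial>gauss1 \<partial>gauss1)"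
    if [measurable]: "g \<in> borel_measurable (borel \<Otimes>\<^sub>M borel)" for g
    using nn_integral_gauss1_reflect_aux[of "-1" 0 g] by simp
  have swap: "(\<integral>\<^sup>+u. \<integral>\<^sup>+v. g (v, u) \<partial>gauss1 \<partial>gauss1) = (\<integral>\<^sup>+u. \<integral>\<^sup>+v. g (u, v) \<partial>gauss1 \<partial>gauss1)"
    if [measurable]: "g \<in> borel_measurable (borel \<Otimes>\<^sub>M borel)" for g
    by (subst gauss1_pair.Fubini') auto
  show ?thesis
  proof (cases "s = 1")
    case True
    then show ?thesis using \<open>c = 0\<close> swap[of f] by simp
  next
    case False
    then have "s = -1" using s by simp
    have "(\<integral>\<^sup>+u. \<integral>\<^sup>+v. f (-v, -u) \<partial>gauss1 \<partial>gauss1) = (\<integral>\<^sup>+u. \<integral>\<^sup>+v. f (-v, u) \<partial>gauss1 \<partial>gauss1)"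
      using flip[of "\<lambda>(u,v). f (-v, u)"] by simp
    also have "\<dots> = (\<integral>\<^sup>+u. \<integral>\<^sup>+v. f (u, v) \<partial>gauss1 \<partial>gauss1)"
      using flip[of f] swap[of "\<lambda>(u,v). f (-u, v)"] by simp
    finally show ?thesis using \<open>s = -1\<close> \<open>c = 0\<close> by simp
  qed
qed

definition lin :: "'i set \<Rightarrow> real \<Rightarrow> real \<Rightarrow> ('i \<Rightarrow> real) \<Rightarrow> ('i \<Rightarrow> real) \<Rightarrow> ('i \<Rightarrow> real)" where
  "lin I a b x y = (\<lambda>i\<in>I. a * x i + b * y i)"

lemma measurable_lin [measurable]:
  assumes [measurable]: "f \<in> measurable M (Pi\<^sub>M I (\<lambda>_. borel))" "g \<in> measurable M (Pi\<^sub>M I (\<lambda>_. borel))"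
  shows "(\<lambda>x. lin I a b (f x) (g x)) \<in> measurable M (Pi\<^sub>M I (\<lambda>_. borel))"
  unfolding lin_def by measurable

lemma lin_in_space [simp]: "lin I a b x y \<in> extensional I"
  by (simp add: lin_def)

lemma lin_apply: "i \<in> I \<Longrightarrow> lin I a b x y i = a * x i + b * y i"
  by (simp add: lin_def)

lemma lin_insert:
  assumes "i \<notin> I"
  shows "lin (insert i I) a b (x(i := u)) (y(i := v)) = (lin I a b x y)(i := a * u + b * v)"
  using assms by (auto simp: lin_def fun_eq_iff)

lemma nn_integral_gauss_reflect:
  assumes cs: "c\<^sup>2 + s\<^sup>2 = 1" and "finite I"
    and "f \<in> borel_measurable (Pi\<^sub>M I (\<lambda>_. borel) \<Otimes>\<^sub>M Pi\<^sub>M I (\<lambda>_. borel))"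
  shows "(\<integral>\<^sup>+x. \<integral>\<^sup>+y. f (lin I c s x y, lin I s (-c) x y) \<partial>gauss I \<partial>gauss I)
       = (\<integral>\<^sup>+x. \<integral>\<^sup>+y. f (x, y) \<partial>gauss I \<partial>gauss I)"
  using assms(2,3)
proof (induction I arbitrary: f rule: finite_induct)
  case empty
  have *: "lin {} a b x y = (\<lambda>_. undefined)" for a b x and y :: "'a \<Rightarrow> real"
    by (auto simp: lin_def)
  show ?case
    by (intro nn_integral_cong) (auto simp: * space_gauss)
next
  case (insert i I)
  note [measurable] = insert.prems
  let ?J = "insert i I"
  have double: "(\<integral>\<^sup>+x. \<integral>\<^sup>+y. g x y \<partial>gauss ?J \<partial>gauss ?J)
      = (\<integral>\<^sup>+x. \<integral>\<^sup>+y. \<integral>\<^sup>+u. \<integral>\<^sup>+v. g (x(i := u)) (y(i := v)) \<partial>gauss1 \<partial>gauss1 \<partial>gauss I \<partial>gauss I)"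
    if [measurable]: "case_prod g \<in> borel_measurable (Pi\<^sub>M ?J (\<lambda>_. borel) \<Otimes>\<^sub>M Pi\<^sub>M ?J (\<lambda>_. borel))" for g
  proof -
    have sl: "g p \<in> borel_measurable (Pi\<^sub>M ?J (\<lambda>_. borel))" if "p \<in> extensional ?J" for p
      using measurable_Pair2[OF \<open>case_prod g \<in> _\<close>, of p] that by (simp add: space_PiM PiE_def)
    have "(\<integral>\<^sup>+x. \<integral>\<^sup>+y. g x y \<partial>gauss ?J \<partial>gauss ?J)
        = (\<integral>\<^sup>+x. \<integral>\<^sup>+u. (\<integral>\<^sup>+y. g (x(i := u)) y \<partial>gauss ?J) \<partial>gauss1 \<partial>gauss I)"
      by (rule nn_integral_gauss_insert) (use insert in auto)
    also have "\<dots> = (\<integral>\<^sup>+x. \<integral>\<^sup>+u. \<integral>\<^sup>+y. \<integral>\<^sup>+v. g (x(i := u)) (y(i := v)) \<partial>gauss1 \<partial>gauss I \<partial>gauss1 \<partial>gauss I)"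
      using insert sl by (intro nn_integral_cong nn_integral_gauss_insert) (auto simp: space_gauss extensional_def)
    also have "\<dots> = (\<integral>\<^sup>+x. \<integral>\<^sup>+y. \<integral>\<^sup>+u. \<integral>\<^sup>+v. g (x(i := u)) (y(i := v)) \<partial>gauss1 \<partial>gauss1 \<partial>gauss I \<partial>gauss I)"
    proof (rule nn_integral_cong)
      fix x assume "x \<in> space (gauss I)"
      then have [measurable]: "x \<in> space (Pi\<^sub>M I (\<lambda>_. borel))"
        by (simp add: space_gauss space_PiM PiE_def)
      show "(\<integral>\<^sup>+u. \<integral>\<^sup>+y. \<integral>\<^sup>+v. g (x(i := u)) (y(i := v)) \<partial>gauss1 \<partial>gauss I \<partial>gauss1)
          = (\<integral>\<^sup>+y. \<integral>\<^sup>+u. \<integral>\<^sup>+v. g (x(i := u)) (y(i := v)) \<partial>gauss1 \<partial>gauss1 \<partial>gauss I)"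
        by (rule gauss_gauss1.Fubini') measurable
    qed
    finally show ?thesis .
  qed
  define H where "H = (\<lambda>(p, q). \<integral>\<^sup>+u. \<integral>\<^sup>+v. f (p(i := u), q(i := v)) \<partial>gauss1 \<partial>gauss1)"
  have [measurable]: "H \<in> borel_measurable (Pi\<^sub>M I (\<lambda>_. borel) \<Otimes>\<^sub>M Pi\<^sub>M I (\<lambda>_. borel))"
    unfolding H_def by measurable
  have "(\<integral>\<^sup>+x. \<integral>\<^sup>+y. f (lin ?J c s x y, lin ?J s (-c) x y) \<partial>gauss ?J \<partial>gauss ?J)
     = (\<integral>\<^sup>+x. \<integral>\<^sup>+y. \<integral>\<^sup>+u. \<integral>\<^sup>+v. f ((lin I c s x y)(i := c * u + s * v), (lin I s (-c) x y)(i := s * u - c * v)) \<partial>gauss1 \<partial>gauss1 \<partial>gauss I \<partial>gauss I)"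
    using insert by (subst double) (auto simp: lin_insert)
  also have "\<dots> = (\<integral>\<^sup>+x. \<integral>\<^sup>+y. H (lin I c s x y, lin I s (-c) x y) \<partial>gauss I \<partial>gauss I)"
  proof -
    have "(\<integral>\<^sup>+u. \<integral>\<^sup>+v. f (p(i := c * u + s * v), q(i := s * u - c * v)) \<partial>gauss1 \<partial>gauss1) = H (p, q)"
      if "p \<in> extensional I" "q \<in> extensional I" for p q
    proof -
      have "(\<lambda>(u, v). f (p(i := u), q(i := v))) \<in> borel_measurable (borel \<Otimes>\<^sub>M borel)"
        using that by (measurable; simp add: space_PiM PiE_def)
      from nn_integral_gauss1_reflect[OF cs this] show ?thesis
        by (simp add: H_def)
    qed
    then show ?thesis
      by (intro nn_integral_cong) simp
  qed
  also have "\<dots> = (\<integral>\<^sup>+x. \<integral>\<^sup>+y. H (x, y) \<partial>gauss I \<partial>gauss I)"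
    by (rule insert.IH) measurable
  also have "\<dots> = (\<integral>\<^sup>+x. \<integral>\<^sup>+y. f (x, y) \<partial>gauss ?J \<partial>gauss ?J)"
    by (subst double) (auto simp: H_def)
  finally show ?case .
qed

text \<open>
  A reflection instead of a rotation of the pair \<open>(x, y)\<close>, because it is its own inverse.
\<close>

definition refl_map :: "'i set \<Rightarrow> real \<Rightarrow> real \<Rightarrow> ('i \<Rightarrow> real) \<times> ('i \<Rightarrow> real) \<Rightarrow> ('i \<Rightarrow> real) \<times> ('i \<Rightarrow> real)" where
  "refl_map I c s = (\<lambda>(x, y). (lin I c s x y, lin I s (-c) x y))"

lemma sets_gauss_pair [measurable_cong]:
  "sets (gauss I \<Otimes>\<^sub>M gauss J) = sets (Pi\<^sub>M I (\<lambda>_. borel) \<Otimes>\<^sub>M Pi\<^sub>M J (\<lambda>_. borel))"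
  by (intro sets_pair_measure_cong sets_gauss)

lemma measurable_refl_map [measurable]:
  "refl_map I c s \<in> measurable (gauss I \<Otimes>\<^sub>M gauss I) (gauss I \<Otimes>\<^sub>M gauss I)"
  unfolding refl_map_def by measurable

lemma distr_gauss_reflect:
  assumes cs: "c\<^sup>2 + s\<^sup>2 = 1" and "finite I"
  shows "distr (gauss I \<Otimes>\<^sub>M gauss I) (gauss I \<Otimes>\<^sub>M gauss I) (refl_map I c s) = gauss I \<Otimes>\<^sub>M gauss I"
proof (rule measure_eqI)
  fix A assume "A \<in> sets (distr (gauss I \<Otimes>\<^sub>M gauss I) (gauss I \<Otimes>\<^sub>M gauss I) (refl_map I c s))"
  then have A: "A \<in> sets (gauss I \<Otimes>\<^sub>M gauss I)"
    by simp
  then have A'[measurable]: "A \<in> sets (Pi\<^sub>M I (\<lambda>_. borel) \<Otimes>\<^sub>M Pi\<^sub>M I (\<lambda>_. borel))"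
    by (simp add: sets_gauss_pair)
  have "emeasure (distr (gauss I \<Otimes>\<^sub>M gauss I) (gauss I \<Otimes>\<^sub>M gauss I) (refl_map I c s)) A
      = (\<integral>\<^sup>+z. indicator A (refl_map I c s z) \<partial>(gauss I \<Otimes>\<^sub>M gauss I))"
    using A by (subst nn_integral_indicator[symmetric], simp, subst nn_integral_distr) auto
  also have "\<dots> = (\<integral>\<^sup>+x. \<integral>\<^sup>+y. indicator A (lin I c s x y, lin I s (-c) x y) \<partial>gauss I \<partial>gauss I)"
    by (subst gauss.nn_integral_fst[symmetric]) (auto simp: refl_map_def)
  also have "\<dots> = (\<integral>\<^sup>+x. \<integral>\<^sup>+y. indicator A (x, y) \<partial>gauss I \<partial>gauss I)"
    by (rule nn_integral_gauss_reflect) (use assms in auto)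
  also have "\<dots> = emeasure (gauss I \<Otimes>\<^sub>M gauss I) A"
    using A by (subst gauss.nn_integral_fst) auto
  finally show "emeasure (distr (gauss I \<Otimes>\<^sub>M gauss I) (gauss I \<Otimes>\<^sub>M gauss I) (refl_map I c s)) A
      = emeasure (gauss I \<Otimes>\<^sub>M gauss I) A" .
qed simp

lemma integral_gauss_reflect:
  fixes f :: "_ \<Rightarrow> real"
  assumes cs: "c\<^sup>2 + s\<^sup>2 = 1" and "finite I"
    and f: "f \<in> borel_measurable (gauss I \<Otimes>\<^sub>M gauss I)"
  shows "(\<integral>z. f (refl_map I c s z) \<partial>(gauss I \<Otimes>\<^sub>M gauss I)) = (\<integral>z. f z \<partial>(gauss I \<Otimes>\<^sub>M gauss I))"
  using integral_distr[OF measurable_refl_map f, of c s] distr_gauss_reflect[OF assms(1,2)] by simp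

lemma nn_integral_gauss1_shift:
  assumes [measurable]: "f \<in> borel_measurable borel"
  shows "(\<integral>\<^sup>+u. f (u + a) \<partial>gauss1) = (\<integral>\<^sup>+u. ennreal (exp (a * u - a\<^sup>2 / 2)) * f u \<partial>gauss1)"
proof -
  have "(\<integral>\<^sup>+u. f (u + a) \<partial>gauss1) = (\<integral>\<^sup>+u. ennreal (std_normal_density u) * f (u + a) \<partial>lborel)"
    by (rule nn_integral_gauss1) simp
  also have "\<dots> = (\<integral>\<^sup>+u. ennreal (std_normal_density (u - a)) * f u \<partial>lborel)"
    by (subst nn_integral_real_affine[where c=1 and t=a]) (auto simp: add.commute)
  also have "\<dots> = (\<integral>\<^sup>+u. ennreal (std_normal_density u) * (ennreal (exp (a * u - a\<^sup>2 / 2)) * f u) \<partial>lborel)"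
  proof (rule nn_integral_cong)
    fix u
    have "std_normal_density (u - a) = std_normal_density u * exp (a * u - a\<^sup>2 / 2)"
      by (simp add: std_normal_density_def flip: exp_add) (simp add: power2_eq_square field_simps)
    then show "ennreal (std_normal_density (u - a)) * f u = ennreal (std_normal_density u) * (ennreal (exp (a * u - a\<^sup>2 / 2)) * f u)"
      by (simp add: ennreal_mult' mult.assoc)
  qed
  also have "\<dots> = (\<integral>\<^sup>+u. ennreal (exp (a * u - a\<^sup>2 / 2)) * f u \<partial>gauss1)"
    by (rule nn_integral_gauss1[symmetric]) simp
  finally show ?thesis .
qed

definition dotp :: "'i set \<Rightarrow> ('i \<Rightarrow> real) \<Rightarrow> ('i \<Rightarrow> real) \<Rightarrow> real" where
  "dotp I v x = (\<Sum>i\<in>I. v i * x i)"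

lemma measurable_dotp [measurable]:
  assumes [measurable]: "f \<in> measurable M (Pi\<^sub>M I (\<lambda>_. borel))"
  shows "(\<lambda>x. dotp I v (f x)) \<in> borel_measurable M"
  unfolding dotp_def by measurable

lemma nn_integral_gauss_shift:
  assumes "finite I" and "f \<in> borel_measurable (Pi\<^sub>M I (\<lambda>_. borel))"
  shows "(\<integral>\<^sup>+x. f (lin I 1 1 x v) \<partial>gauss I) = (\<integral>\<^sup>+x. ennreal (exp (dotp I v x - dotp I v v / 2)) * f x \<partial>gauss I)"
  using assms
proof (induction I arbitrary: f rule: finite_induct)
  case empty
  have *: "lin {} a b x y = (\<lambda>_. undefined)" for a b x and y :: "'a \<Rightarrow> real"
    by (auto simp: lin_def)
  show ?case
    by (rule nn_integral_cong) (auto simp: * dotp_def space_gauss)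
next
  case (insert i I)
  note [measurable] = insert.prems
  let ?J = "insert i I"
  have [measurable]: "(\<lambda>x. lin ?J 1 1 x v) \<in> measurable (Pi\<^sub>M ?J (\<lambda>_. borel)) (Pi\<^sub>M ?J (\<lambda>_. borel))"
    unfolding lin_def by measurable
  have [measurable]: "(\<lambda>x. lin I 1 1 x v) \<in> measurable (Pi\<^sub>M I (\<lambda>_. borel)) (Pi\<^sub>M I (\<lambda>_. borel))"
    unfolding lin_def by measurable
  have d: "dotp ?J v (x(i := u)) - dotp ?J v v / 2 = (dotp I v x - dotp I v v / 2) + (v i * u - (v i)\<^sup>2 / 2)" for x u
  proof -
    have "(\<Sum>j\<in>I. v j * (x(i := u)) j) = (\<Sum>j\<in>I. v j * x j)"
      using insert by (intro sum.cong) auto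
    then show ?thesis using insert
      by (simp add: dotp_def power2_eq_square add_divide_distrib)
  qed
  define H where "H p = (\<integral>\<^sup>+u. ennreal (exp (v i * u - (v i)\<^sup>2 / 2)) * f (p(i := u)) \<partial>gauss1)" for p
  have [measurable]: "H \<in> borel_measurable (Pi\<^sub>M I (\<lambda>_. borel))"
    unfolding H_def by measurable
  have sl: "(\<lambda>u. f (p(i := u))) \<in> borel_measurable borel" if "p \<in> extensional I" for p
    using that by (measurable; simp add: space_PiM PiE_def)
  have "(\<integral>\<^sup>+x. f (lin ?J 1 1 x v) \<partial>gauss ?J) = (\<integral>\<^sup>+x. \<integral>\<^sup>+u. f (lin ?J 1 1 (x(i := u)) v) \<partial>gauss1 \<partial>gauss I)"
    by (rule nn_integral_gauss_insert) (use insert in auto)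
  also have "\<dots> = (\<integral>\<^sup>+x. \<integral>\<^sup>+u. f ((lin I 1 1 x v)(i := u + v i)) \<partial>gauss1 \<partial>gauss I)"
    using lin_insert[OF insert(2), of 1 1 _ _ v "v i"] by simp
  also have "\<dots> = (\<integral>\<^sup>+x. H (lin I 1 1 x v) \<partial>gauss I)"
    unfolding H_def by (intro nn_integral_cong nn_integral_gauss1_shift sl) simp
  also have "\<dots> = (\<integral>\<^sup>+x. ennreal (exp (dotp I v x - dotp I v v / 2)) * H x \<partial>gauss I)"
    by (rule insert.IH) measurable
  also have "\<dots> = (\<integral>\<^sup>+x. \<integral>\<^sup>+u. ennreal (exp (dotp ?J v (x(i := u)) - dotp ?J v v / 2)) * f (x(i := u)) \<partial>gauss1 \<partial>gauss I)"
    unfolding H_def d exp_add using sl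
    by (intro nn_integral_cong) (simp add: nn_integral_cmult[symmetric] ennreal_mult' mult.assoc space_gauss)
  also have "\<dots> = (\<integral>\<^sup>+x. ennreal (exp (dotp ?J v x - dotp ?J v v / 2)) * f x \<partial>gauss ?J)"
    by (rule nn_integral_gauss_insert[symmetric]) (use insert in auto)
  finally show ?case .
qed

lemma measurable_shift [measurable]: "(\<lambda>x. lin I 1 1 x v) \<in> measurable (gauss I) (gauss I)"
  unfolding lin_def by measurable

lemma distr_gauss_shift:
  assumes "finite I"
  shows "distr (gauss I) (gauss I) (\<lambda>x. lin I 1 1 x v) = density (gauss I) (\<lambda>x. ennreal (exp (dotp I v x - dotp I v v / 2)))"
proof (rule measure_eqI)
  fix A assume "A \<in> sets (distr (gauss I) (gauss I) (\<lambda>x. lin I 1 1 x v))"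
  then have A: "A \<in> sets (gauss I)" by simp
  then have A'[measurable]: "A \<in> sets (Pi\<^sub>M I (\<lambda>_. borel))" by (simp add: sets_gauss)
  have "emeasure (distr (gauss I) (gauss I) (\<lambda>x. lin I 1 1 x v)) A = (\<integral>\<^sup>+x. indicator A (lin I 1 1 x v) \<partial>gauss I)"
    using A by (subst nn_integral_indicator[symmetric], simp, subst nn_integral_distr) auto
  also have "\<dots> = (\<integral>\<^sup>+x. ennreal (exp (dotp I v x - dotp I v v / 2)) * indicator A x \<partial>gauss I)"
    by (rule nn_integral_gauss_shift) (use assms in auto)
  also have "\<dots> = emeasure (density (gauss I) (\<lambda>x. ennreal (exp (dotp I v x - dotp I v v / 2)))) A"
    using A by (subst emeasure_density) auto
  finally show "emeasure (distr (gauss I) (gauss I) (\<lambda>x. lin I 1 1 x v)) A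
     = emeasure (density (gauss I) (\<lambda>x. ennreal (exp (dotp I v x - dotp I v v / 2)))) A" .
qed simp

lemma integral_gauss_shift:
  fixes f :: "_ \<Rightarrow> real"
  assumes "finite I" and f: "f \<in> borel_measurable (gauss I)"
  shows "(\<integral>x. f (lin I 1 1 x v) \<partial>gauss I) = (\<integral>x. exp (dotp I v x - dotp I v v / 2) * f x \<partial>gauss I)"
proof -
  have "(\<integral>x. f (lin I 1 1 x v) \<partial>gauss I) = (\<integral>x. f x \<partial>distr (gauss I) (gauss I) (\<lambda>x. lin I 1 1 x v))"
    using f by (subst integral_distr) auto
  also have "\<dots> = (\<integral>x. exp (dotp I v x - dotp I v v / 2) * f x \<partial>gauss I)"
    using f by (subst distr_gauss_shift[OF assms(1)], subst integral_density) auto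
  finally show ?thesis .
qed

lemma integrable_gauss_shift:
  fixes f :: "_ \<Rightarrow> real"
  assumes "finite I" and f: "f \<in> borel_measurable (gauss I)"
  shows "integrable (gauss I) (\<lambda>x. f (lin I 1 1 x v)) \<longleftrightarrow> integrable (gauss I) (\<lambda>x. exp (dotp I v x - dotp I v v / 2) * f x)"
proof -
  have "integrable (gauss I) (\<lambda>x. f (lin I 1 1 x v)) \<longleftrightarrow> integrable (distr (gauss I) (gauss I) (\<lambda>x. lin I 1 1 x v)) f"
    using f by (subst integrable_distr_eq) auto
  also have "\<dots> \<longleftrightarrow> integrable (gauss I) (\<lambda>x. exp (dotp I v x - dotp I v v / 2) * f x)"
    using f by (subst distr_gauss_shift[OF assms(1)], subst integrable_density) auto
  finally show ?thesis .
qed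

section \<open>Hypercontractivity\<close>

lemma abs_mult_le_squares: "\<bar>a * b\<bar> \<le> a\<^sup>2 + b\<^sup>2" for a b :: real
proof -
  have "2 * (\<bar>a\<bar> * \<bar>b\<bar>) \<le> a\<^sup>2 + b\<^sup>2"
    using sum_squares_bound[of "\<bar>a\<bar>" "\<bar>b\<bar>"] by (simp add: mult.assoc)
  moreover have "0 \<le> \<bar>a\<bar> * \<bar>b\<bar>" by simp
  ultimately show ?thesis unfolding abs_mult by linarith
qed

lemma integral_Cauchy_Schwarz:
  fixes f g :: "'a \<Rightarrow> real"
  assumes [measurable]: "f \<in> borel_measurable M" "g \<in> borel_measurable M"
    and f2: "integrable M (\<lambda>x. (f x)\<^sup>2)" and g2: "integrable M (\<lambda>x. (g x)\<^sup>2)"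
  shows "(\<integral>x. f x * g x \<partial>M)\<^sup>2 \<le> (\<integral>x. (f x)\<^sup>2 \<partial>M) * (\<integral>x. (g x)\<^sup>2 \<partial>M)"
proof -
  let ?A = "\<integral>x. (f x)\<^sup>2 \<partial>M" and ?B = "\<integral>x. f x * g x \<partial>M" and ?C = "\<integral>x. (g x)\<^sup>2 \<partial>M"
  have fg: "integrable M (\<lambda>x. f x * g x)"
  proof (rule Bochner_Integration.integrable_bound)
    show "integrable M (\<lambda>x. (f x)\<^sup>2 + (g x)\<^sup>2)" using f2 g2 by simp
    show "AE x in M. norm (f x * g x) \<le> norm ((f x)\<^sup>2 + (g x)\<^sup>2)"
      using abs_mult_le_squares by simp
  qed simp
  have quad: "0 \<le> ?A + 2 * t * ?B + t\<^sup>2 * ?C" for t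
  proof -
    have "0 \<le> (\<integral>x. (f x + t * g x)\<^sup>2 \<partial>M)" by simp
    also have "\<dots> = (\<integral>x. (f x)\<^sup>2 + 2 * t * (f x * g x) + t\<^sup>2 * (g x)\<^sup>2 \<partial>M)"
      by (simp add: power2_eq_square algebra_simps)
    also have "\<dots> = ?A + 2 * t * ?B + t\<^sup>2 * ?C"
      using f2 g2 fg by simp
    finally show ?thesis .
  qed
  have C: "0 \<le> ?C" by simp
  show ?thesis
  proof (cases "?C = 0")
    case True
    have "?B = 0"
    proof (rule ccontr)
      assume "?B \<noteq> 0"
      show False
      proof -
        have "2 * (- (?A + 1) / (2 * ?B)) * ?B = - (?A + 1)"
          using \<open>?B \<noteq> 0\<close> by (simp add: field_simps)
        then show False
          using quad[of "- (?A + 1) / (2 * ?B)"] True by simp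
      qed
    qed
    then show ?thesis using True by simp
  next
    case False
    then have "0 < ?C" using C by linarith
    have "0 \<le> ?C * (?A + 2 * (- ?B / ?C) * ?B + (- ?B / ?C)\<^sup>2 * ?C)"
      using quad[of "- ?B / ?C"] C by (rule mult_nonneg_nonneg[rotated])
    also have "\<dots> = ?A * ?C - ?B\<^sup>2"
      using \<open>0 < ?C\<close> by (simp add: power2_eq_square field_simps)
    finally show ?thesis by simp
  qed
qed

definition bdd :: "('a \<Rightarrow> real) \<Rightarrow> bool" where
  "bdd f \<longleftrightarrow> (\<exists>B. \<forall>x. \<bar>f x\<bar> \<le> B)"

lemma bddI: "(\<And>x. \<bar>f x\<bar> \<le> B) \<Longrightarrow> bdd f"
  by (auto simp: bdd_def)

lemma bddE:
  assumes "bdd f" obtains B where "0 \<le> B" "\<And>x. \<bar>f x\<bar> \<le> B"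
  using assms unfolding bdd_def by (meson abs_ge_zero order_trans)

lemma bdd_const [simp]: "bdd (\<lambda>_. c)"
  by (rule bddI[of _ "\<bar>c\<bar>"]) simp

lemma bdd_mono: "bdd g \<Longrightarrow> (\<And>x. \<bar>f x\<bar> \<le> \<bar>g x\<bar>) \<Longrightarrow> bdd f"
  unfolding bdd_def by (meson order_trans)

lemma bdd_comp: "bdd f \<Longrightarrow> bdd (\<lambda>x. f (g x))"
  by (auto simp: bdd_def)

lemma bdd_mult:
  assumes "bdd f" "bdd g" shows "bdd (\<lambda>x. f x * g x)"
proof -
  obtain B C where "0 \<le> B" "\<And>x. \<bar>f x\<bar> \<le> B" "0 \<le> C" "\<And>x. \<bar>g x\<bar> \<le> C"
    using assms by (metis bddE)
  then show ?thesis by (intro bddI[of _ "B * C"]) (auto simp: abs_mult intro: mult_mono)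
qed

lemma bdd_add:
  assumes "bdd f" "bdd g" shows "bdd (\<lambda>x. f x + g x)"
proof -
  obtain B C where "\<And>x. \<bar>f x\<bar> \<le> B" "\<And>x. \<bar>g x\<bar> \<le> C"
    using assms by (metis bddE)
  then show ?thesis by (intro bddI[of _ "B + C"]) (meson abs_triangle_ineq add_mono order_trans)
qed

lemma bdd_minus: "bdd f \<Longrightarrow> bdd (\<lambda>x. - f x)"
  by (auto simp: bdd_def)

lemma bdd_diff: "bdd f \<Longrightarrow> bdd g \<Longrightarrow> bdd (\<lambda>x. f x - g x)"
  using bdd_add[OF _ bdd_minus, of f g] by simp

lemma bdd_power: "bdd f \<Longrightarrow> bdd (\<lambda>x. f x ^ n)"
  by (induction n) (auto intro: bdd_mult)

lemma bdd_abs: "bdd f \<Longrightarrow> bdd (\<lambda>x. \<bar>f x\<bar>)"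
  by (auto simp: bdd_def)

lemmas bdd_intros = bdd_const bdd_mult bdd_add bdd_diff bdd_minus bdd_power bdd_abs

lemma (in prob_space) bdd_integrable:
  assumes "bdd f" "f \<in> borel_measurable M"
  shows "integrable M f"
proof -
  obtain B where "\<And>x. \<bar>f x\<bar> \<le> B" using assms(1) by (metis bddE)
  then show ?thesis using assms(2) by (intro integrable_const_bound[where B=B]) auto
qed

lemma (in prob_space) abs_integral_le:
  fixes f :: "'a \<Rightarrow> real"
  assumes "\<And>x. \<bar>f x\<bar> \<le> B" "f \<in> borel_measurable M"
  shows "\<bar>\<integral>x. f x \<partial>M\<bar> \<le> B"
proof -
  have "integrable M f" using assms by (intro bdd_integrable bddI) auto
  have "\<bar>\<integral>x. f x \<partial>M\<bar> \<le> (\<integral>x. \<bar>f x\<bar> \<partial>M)" by (rule integral_abs_bound)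
  also have "\<dots> \<le> (\<integral>x. B \<partial>M)" using assms \<open>integrable M f\<close> by (intro integral_mono) auto
  finally show ?thesis by (simp add: prob_space)
qed

lemma (in prob_space) bdd_integral:
  fixes g :: "'b \<Rightarrow> 'a \<Rightarrow> real"
  assumes "bdd (\<lambda>(x, y). g x y)"
  shows "bdd (\<lambda>x. \<integral>y. g x y \<partial>M)"
proof -
  obtain B where B: "0 \<le> B" "\<And>z. \<bar>case z of (x, y) \<Rightarrow> g x y\<bar> \<le> B" using assms by (metis bddE)
  show ?thesis
  proof (rule bddI[of _ B])
    fix x show "\<bar>\<integral>y. g x y \<partial>M\<bar> \<le> B"
      using abs_integral_le[of "g x" B] B not_integrable_integral_eq[of M "g x"]
      by (cases "integrable M (g x)") (force dest: borel_measurable_integrable)+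
  qed
qed

lemma measure_gauss1_UNIV [simp]: "measure gauss1 UNIV = 1"
  using gauss1.prob_space by simp

lemma gaussian_exp_quadratic:
  fixes \<alpha> \<beta> :: real
  assumes "\<alpha> < 1/2"
  shows "integrable gauss1 (\<lambda>x. exp (\<alpha> * x\<^sup>2 + \<beta> * x))"
    and "(\<integral>x. exp (\<alpha> * x\<^sup>2 + \<beta> * x) \<partial>gauss1) = exp (\<beta>\<^sup>2 / (2 * (1 - 2 * \<alpha>))) / sqrt (1 - 2 * \<alpha>)"
proof -
  define q where "q = 1 - 2 * \<alpha>"
  have q: "0 < q" using assms by (simp add: q_def)
  define s where "s = 1 / sqrt q"
  have s: "0 < s" "s\<^sup>2 = 1 / q" using q by (auto simp: s_def power_divide)
  let ?K = "exp (\<beta>\<^sup>2 / (2 * q)) / sqrt q"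
  have a: "\<alpha> = (1 - q) / 2" by (simp add: q_def)
  have eq: "std_normal_density x * exp (\<alpha> * x\<^sup>2 + \<beta> * x) = ?K * normal_density (\<beta> / q) s x" for x
  proof -
    have "- x\<^sup>2 / 2 + (\<alpha> * x\<^sup>2 + \<beta> * x) = \<beta>\<^sup>2 / (2 * q) + - (x - \<beta> / q)\<^sup>2 / (2 * (1 / q))"
      using q unfolding a by (simp add: power2_eq_square field_simps)
    then have "exp (- x\<^sup>2 / 2) * exp (\<alpha> * x\<^sup>2 + \<beta> * x) = exp (\<beta>\<^sup>2 / (2 * q)) * exp (- (x - \<beta> / q)\<^sup>2 / (2 * s\<^sup>2))"
      unfolding s(2) by (simp only: exp_add[symmetric])
    then show ?thesis using q s
      by (simp add: std_normal_density_def normal_density_def real_sqrt_divide)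
  qed
  show "integrable gauss1 (\<lambda>x. exp (\<alpha> * x\<^sup>2 + \<beta> * x))"
    by (subst integrable_gauss1_iff) (use s in \<open>simp_all add: eq\<close>)
  show "(\<integral>x. exp (\<alpha> * x\<^sup>2 + \<beta> * x) \<partial>gauss1) = exp (\<beta>\<^sup>2 / (2 * (1 - 2 * \<alpha>))) / sqrt (1 - 2 * \<alpha>)"
    by (subst integral_gauss1) (use s in \<open>simp_all add: eq flip: q_def\<close>)
qed

lemma distr_gauss1_reflect:
  assumes cs: "c\<^sup>2 + s\<^sup>2 = 1"
  shows "distr (gauss1 \<Otimes>\<^sub>M gauss1) (gauss1 \<Otimes>\<^sub>M gauss1) (\<lambda>(u, v). (c * u + s * v, s * u - c * v)) = gauss1 \<Otimes>\<^sub>M gauss1"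
    (is "distr ?M ?M ?T = ?M")
proof (rule measure_eqI)
  have T[measurable]: "?T \<in> measurable ?M ?M" by measurable
  fix A assume "A \<in> sets (distr ?M ?M ?T)"
  then have A: "A \<in> sets ?M" by simp
  then have A'[measurable]: "A \<in> sets (borel \<Otimes>\<^sub>M borel)"
    using sets_pair_measure_cong[OF sets_gauss1 sets_gauss1] by simp
  have "emeasure (distr ?M ?M ?T) A = (\<integral>\<^sup>+z. indicator A (?T z) \<partial>?M)"
    using A by (subst nn_integral_indicator[symmetric], simp, subst nn_integral_distr) auto
  also have "\<dots> = (\<integral>\<^sup>+u. \<integral>\<^sup>+v. indicator A (c * u + s * v, s * u - c * v) \<partial>gauss1 \<partial>gauss1)"
    by (subst gauss1.nn_integral_fst[symmetric]) auto
  also have "\<dots> = (\<integral>\<^sup>+u. \<integral>\<^sup>+v. indicator A (u, v) \<partial>gauss1 \<partial>gauss1)"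
    by (rule nn_integral_gauss1_reflect[OF cs]) simp
  also have "\<dots> = emeasure ?M A"
    using A by (subst gauss1.nn_integral_fst) auto
  finally show "emeasure (distr ?M ?M ?T) A = emeasure ?M A" .
qed simp

lemma integral_gauss1_reflect:
  fixes g :: "real \<Rightarrow> real \<Rightarrow> real"
  assumes cs: "c\<^sup>2 + s\<^sup>2 = 1" and [measurable]: "case_prod g \<in> borel_measurable (borel \<Otimes>\<^sub>M borel)"
    and bdd: "bdd (case_prod g)"
  shows "(\<integral>u. \<integral>v. g (c * u + s * v) (s * u - c * v) \<partial>gauss1 \<partial>gauss1) = (\<integral>u. \<integral>v. g u v \<partial>gauss1 \<partial>gauss1)"
proof -
  let ?M = "gauss1 \<Otimes>\<^sub>M gauss1" and ?T = "\<lambda>(u, v). (c * u + s * v, s * u - c * v)"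
  have T[measurable]: "?T \<in> measurable ?M ?M" by measurable
  have g[measurable]: "case_prod g \<in> borel_measurable ?M"
    by measurable
  have "integrable ?M (\<lambda>z. case_prod g (?T z))"
    by (rule gauss1_pair.bdd_integrable[OF bdd_comp[OF bdd]]) measurable
  then have "(\<integral>u. \<integral>v. g (c * u + s * v) (s * u - c * v) \<partial>gauss1 \<partial>gauss1) = (\<integral>z. case_prod g (?T z) \<partial>?M)"
    by (subst gauss1_pair.integral_fst'[symmetric]) (auto simp: split_beta')
  also have "\<dots> = (\<integral>z. case_prod g z \<partial>?M)"
    using integral_distr[OF T g] distr_gauss1_reflect[OF cs] by simp
  also have "\<dots> = (\<integral>u. \<integral>v. g u v \<partial>gauss1 \<partial>gauss1)"
    by (subst gauss1_pair.integral_fst'[symmetric]) (auto intro: gauss1_pair.bdd_integrable bdd)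
  finally show ?thesis .
qed

text \<open>
  The Mehler kernel for the correlation \<open>1/4\<close>; any correlation for which the kernel is close enough
  to \<open>1\<close> in the sense of \<open>integral_mehler_diag\<close> would do.
\<close>

definition mehler :: "real \<Rightarrow> real \<Rightarrow> real" where
  "mehler x y = 4 / sqrt 15 * exp (- x\<^sup>2 / 30 + 4 * x * y / 15 - y\<^sup>2 / 30)"

definition noise1 :: "(real \<Rightarrow> real) \<Rightarrow> real \<Rightarrow> real" where
  "noise1 f x = (\<integral>z. f (1/4 * x + sqrt 15 / 4 * z) \<partial>gauss1)"

lemma noise1_kernel:
  assumes [measurable]: "f \<in> borel_measurable borel"
  shows "noise1 f x = (\<integral>y. mehler x y * f y \<partial>gauss1)"
proof -
  have "(\<integral>y. mehler x y * f y \<partial>gauss1) = (\<integral>y. std_normal_density y * (mehler x y * f y) \<partial>lborel)"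
    by (rule integral_gauss1) (simp add: mehler_def)
  also have "\<dots> = \<bar>sqrt 15 / 4\<bar> *\<^sub>R (\<integral>z. std_normal_density (1/4 * x + sqrt 15 / 4 * z)
      * (mehler x (1/4 * x + sqrt 15 / 4 * z) * f (1/4 * x + sqrt 15 / 4 * z)) \<partial>lborel)"
    by (rule lborel_integral_real_affine) simp
  also have "\<dots> = (\<integral>z. sqrt 15 / 4 * (std_normal_density (1/4 * x + sqrt 15 / 4 * z)
      * (mehler x (1/4 * x + sqrt 15 / 4 * z) * f (1/4 * x + sqrt 15 / 4 * z))) \<partial>lborel)"
    by simp
  also have "\<dots> = (\<integral>z. std_normal_density z * f (1/4 * x + sqrt 15 / 4 * z) \<partial>lborel)"
  proof (rule Bochner_Integration.integral_cong)
    fix z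
    let ?y = "1/4 * x + sqrt 15 / 4 * z"
    have "- ?y\<^sup>2 / 2 + (- x\<^sup>2 / 30 + 4 * x * ?y / 15 - ?y\<^sup>2 / 30) = - ((4 * ?y - x)\<^sup>2 / 15) / 2"
      by (simp add: power2_eq_square field_simps)
    also have "(4 * ?y - x)\<^sup>2 / 15 = z\<^sup>2"
      by (simp add: power2_eq_square)
    finally have "exp (- ?y\<^sup>2 / 2) * exp (- x\<^sup>2 / 30 + 4 * x * ?y / 15 - ?y\<^sup>2 / 30) = exp (- z\<^sup>2 / 2)"
      by (simp only: exp_add[symmetric] minus_divide_left)
    then have "sqrt 15 / 4 * (std_normal_density ?y * mehler x ?y) = std_normal_density z"
      by (simp add: std_normal_density_def mehler_def)
    then show "sqrt 15 / 4 * (std_normal_density ?y * (mehler x ?y * f ?y)) = std_normal_density z * f ?y"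
      by (metis mult.assoc)
  qed simp
  also have "\<dots> = noise1 f x"
    unfolding noise1_def by (rule integral_gauss1[symmetric]) simp
  finally show ?thesis ..
qed

lemma measurable_noise1 [measurable]:
  assumes [measurable]: "f \<in> borel_measurable borel"
  shows "noise1 f \<in> borel_measurable borel"
  unfolding noise1_def by measurable

lemma bdd_noise1: "bdd f \<Longrightarrow> bdd (noise1 f)"
  unfolding noise1_def
  by (rule gauss1.bdd_integral) (auto simp: split_beta' intro: bdd_comp)

lemma integrable_mehler: "integrable gauss1 (mehler x)" "integrable gauss1 (\<lambda>y. (mehler x y)\<^sup>2)"
  and integral_mehler: "(\<integral>y. mehler x y \<partial>gauss1) = 1"
  and integral_mehler2: "(\<integral>y. (mehler x y)\<^sup>2 \<partial>gauss1) = 16 / sqrt 255 * exp (x\<^sup>2 / 17)"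
proof -
  have 1: "mehler x = (\<lambda>y. (4 / sqrt 15 * exp (- x\<^sup>2 / 30)) * exp ((-1/30) * y\<^sup>2 + (4 * x / 15) * y))"
    by (simp add: mehler_def fun_eq_iff exp_add[symmetric] exp_diff field_simps)
  have 2: "(\<lambda>y. (mehler x y)\<^sup>2) = (\<lambda>y. (16 / 15 * exp (- x\<^sup>2 / 15)) * exp ((-1/15) * y\<^sup>2 + (8 * x / 15) * y))"
    unfolding 1 by (simp add: power_mult_distrib power_divide fun_eq_iff exp_double[symmetric] algebra_simps)
  show "integrable gauss1 (mehler x)" unfolding 1
    by (intro integrable_mult_right gaussian_exp_quadratic) simp
  show "integrable gauss1 (\<lambda>y. (mehler x y)\<^sup>2)" unfolding 2
    by (intro integrable_mult_right gaussian_exp_quadratic) simp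
  show "(\<integral>y. mehler x y \<partial>gauss1) = 1"
    using noise1_kernel[of "\<lambda>_. 1" x] by (simp add: noise1_def)
  have "(\<integral>y. (mehler x y)\<^sup>2 \<partial>gauss1) = (16 / 15 * exp (- x\<^sup>2 / 15)) * (exp ((8 * x / 15)\<^sup>2 / (2 * (1 - 2 * (-1/15)))) / sqrt (1 - 2 * (-1/15)))"
    unfolding 2 by (subst integral_mult_right_zero, subst gaussian_exp_quadratic(2)) auto
  also have "\<dots> = 16 / 15 / sqrt (17/15) * (exp (- x\<^sup>2 / 15) * exp (32 * x\<^sup>2 / 255))"
    by (simp add: power_mult_distrib power_divide)
  also have "exp (- x\<^sup>2 / 15) * exp (32 * x\<^sup>2 / 255) = exp (x\<^sup>2 / 17)"
    by (simp add: exp_add[symmetric])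
  also have "16 / 15 / sqrt (17/15) = 16 / sqrt 255"
  proof -
    have "15 * sqrt (17/15) = sqrt (15\<^sup>2 * (17/15))" by (simp only: real_sqrt_mult real_sqrt_abs)
    also have "\<dots> = sqrt 255" by simp
    finally show ?thesis by (simp add: field_simps)
  qed
  finally show "(\<integral>y. (mehler x y)\<^sup>2 \<partial>gauss1) = 16 / sqrt 255 * exp (x\<^sup>2 / 17)" .
qed

lemma integrable_mehler_diag:
    "integrable gauss1 (\<lambda>x. 16 / sqrt 255 * exp (x\<^sup>2 / 17) - 1)"
    "integrable gauss1 (\<lambda>x. (16 / sqrt 255 * exp (x\<^sup>2 / 17) - 1)\<^sup>2)"
  and integral_mehler_diag: "(\<integral>x. 16 / sqrt 255 * exp (x\<^sup>2 / 17) - 1 \<partial>gauss1) = 1 / 15"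
    "(\<integral>x. (16 / sqrt 255 * exp (x\<^sup>2 / 17) - 1)\<^sup>2 \<partial>gauss1) \<le> 1 / 20"
proof -
  have i1: "integrable gauss1 (\<lambda>x. exp (x\<^sup>2 / 17))" and e1: "(\<integral>x. exp (x\<^sup>2 / 17) \<partial>gauss1) = 1 / sqrt (15/17)"
    using gaussian_exp_quadratic[of "1/17" 0] by simp_all
  have i2: "integrable gauss1 (\<lambda>x. exp (2 * x\<^sup>2 / 17))" and e2: "(\<integral>x. exp (2 * x\<^sup>2 / 17) \<partial>gauss1) = 1 / sqrt (13/17)"
    using gaussian_exp_quadratic[of "2/17" 0] by simp_all
  have sq: "(16 / sqrt 255 * exp (x\<^sup>2 / 17) - 1)\<^sup>2 = 256/255 * exp (2 * x\<^sup>2 / 17) - 32 / sqrt 255 * exp (x\<^sup>2 / 17) + 1" for x :: real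
    using exp_double[of "x\<^sup>2 / 17"] by (simp add: power2_diff power_mult_distrib power_divide)
  have m: "16 / sqrt 255 * (1 / sqrt (15/17)) = 16 / 15"
  proof -
    have "sqrt 255 * sqrt (15/17) = sqrt (15\<^sup>2)" by (simp flip: real_sqrt_mult)
    then show ?thesis by simp
  qed
  have n: "1 / sqrt (13/17) \<le> 11437/10000"
  proof -
    have "10000/11437 \<le> sqrt (13/17)" by (rule real_le_rsqrt) (simp add: power2_eq_square)
    then show ?thesis by (simp add: field_simps)
  qed
  show "integrable gauss1 (\<lambda>x. 16 / sqrt 255 * exp (x\<^sup>2 / 17) - 1)"
    using i1 by simp
  show "integrable gauss1 (\<lambda>x. (16 / sqrt 255 * exp (x\<^sup>2 / 17) - 1)\<^sup>2)"
    unfolding sq using i1 i2 by simp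
  show "(\<integral>x. 16 / sqrt 255 * exp (x\<^sup>2 / 17) - 1 \<partial>gauss1) = 1 / 15"
  proof -
    have "(\<integral>x. 16 / sqrt 255 * exp (x\<^sup>2 / 17) - 1 \<partial>gauss1) = 16 / sqrt 255 * (1 / sqrt (15/17)) - 1"
      using i1 by (simp add: e1)
    then show ?thesis unfolding m by simp
  qed
  have "(\<integral>x. (16 / sqrt 255 * exp (x\<^sup>2 / 17) - 1)\<^sup>2 \<partial>gauss1) = 256/255 * (1 / sqrt (13/17)) - 2 * (16 / sqrt 255 * (1 / sqrt (15/17))) + 1"
    unfolding sq using i1 i2 by (simp add: e1 e2 mult.commute)
  also have "\<dots> \<le> 1 / 20" unfolding m using n by linarith
  finally show "(\<integral>x. (16 / sqrt 255 * exp (x\<^sup>2 / 17) - 1)\<^sup>2 \<partial>gauss1) \<le> 1 / 20" .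
qed

lemma integral_noise1:
  assumes [measurable]: "f \<in> borel_measurable borel" "g \<in> borel_measurable borel" and "bdd f" "bdd g"
  shows "(\<integral>x. f x * noise1 g x \<partial>gauss1) = (\<integral>x. noise1 f x * g x \<partial>gauss1)"
proof -
  have "(\<integral>x. f x * noise1 g x \<partial>gauss1) = (\<integral>u. \<integral>v. f u * g (1/4 * u + sqrt 15 / 4 * v) \<partial>gauss1 \<partial>gauss1)"
    by (simp add: noise1_def)
  also have "\<dots> = (\<integral>u. \<integral>v. f (1/4 * u + sqrt 15 / 4 * v) * g (1/4 * (1/4 * u + sqrt 15 / 4 * v) + sqrt 15 / 4 * (sqrt 15 / 4 * u - 1/4 * v)) \<partial>gauss1 \<partial>gauss1)"
  proof (rule integral_gauss1_reflect[symmetric])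
    show "bdd (\<lambda>(u, v). f u * g (1/4 * u + sqrt 15 / 4 * v))"
      unfolding split_beta' by (intro bdd_mult bdd_comp[OF \<open>bdd f\<close>] bdd_comp[OF \<open>bdd g\<close>])
  qed (auto simp: power_divide)
  also have "\<dots> = (\<integral>u. \<integral>v. f (1/4 * u + sqrt 15 / 4 * v) * g u \<partial>gauss1 \<partial>gauss1)"
  proof -
    have "1/4 * (1/4 * u + sqrt 15 / 4 * v) + sqrt 15 / 4 * (sqrt 15 / 4 * u - 1/4 * v) = u" for u v
      by (simp add: algebra_simps)
    then show ?thesis by simp
  qed
  also have "\<dots> = (\<integral>x. noise1 f x * g x \<partial>gauss1)"
    by (simp add: noise1_def)
  finally show ?thesis .
qed

lemma noise1_diff:
  assumes "f \<in> borel_measurable borel" "bdd f"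
  shows "noise1 (\<lambda>x. f x - c) x = noise1 f x - c"
proof -
  have "integrable gauss1 (\<lambda>z. f (1/4 * x + sqrt 15 / 4 * z))"
    using assms(1) by (intro gauss1.bdd_integrable bdd_comp[OF assms(2)]) auto
  then show ?thesis by (simp add: noise1_def)
qed

text \<open>
  For mean zero \<open>h\<close> the \<open>L\<^sup>4\<close> norm of \<open>noise1 h\<close> is so small compared with the \<open>L\<^sup>2\<close> norm of \<open>h\<close> that
  the expansion of \<open>(c + noise1 h)\<^sup>4\<close> is dominated by that of \<open>(c\<^sup>2 + h\<^sup>2)\<^sup>2\<close>.
\<close>

lemma noise1_hypercontractive:
  assumes [measurable]: "f \<in> borel_measurable borel" and f: "bdd f"
  shows "(\<integral>x. noise1 f x ^ 4 \<partial>gauss1) \<le> (\<integral>x. (f x)\<^sup>2 \<partial>gauss1)\<^sup>2"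
proof -
  define c where "c = (\<integral>x. f x \<partial>gauss1)"
  define h where "h x = f x - c" for x
  define u where "u = noise1 h"
  define V where "V = (\<integral>x. (h x)\<^sup>2 \<partial>gauss1)"
  have [measurable]: "h \<in> borel_measurable borel" unfolding h_def by measurable
  have [measurable]: "u \<in> borel_measurable borel" unfolding u_def by measurable
  have h: "bdd h" unfolding h_def using f by (intro bdd_intros)
  have u: "bdd u" unfolding u_def using h by (rule bdd_noise1)
  have iup: "integrable gauss1 (\<lambda>x. u x ^ n)" for n
    by (rule gauss1.bdd_integrable) (use u in \<open>auto intro: bdd_power\<close>)
  have iu: "integrable gauss1 u" using iup[of 1] by simp
  have ihp: "integrable gauss1 (\<lambda>x. h x ^ n)" for n
    by (rule gauss1.bdd_integrable) (use h in \<open>auto intro: bdd_power\<close>)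
  have ih: "integrable gauss1 h" using ihp[of 1] by simp
  have intf: "integrable gauss1 f" by (rule gauss1.bdd_integrable) (use f in auto)
  have Eh: "(\<integral>x. h x \<partial>gauss1) = 0"
    unfolding h_def c_def using intf by simp
  have V0: "0 \<le> V" unfolding V_def by simp
  have Ef2: "(\<integral>x. (f x)\<^sup>2 \<partial>gauss1) = c\<^sup>2 + V"
  proof -
    have "(f x)\<^sup>2 = c\<^sup>2 + 2 * c * h x + (h x)\<^sup>2" for x
      by (simp add: h_def power2_eq_square algebra_simps)
    then have "(\<integral>x. (f x)\<^sup>2 \<partial>gauss1) = (\<integral>x. c\<^sup>2 + 2 * c * h x + (h x)\<^sup>2 \<partial>gauss1)" by simp
    also have "\<dots> = c\<^sup>2 + 2 * c * (\<integral>x. h x \<partial>gauss1) + V"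
      using ih ihp[of 2] by (simp add: V_def)
    finally show ?thesis using Eh by simp
  qed
  have Eu: "(\<integral>x. u x \<partial>gauss1) = 0"
    using integral_noise1[of "\<lambda>_. 1" h] h Eh by (simp add: u_def noise1_def)
  let ?m = "\<lambda>x. 16 / sqrt 255 * exp (x\<^sup>2 / 17) - 1"
  have ux: "(u x)\<^sup>2 \<le> V * ?m x" for x
  proof -
    have [measurable]: "mehler x \<in> borel_measurable borel" by (simp add: mehler_def[abs_def])
    have i: "integrable gauss1 (\<lambda>y. mehler x y * h y)"
    proof -
      obtain B where B: "0 \<le> B" "\<And>x. \<bar>h x\<bar> \<le> B" using h by (metis bddE)
      have "integrable gauss1 (\<lambda>y. B * mehler x y)" using integrable_mehler by simp
      then show ?thesis
        by (rule Bochner_Integration.integrable_bound)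
          (use B in \<open>auto simp: abs_mult mult.commute intro!: mult_right_mono AE_I2\<close>)
    qed
    have "(\<integral>y. h y * (mehler x y - 1) \<partial>gauss1) = (\<integral>y. mehler x y * h y - h y \<partial>gauss1)"
      by (intro Bochner_Integration.integral_cong) (auto simp: algebra_simps)
    also have "\<dots> = u x"
      unfolding u_def noise1_kernel[OF \<open>h \<in> borel_measurable borel\<close>]
      using Bochner_Integration.integral_diff[OF i ih] Eh by simp
    finally have "u x = (\<integral>y. h y * (mehler x y - 1) \<partial>gauss1)" ..
    moreover have "(\<integral>y. h y * (mehler x y - 1) \<partial>gauss1)\<^sup>2 \<le> V * (\<integral>y. (mehler x y - 1)\<^sup>2 \<partial>gauss1)"
      unfolding V_def
    proof (rule integral_Cauchy_Schwarz)
      show "integrable gauss1 (\<lambda>y. (mehler x y - 1)\<^sup>2)"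
        using integrable_mehler[of x] by (simp add: power2_diff)
    qed (use ihp[of 2] in auto)
    ultimately have "(u x)\<^sup>2 \<le> V * (\<integral>y. (mehler x y - 1)\<^sup>2 \<partial>gauss1)" by simp
    also have "(\<integral>y. (mehler x y - 1)\<^sup>2 \<partial>gauss1) = ?m x"
      using integrable_mehler[of x] by (simp add: power2_diff integral_mehler integral_mehler2)
    finally show ?thesis .
  qed
  have E2: "(\<integral>x. (u x)\<^sup>2 \<partial>gauss1) \<le> V * (1 / 15)"
  proof -
    have "(\<integral>x. (u x)\<^sup>2 \<partial>gauss1) \<le> (\<integral>x. V * ?m x \<partial>gauss1)"
      by (intro integral_mono integrable_mult_right integrable_mehler_diag ux iup)
    then show ?thesis by (subst (asm) integral_mult_right_zero, subst (asm) integral_mehler_diag)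
  qed
  have E4: "(\<integral>x. u x ^ 4 \<partial>gauss1) \<le> V\<^sup>2 * (1 / 20)"
  proof -
    have "u x ^ 4 \<le> V\<^sup>2 * (?m x)\<^sup>2" for x
      using power_mono[OF ux[of x], of 2] by (simp add: power_mult_distrib flip: power_mult)
    then have "(\<integral>x. u x ^ 4 \<partial>gauss1) \<le> (\<integral>x. V\<^sup>2 * (?m x)\<^sup>2 \<partial>gauss1)"
      by (intro integral_mono integrable_mult_right integrable_mehler_diag iup)
    also have "\<dots> = V\<^sup>2 * (\<integral>x. (?m x)\<^sup>2 \<partial>gauss1)" by simp
    also have "\<dots> \<le> V\<^sup>2 * (1 / 20)"
      by (intro mult_left_mono integral_mehler_diag) simp
    finally show ?thesis .
  qed
  have nf: "noise1 f x = c + u x" for x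
    unfolding u_def h_def using noise1_diff[OF assms, of c x] by simp
  have pt: "(c + a) ^ 4 \<le> c ^ 4 + 4 * c ^ 3 * a + 8 * c\<^sup>2 * a\<^sup>2 + 3 * a ^ 4" for a
  proof -
    have "c ^ 4 + 4 * c ^ 3 * a + 8 * c\<^sup>2 * a\<^sup>2 + 3 * a ^ 4 - (c + a) ^ 4 = 2 * a\<^sup>2 * (c - a)\<^sup>2"
      by (simp add: power2_eq_square power3_eq_cube power4_eq_xxxx algebra_simps)
    moreover have "0 \<le> 2 * a\<^sup>2 * (c - a)\<^sup>2" by simp
    ultimately show ?thesis by linarith
  qed
  have "(\<integral>x. noise1 f x ^ 4 \<partial>gauss1) \<le> (\<integral>x. c ^ 4 + 4 * c ^ 3 * u x + 8 * c\<^sup>2 * (u x)\<^sup>2 + 3 * u x ^ 4 \<partial>gauss1)"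
    unfolding nf
    by (intro integral_mono pt gauss1.bdd_integrable bdd_intros u) measurable
  also have "\<dots> = c ^ 4 + 8 * c\<^sup>2 * (\<integral>x. (u x)\<^sup>2 \<partial>gauss1) + 3 * (\<integral>x. u x ^ 4 \<partial>gauss1)"
    using iu iup[of 2] iup[of 4] Eu by simp
  also have "\<dots> \<le> c ^ 4 + 8 * c\<^sup>2 * (V * (1/15)) + 3 * (V\<^sup>2 * (1/20))"
    by (intro add_mono mult_left_mono E2 E4) auto
  also have "\<dots> \<le> (c\<^sup>2 + V)\<^sup>2"
  proof -
    have "(c\<^sup>2 + V)\<^sup>2 - (c ^ 4 + 8 * c\<^sup>2 * (V * (1/15)) + 3 * (V\<^sup>2 * (1/20))) = 22/15 * (c\<^sup>2 * V) + 17/20 * V\<^sup>2"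
      by (simp add: power2_eq_square power4_eq_xxxx algebra_simps)
    moreover have "0 \<le> 22/15 * (c\<^sup>2 * V) + 17/20 * V\<^sup>2" using V0 by simp
    ultimately show ?thesis by linarith
  qed
  finally show ?thesis unfolding Ef2 .
qed

definition norm4 :: "'a measure \<Rightarrow> ('a \<Rightarrow> real) \<Rightarrow> real" where
  "norm4 M k = sqrt (sqrt (\<integral>x. k x ^ 4 \<partial>M))"

definition norm2 :: "'a measure \<Rightarrow> ('a \<Rightarrow> real) \<Rightarrow> real" where
  "norm2 M k = sqrt (\<integral>x. (k x)\<^sup>2 \<partial>M)"

lemma norm4_nonneg [simp]: "0 \<le> norm4 M k" and norm2_nonneg [simp]: "0 \<le> norm2 M k"
  by (simp_all add: norm4_def norm2_def)

lemma norm4_pow: "norm4 M k ^ 4 = (\<integral>x. k x ^ 4 \<partial>M)"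
proof -
  have "norm4 M k ^ 4 = ((norm4 M k)\<^sup>2)\<^sup>2" by (simp flip: power_mult)
  then show ?thesis by (simp add: norm4_def)
qed

lemma norm2_pow: "(norm2 M k)\<^sup>2 = (\<integral>x. (k x)\<^sup>2 \<partial>M)"
  by (simp add: norm2_def)

lemma (in prob_space) holder4:
  assumes [measurable]: "g \<in> borel_measurable M" "k \<in> borel_measurable M" and "bdd g" "bdd k"
  shows "\<bar>\<integral>x. g x * k x ^ 3 \<partial>M\<bar> \<le> norm4 M g * norm4 M k ^ 3"
proof -
  have i: "integrable M (\<lambda>x. (g x * k x)\<^sup>2)" "integrable M (\<lambda>x. ((k x)\<^sup>2)\<^sup>2)" "integrable M (\<lambda>x. ((g x)\<^sup>2)\<^sup>2)"
    using assms(3,4) by (auto intro!: bdd_integrable bdd_intros)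
  have eq: "g x * k x ^ 3 = (g x * k x) * (k x)\<^sup>2" for x
    by (simp add: power3_eq_cube power2_eq_square)
  have p4: "((a::real)\<^sup>2)\<^sup>2 = a ^ 4" for a by simp
  have "(\<integral>x. g x * k x ^ 3 \<partial>M)\<^sup>2 \<le> (\<integral>x. (g x * k x)\<^sup>2 \<partial>M) * (\<integral>x. ((k x)\<^sup>2)\<^sup>2 \<partial>M)"
    unfolding eq by (rule integral_Cauchy_Schwarz) (use i in auto)
  also have "\<dots> \<le> ((norm4 M g)\<^sup>2 * (norm4 M k)\<^sup>2) * norm4 M k ^ 4"
  proof (rule mult_mono)
    have "(\<integral>x. (g x * k x)\<^sup>2 \<partial>M)\<^sup>2 \<le> (\<integral>x. ((g x)\<^sup>2)\<^sup>2 \<partial>M) * (\<integral>x. ((k x)\<^sup>2)\<^sup>2 \<partial>M)"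
      unfolding power_mult_distrib by (rule integral_Cauchy_Schwarz) (use i in auto)
    also have "\<dots> = ((norm4 M g)\<^sup>2 * (norm4 M k)\<^sup>2)\<^sup>2"
      unfolding p4 norm4_pow[symmetric] by (simp add: power_mult_distrib flip: power_mult)
    finally show "(\<integral>x. (g x * k x)\<^sup>2 \<partial>M) \<le> (norm4 M g)\<^sup>2 * (norm4 M k)\<^sup>2"
      by (rule power2_le_imp_le) simp
  qed (simp_all add: norm4_pow)
  also have "\<dots> = (norm4 M g * norm4 M k ^ 3)\<^sup>2"
    by (simp add: power2_eq_square power3_eq_cube power4_eq_xxxx)
  finally have "\<bar>\<integral>x. g x * k x ^ 3 \<partial>M\<bar>\<^sup>2 \<le> (norm4 M g * norm4 M k ^ 3)\<^sup>2" by simp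
  then show ?thesis by (rule power2_le_imp_le) simp
qed

lemma noise1_two_function:
  assumes [measurable]: "f \<in> borel_measurable borel" "k \<in> borel_measurable borel" and "bdd f" "bdd k"
  shows "\<bar>\<integral>u. \<integral>v. f u * k (1/4 * u + sqrt 15 / 4 * v) ^ 3 \<partial>gauss1 \<partial>gauss1\<bar> \<le> norm2 gauss1 f * norm4 gauss1 k ^ 3"
proof -
  have "(\<integral>u. \<integral>v. f u * k (1/4 * u + sqrt 15 / 4 * v) ^ 3 \<partial>gauss1 \<partial>gauss1) = (\<integral>u. f u * noise1 (\<lambda>x. k x ^ 3) u \<partial>gauss1)"
    by (simp add: noise1_def)
  also have "\<dots> = (\<integral>u. noise1 f u * k u ^ 3 \<partial>gauss1)"
    by (rule integral_noise1) (use assms in \<open>auto intro: bdd_power\<close>)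
  finally have "\<bar>\<integral>u. \<integral>v. f u * k (1/4 * u + sqrt 15 / 4 * v) ^ 3 \<partial>gauss1 \<partial>gauss1\<bar> \<le> norm4 gauss1 (noise1 f) * norm4 gauss1 k ^ 3"
    using gauss1.holder4[of "noise1 f" k] assms bdd_noise1[of f] by simp
  also have "\<dots> \<le> norm2 gauss1 f * norm4 gauss1 k ^ 3"
  proof (rule mult_right_mono)
    have "sqrt (\<integral>x. noise1 f x ^ 4 \<partial>gauss1) \<le> (\<integral>x. (f x)\<^sup>2 \<partial>gauss1)"
      using noise1_hypercontractive[OF assms(1,3)] by (intro real_le_lsqrt) auto
    then show "norm4 gauss1 (noise1 f) \<le> norm2 gauss1 f"
      by (simp add: norm4_def norm2_def)
  qed simp
  finally show ?thesis .
qed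

lemma integral_gauss_insert:
  fixes f :: "('i \<Rightarrow> real) \<Rightarrow> real"
  assumes I: "finite I" "i \<notin> I"
    and f[measurable]: "f \<in> borel_measurable (Pi\<^sub>M (insert i I) (\<lambda>_. borel))" and "bdd f"
  shows "(\<integral>x. f x \<partial>gauss (insert i I)) = (\<integral>u. \<integral>x. f (x(i := u)) \<partial>gauss I \<partial>gauss1)"
proof -
  have "integrable (gauss (insert i I)) f"
    using \<open>bdd f\<close> by (rule gauss.bdd_integrable) measurable
  then have "(\<integral>x. f x \<partial>gauss (insert i I)) = (\<integral>x. \<integral>u. f (x(i := u)) \<partial>gauss1 \<partial>gauss I)"
    unfolding gauss_def by (rule gauss1_prod.product_integral_insert[OF I])
  also have "\<dots> = (\<integral>u. \<integral>x. f (x(i := u)) \<partial>gauss I \<partial>gauss1)"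
  proof (rule gauss_gauss1.Fubini_integral[symmetric], rule gauss_gauss1.bdd_integrable)
    show "bdd (\<lambda>(x, u). f (x(i := u)))"
      unfolding split_beta' by (rule bdd_comp[OF \<open>bdd f\<close>])
  qed measurable
  finally show ?thesis .
qed

lemma (in prob_space) norm2_le:
  assumes "0 \<le> B" "\<And>x. \<bar>f x\<bar> \<le> B" and [measurable]: "f \<in> borel_measurable M"
  shows "norm2 M f \<le> B"
proof -
  have "\<bar>\<integral>x. (f x)\<^sup>2 \<partial>M\<bar> \<le> B\<^sup>2"
    by (rule abs_integral_le) (use assms in \<open>auto simp: abs_le_square_iff[symmetric]\<close>)
  then show ?thesis unfolding norm2_def using assms(1) by (intro real_le_lsqrt) auto
qed

lemma (in prob_space) norm4_le:
  assumes "0 \<le> B" "\<And>x. \<bar>f x\<bar> \<le> B" and [measurable]: "f \<in> borel_measurable M"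
  shows "norm4 M f \<le> B"
proof -
  have "\<bar>\<integral>x. f x ^ 4 \<partial>M\<bar> \<le> B ^ 4"
  proof (rule abs_integral_le)
    fix x show "\<bar>f x ^ 4\<bar> \<le> B ^ 4" using power_mono[OF assms(2)[of x], of 4] by (simp add: power_abs)
  qed simp
  then have "norm4 M f ^ 4 \<le> B ^ 4" by (simp add: norm4_pow)
  then show ?thesis using assms(1) by (metis power_mono_iff norm4_nonneg zero_less_numeral)
qed

text \<open>
  Hypercontractivity from \<open>L\<^bsup>4/3\<^esup>\<close> to \<open>L\<^sup>2\<close> in its bilinear form, which tensorizes; the function in
  \<open>L\<^bsup>4/3\<^esup>\<close> is written as a cube \<open>k\<^sup>3\<close> so that only integer powers occur.
\<close>

lemma noise_two_function:
  fixes f k :: "('i \<Rightarrow> real) \<Rightarrow> real"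
  assumes "finite I"
    and "f \<in> borel_measurable (Pi\<^sub>M I (\<lambda>_. borel))" "k \<in> borel_measurable (Pi\<^sub>M I (\<lambda>_. borel))"
    and "bdd f" "bdd k"
  shows "\<bar>\<integral>x. \<integral>y. f x * k (lin I (1/4) (sqrt 15 / 4) x y) ^ 3 \<partial>gauss I \<partial>gauss I\<bar>
    \<le> norm2 (gauss I) f * norm4 (gauss I) k ^ 3"
  using assms
proof (induction I arbitrary: f k rule: finite_induct)
  case empty
  have *: "lin {} a b x y = (\<lambda>_. undefined)" for a b x and y :: "'i \<Rightarrow> real"
    by (auto simp: lin_def)
  have cong: "(\<integral>x. g x \<partial>gauss {}) = g (\<lambda>_. undefined)" for g :: "('i \<Rightarrow> real) \<Rightarrow> real"
  proof -
    have "(\<integral>x. g x \<partial>gauss {}) = (\<integral>x. g (\<lambda>_. undefined) \<partial>gauss ({}::'i set))"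
      by (intro Bochner_Integration.integral_cong) (auto simp: space_gauss)
    then show ?thesis by (simp add: gauss.prob_space)
  qed
  have "norm4 (gauss {}) k ^ 3 = \<bar>k (\<lambda>_. undefined)\<bar> ^ 3"
  proof -
    have "norm4 (gauss {}) k ^ 4 = \<bar>k (\<lambda>_. undefined)\<bar> ^ 4"
      unfolding norm4_pow cong by simp
    then have "norm4 (gauss {}) k = \<bar>k (\<lambda>_. undefined)\<bar>"
      by (metis abs_ge_zero norm4_nonneg power_eq_iff_eq_base zero_less_numeral)
    then show ?thesis by simp
  qed
  then show ?case by (simp add: * cong norm2_def abs_mult power_abs gauss.prob_space)
next
  case (insert i I)
  note [measurable] = insert.prems(1,2)
  let ?J = "insert i I" and ?r = "1/4 :: real" and ?s = "sqrt 15 / 4 :: real"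
  obtain Cf where Cf: "0 \<le> Cf" "\<And>x. \<bar>f x\<bar> \<le> Cf" using insert.prems(3) by (metis bddE)
  obtain Ck where Ck: "0 \<le> Ck" "\<And>x. \<bar>k x\<bar> \<le> Ck" using insert.prems(4) by (metis bddE)
  define A where "A u = norm2 (gauss I) (\<lambda>x. f (x(i := u)))" for u
  define B where "B u = norm4 (gauss I) (\<lambda>x. k (x(i := u)))" for u
  define h where "h u v = (\<integral>x. \<integral>y. f (x(i := u)) * k ((lin I ?r ?s x y)(i := ?r * u + ?s * v)) ^ 3 \<partial>gauss I \<partial>gauss I)" for u v
  have [measurable]: "A \<in> borel_measurable borel" unfolding A_def norm2_def by measurable
  have [measurable]: "B \<in> borel_measurable borel" unfolding B_def norm4_def by measurable
  have [measurable]: "case_prod h \<in> borel_measurable (borel \<Otimes>\<^sub>M borel)" unfolding h_def by measurable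
  have bA: "bdd A"
  proof (rule bddI)
    fix u show "\<bar>A u\<bar> \<le> Cf" unfolding A_def using Cf by (simp add: gauss.norm2_le)
  qed
  have bB: "bdd B"
  proof (rule bddI)
    fix u show "\<bar>B u\<bar> \<le> Ck" unfolding B_def using Ck by (simp add: gauss.norm4_le)
  qed
  have hAB: "\<bar>h u v\<bar> \<le> A u * B (?r * u + ?s * v) ^ 3" for u v
    unfolding h_def A_def B_def
    by (rule insert.IH[of "\<lambda>x. f (x(i := u))" "\<lambda>x. k (x(i := ?r * u + ?s * v))"])
      (measurable, rule bdd_comp[OF \<open>bdd f\<close>], rule bdd_comp[OF \<open>bdd k\<close>])
  have bAB: "bdd (\<lambda>(u, v). A u * B (?r * u + ?s * v) ^ 3)"
    unfolding split_beta' by (intro bdd_mult bdd_power bdd_comp[OF bA] bdd_comp[OF bB])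
  have bh: "bdd (case_prod h)"
    using bAB by (rule bdd_mono) (use order_trans[OF hAB abs_ge_self] in \<open>simp add: split_beta'\<close>)
  have g_bdd: "bdd (\<lambda>(x, y). f (x(i := u)) * k (lin ?J ?r ?s (x(i := u)) y) ^ 3)" for u
    unfolding split_beta' by (intro bdd_mult bdd_power bdd_comp[OF \<open>bdd f\<close>] bdd_comp[OF \<open>bdd k\<close>])
  have "(\<integral>x. \<integral>y. f x * k (lin ?J ?r ?s x y) ^ 3 \<partial>gauss ?J \<partial>gauss ?J)
     = (\<integral>u. \<integral>x. \<integral>y. f (x(i := u)) * k (lin ?J ?r ?s (x(i := u)) y) ^ 3 \<partial>gauss ?J \<partial>gauss I \<partial>gauss1)"
  proof (rule integral_gauss_insert[OF insert(1,2)])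
    have "bdd (\<lambda>(x, y). f x * k (lin ?J ?r ?s x y) ^ 3)"
      unfolding split_beta' by (intro bdd_mult bdd_power bdd_comp[OF \<open>bdd f\<close>] bdd_comp[OF \<open>bdd k\<close>])
    then show "bdd (\<lambda>x. \<integral>y. f x * k (lin ?J ?r ?s x y) ^ 3 \<partial>gauss ?J)"
      by (rule gauss.bdd_integral)
  qed measurable
  also have "\<dots> = (\<integral>u. \<integral>v. h u v \<partial>gauss1 \<partial>gauss1)"
  proof (rule Bochner_Integration.integral_cong[OF refl])
    fix u
    have slice: "(\<integral>y. f (x(i := u)) * k (lin ?J ?r ?s (x(i := u)) y) ^ 3 \<partial>gauss ?J)
       = (\<integral>v. \<integral>y. f (x(i := u)) * k ((lin I ?r ?s x y)(i := ?r * u + ?s * v)) ^ 3 \<partial>gauss I \<partial>gauss1)" (is "?L = _")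
      if "x \<in> space (gauss I)" for x
    proof -
      have [measurable]: "x(i := u) \<in> space (Pi\<^sub>M ?J (\<lambda>_. borel))"
        using that by (auto simp: space_gauss space_PiM PiE_def extensional_def)
      have "?L = (\<integral>v. \<integral>y. f (x(i := u)) * k (lin ?J ?r ?s (x(i := u)) (y(i := v))) ^ 3 \<partial>gauss I \<partial>gauss1)"
      proof (rule integral_gauss_insert[OF insert(1,2)])
        show "bdd (\<lambda>y. f (x(i := u)) * k (lin ?J ?r ?s (x(i := u)) y) ^ 3)"
          by (intro bdd_mult bdd_power bdd_comp[OF \<open>bdd k\<close>] bdd_const)
      qed measurable
      then show ?thesis using lin_insert[OF insert(2)] by simp
    qed
    have "(\<integral>x. \<integral>y. f (x(i := u)) * k (lin ?J ?r ?s (x(i := u)) y) ^ 3 \<partial>gauss ?J \<partial>gauss I)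
       = (\<integral>x. \<integral>v. \<integral>y. f (x(i := u)) * k ((lin I ?r ?s x y)(i := ?r * u + ?s * v)) ^ 3 \<partial>gauss I \<partial>gauss1 \<partial>gauss I)"
      by (intro Bochner_Integration.integral_cong refl slice)
    also have "\<dots> = (\<integral>v. h u v \<partial>gauss1)"
      unfolding h_def
    proof (rule gauss_gauss1.Fubini_integral[symmetric], rule gauss_gauss1.bdd_integrable)
      have "bdd (\<lambda>(z, y). f ((fst z)(i := u)) * k ((lin I ?r ?s (fst z) y)(i := ?r * u + ?s * (snd z))) ^ 3)"
        unfolding split_beta' by (intro bdd_mult bdd_power bdd_comp[OF \<open>bdd f\<close>] bdd_comp[OF \<open>bdd k\<close>])
      from gauss.bdd_integral[OF this]
      show "bdd (\<lambda>(x, v). \<integral>y. f (x(i := u)) * k ((lin I ?r ?s x y)(i := ?r * u + ?s * v)) ^ 3 \<partial>gauss I)"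
        by (simp add: split_beta')
    qed measurable
    finally show "(\<integral>x. \<integral>y. f (x(i := u)) * k (lin ?J ?r ?s (x(i := u)) y) ^ 3 \<partial>gauss ?J \<partial>gauss I) = (\<integral>v. h u v \<partial>gauss1)" .
  qed
  finally have T: "(\<integral>x. \<integral>y. f x * k (lin ?J ?r ?s x y) ^ 3 \<partial>gauss ?J \<partial>gauss ?J) = (\<integral>z. case_prod h z \<partial>(gauss1 \<Otimes>\<^sub>M gauss1))"
    using bh by (simp add: gauss1_pair.integral_fst[symmetric] gauss1_pair.bdd_integrable)
  have nA: "norm2 gauss1 A = norm2 (gauss ?J) f"
  proof -
    have "(\<integral>x. (f x)\<^sup>2 \<partial>gauss ?J) = (\<integral>u. \<integral>x. (f (x(i := u)))\<^sup>2 \<partial>gauss I \<partial>gauss1)"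
      by (rule integral_gauss_insert[OF insert(1,2)]) (use insert.prems in \<open>auto intro: bdd_power\<close>)
    then show ?thesis by (simp add: norm2_def A_def)
  qed
  have nB: "norm4 gauss1 B = norm4 (gauss ?J) k"
  proof -
    have "(\<integral>x. (k x) ^ 4 \<partial>gauss ?J) = (\<integral>u. \<integral>x. (k (x(i := u))) ^ 4 \<partial>gauss I \<partial>gauss1)"
      by (rule integral_gauss_insert[OF insert(1,2)]) (use insert.prems in \<open>auto intro: bdd_power\<close>)
    then have "(\<integral>u. B u ^ 4 \<partial>gauss1) = (\<integral>x. (k x) ^ 4 \<partial>gauss ?J)" by (simp add: norm4_pow B_def)
    then show ?thesis unfolding norm4_def by simp
  qed
  have "\<bar>\<integral>z. case_prod h z \<partial>(gauss1 \<Otimes>\<^sub>M gauss1)\<bar> \<le> (\<integral>z. \<bar>case_prod h z\<bar> \<partial>(gauss1 \<Otimes>\<^sub>M gauss1))"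
    by (rule integral_abs_bound)
  also have "\<dots> \<le> (\<integral>z. (case z of (u, v) \<Rightarrow> A u * B (?r * u + ?s * v) ^ 3) \<partial>(gauss1 \<Otimes>\<^sub>M gauss1))"
    by (intro integral_mono gauss1_pair.bdd_integrable bdd_abs bh bAB) (use hAB in auto)
  also have "\<dots> = (\<integral>u. \<integral>v. A u * B (?r * u + ?s * v) ^ 3 \<partial>gauss1 \<partial>gauss1)"
    using bAB by (subst gauss1_pair.integral_fst) (auto intro!: gauss1_pair.bdd_integrable)
  also have "\<dots> \<le> norm2 gauss1 A * norm4 gauss1 B ^ 3"
    using noise1_two_function[OF _ _ bA bB] by (simp add: abs_le_iff)
  finally show ?case unfolding T nA nB .
qed

section \<open>The Ornstein--Uhlenbeck semigroup\<close>

lemma measurable_gauss_iff: "measurable (gauss I) N = measurable (Pi\<^sub>M I (\<lambda>_. borel)) N"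
  by (rule measurable_cong_sets) (auto simp: sets_gauss)

lemma distr_gauss_component: "i \<in> I \<Longrightarrow> distr (gauss I) gauss1 (\<lambda>x. x i) = gauss1"
  unfolding gauss_def by (rule distr_PiM_component) (rule prob_space_gauss1)

lemma gauss_component:
  fixes f :: "real \<Rightarrow> real"
  assumes "i \<in> I" and [measurable]: "f \<in> borel_measurable borel"
  shows integrable_gauss_component: "integrable (gauss I) (\<lambda>x. f (x i)) \<longleftrightarrow> integrable gauss1 f"
    and integral_gauss_component: "(\<integral>x. f (x i) \<partial>gauss I) = (\<integral>x. f x \<partial>gauss1)"
proof -
  have m: "(\<lambda>x. x i) \<in> measurable (gauss I) gauss1"
    using assms(1) unfolding gauss_def by simp
  have f: "f \<in> borel_measurable gauss1" by simp
  show "integrable (gauss I) (\<lambda>x. f (x i)) \<longleftrightarrow> integrable gauss1 f"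
    using integrable_distr_eq[OF m f] distr_gauss_component[OF assms(1)] by simp
  show "(\<integral>x. f (x i) \<partial>gauss I) = (\<integral>x. f x \<partial>gauss1)"
    using integral_distr[OF m f] distr_gauss_component[OF assms(1)] by simp
qed

lemma gauss1_moments:
  shows integrable_gauss1_power: "integrable gauss1 (\<lambda>x. x ^ n)"
    and integral_gauss1_id: "(\<integral>x. x \<partial>gauss1) = 0"
    and integral_gauss1_square: "(\<integral>x. x\<^sup>2 \<partial>gauss1) = 1"
  using integrable_std_normal_moment[of n] integral_std_normal_moment_odd[of 0] integral_std_normal_moment_even[of 1]
  by (simp_all add: integrable_gauss1_iff integral_gauss1 fact_numeral)

lemma integrable_gauss_power: "i \<in> I \<Longrightarrow> integrable (gauss I) (\<lambda>x. x i ^ n)"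
  by (subst integrable_gauss_component[of i I "\<lambda>x. x ^ n"]) (auto intro: integrable_gauss1_power)

lemma integral_gauss_coord: "i \<in> I \<Longrightarrow> (\<integral>x. x i \<partial>gauss I) = 0"
  by (subst integral_gauss_component[of i I "\<lambda>x. x"]) (auto intro: integral_gauss1_id)

lemma integrable_gauss_coord: "i \<in> I \<Longrightarrow> integrable (gauss I) (\<lambda>x. x i)"
  using integrable_gauss_power[of i I 1] by simp

lemma integral_gauss_coord_square: "i \<in> I \<Longrightarrow> (\<integral>x. (x i)\<^sup>2 \<partial>gauss I) = 1"
  by (subst integral_gauss_component[of i I "\<lambda>x. x\<^sup>2"]) (auto intro: integral_gauss1_square)

lemma gauss_coord_mult:
  assumes "finite I" "i \<in> I" "j \<in> I" "i \<noteq> j"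
  shows "integrable (gauss I) (\<lambda>x. x i * x j)" "(\<integral>x. x i * x j \<partial>gauss I) = 0"
proof -
  define f where "f = (\<lambda>k (x::real). if k = i \<or> k = j then x else 1)"
  have *: "(\<Prod>k\<in>I. f k (x k)) = x i * x j" for x
  proof -
    have "(\<Prod>k\<in>I. f k (x k)) = (\<Prod>k\<in>{i, j}. f k (x k))"
      by (rule prod.mono_neutral_right) (use assms in \<open>auto simp: f_def\<close>)
    then show ?thesis using assms by (simp add: f_def)
  qed
  have fi: "integrable gauss1 (f k)" for k
    using integrable_gauss1_power[of 1] by (cases "k = i \<or> k = j") (auto simp: f_def)
  show "integrable (gauss I) (\<lambda>x. x i * x j)"
    using gauss1_prod.product_integrable_prod[of I f] assms fi by (simp add: * gauss_def)
  have "(\<integral>x. x i * x j \<partial>gauss I) = (\<Prod>k\<in>I. \<integral>x. f k x \<partial>gauss1)"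
    using gauss1_prod.product_integral_prod[of I f] assms fi by (simp add: * gauss_def)
  also have "\<dots> = 0"
    using assms integral_gauss1_id by (auto simp: f_def intro!: prod_zero bexI[of _ i])
  finally show "(\<integral>x. x i * x j \<partial>gauss I) = 0" .
qed

lemma bdd_mult_integrable:
  assumes "bdd f" "f \<in> borel_measurable M" "integrable M g"
  shows "integrable M (\<lambda>x. f x * g x :: real)"
proof -
  obtain B where B: "0 \<le> B" "\<And>x. \<bar>f x\<bar> \<le> B" using assms(1) by (metis bddE)
  have "integrable M (\<lambda>x. B * g x)" using assms(3) by simp
  then show ?thesis
    by (rule Bochner_Integration.integrable_bound)
      (use B assms in \<open>auto simp: abs_mult intro!: mult_right_mono AE_I2\<close>)
qed

locale finite_index =
  fixes I :: "'i set"
  assumes finite_I [simp, intro]: "finite I"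
begin

abbreviation G :: "('i \<Rightarrow> real) measure" where "G \<equiv> gauss I"
abbreviation GG where "GG \<equiv> gauss I \<Otimes>\<^sub>M gauss I"
abbreviation V :: "('i \<Rightarrow> real) measure" where "V \<equiv> Pi\<^sub>M I (\<lambda>_. borel)"

lemma integrable_fst_comp:
  fixes f :: "('i \<Rightarrow> real) \<Rightarrow> real"
  assumes "integrable G f" shows "integrable GG (\<lambda>z. f (fst z))"
  using assms integrable_distr_eq[of fst GG G f] gauss.distr_pair_fst[of G I]
  by (simp add: borel_measurable_integrable)

lemma integrable_snd_comp:
  fixes f :: "('i \<Rightarrow> real) \<Rightarrow> real"
  assumes "integrable G f" shows "integrable GG (\<lambda>z. f (snd z))"
  using integrable_fst_comp[OF assms] gauss_pair.integrable_product_swap_iff[of I I "\<lambda>z. f (snd z)"]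
  by (simp add: split_beta')

lemma integrable_dotp: "integrable G (dotp I w)"
  unfolding dotp_def[abs_def] by (intro Bochner_Integration.integrable_sum integrable_mult_right integrable_gauss_coord)

lemma integral_dotp: "(\<integral>x. dotp I w x \<partial>G) = 0"
  unfolding dotp_def using integrable_gauss_coord[of _ I]
  by (subst Bochner_Integration.integral_sum) (auto simp: integral_gauss_coord)

lemma dotp_square: "(dotp I w x)\<^sup>2 = (\<Sum>i\<in>I. \<Sum>j\<in>I. w i * w j * (x i * x j))"
  unfolding dotp_def power2_eq_square sum_product by (intro sum.cong) auto

lemma integrable_coord_mult: "i \<in> I \<Longrightarrow> j \<in> I \<Longrightarrow> integrable G (\<lambda>x. x i * x j)"
  using gauss_coord_mult[of I i j] integrable_gauss_power[of i I 2] by (cases "i = j") (auto simp: power2_eq_square)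

lemma integral_coord_mult: "i \<in> I \<Longrightarrow> j \<in> I \<Longrightarrow> (\<integral>x. x i * x j \<partial>G) = (if i = j then 1 else 0)"
  using gauss_coord_mult[of I i j] integral_gauss_coord_square[of i I] by (auto simp: power2_eq_square)

lemma integrable_dotp_square: "integrable G (\<lambda>x. (dotp I w x)\<^sup>2)"
  unfolding dotp_square by (intro Bochner_Integration.integrable_sum integrable_mult_right integrable_coord_mult)

lemma integral_dotp_square: "(\<integral>x. (dotp I w x)\<^sup>2 \<partial>G) = (\<Sum>i\<in>I. (w i)\<^sup>2)"
proof -
  have "(\<integral>x. (dotp I w x)\<^sup>2 \<partial>G) = (\<Sum>i\<in>I. \<Sum>j\<in>I. w i * w j * (\<integral>x. x i * x j \<partial>G))"
    unfolding dotp_square using integrable_coord_mult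
    by (subst Bochner_Integration.integral_sum; simp)+
  also have "\<dots> = (\<Sum>i\<in>I. (w i)\<^sup>2)"
    by (intro sum.cong refl) (simp add: integral_coord_mult if_distrib power2_eq_square cong: if_cong)
  finally show ?thesis .
qed

lemma lin_cong: "(\<And>i. i \<in> I \<Longrightarrow> a * x i + b * y i = a' * x' i + b' * y' i) \<Longrightarrow> lin I a b x y = lin I a' b' x' y'"
  by (auto simp: lin_def fun_eq_iff)

lemma integral_sum_gauss:
  assumes \<tau>: "\<alpha>\<^sup>2 + \<beta>\<^sup>2 = \<tau>\<^sup>2" and "\<tau> \<noteq> 0" and [measurable]: "h \<in> borel_measurable V" and "bdd h"
  shows "(\<integral>x. \<integral>y. h (lin I \<alpha> \<beta> x y) \<partial>G \<partial>G) = (\<integral>x. h (lin I \<tau> 0 x x) \<partial>G)"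
    and "(\<integral>x. \<integral>y. h (lin I \<alpha> \<beta> x y) * dotp I w y \<partial>G \<partial>G) = \<beta> / \<tau> * (\<integral>x. h (lin I \<tau> 0 x x) * dotp I w x \<partial>G)"
proof -
  define c s where "c = \<alpha> / \<tau>" and "s = \<beta> / \<tau>"
  have cs: "c\<^sup>2 + s\<^sup>2 = 1"
    using assms(1,2) by (simp add: c_def s_def power_divide add_divide_distrib[symmetric])
  have cs': "c * c + s * s = 1" using cs by (simp add: power2_eq_square)
  have lin: "lin I \<alpha> \<beta> x y = lin I \<tau> 0 (fst (refl_map I c s (x, y))) (fst (refl_map I c s (x, y)))" for x y
    unfolding refl_map_def using assms(2) by (auto simp: c_def s_def lin_def fun_eq_iff distrib_left)
  have dot: "dotp I w y = s * dotp I w (fst (refl_map I c s (x, y))) - c * dotp I w (snd (refl_map I c s (x, y)))" for x y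
  proof -
    have "y i = s * (c * x i + s * y i) - c * (s * x i - c * y i)" for i
    proof -
      have "s * (c * x i + s * y i) - c * (s * x i - c * y i) = (c * c + s * s) * y i" by (simp add: algebra_simps)
      then show ?thesis using cs' by simp
    qed
    then have "w i * y i = s * (w i * (c * x i + s * y i)) - c * (w i * (s * x i - c * y i))" for i
      by (metis mult.left_commute right_diff_distrib)
    then show ?thesis
      unfolding dotp_def refl_map_def sum_distrib_left sum_subtractf[symmetric]
      by (intro sum.cong) (simp_all add: lin_apply)
  qed
  have bh: "bdd (\<lambda>x. h (lin I \<tau> 0 x x))" by (rule bdd_comp[OF \<open>bdd h\<close>])
  have bhp: "bdd (\<lambda>z. h (lin I \<alpha> \<beta> (fst z) (snd z)))" by (rule bdd_comp[OF \<open>bdd h\<close>])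
  have ih: "integrable G (\<lambda>x. h (lin I \<tau> 0 x x))"
    by (rule gauss.bdd_integrable[OF bh]) measurable
  have "(\<integral>x. \<integral>y. h (lin I \<alpha> \<beta> x y) \<partial>G \<partial>G) = (\<integral>z. h (lin I \<alpha> \<beta> (fst z) (snd z)) \<partial>GG)"
    by (subst gauss_pair.integral_fst'[symmetric]) (auto intro!: gauss_pair.bdd_integrable bhp)
  also have "\<dots> = (\<integral>z. h (lin I \<tau> 0 (fst (refl_map I c s z)) (fst (refl_map I c s z))) \<partial>GG)"
    using lin by (metis prod.collapse)
  also have "\<dots> = (\<integral>z. h (lin I \<tau> 0 (fst z) (fst z)) \<partial>GG)"
    by (rule integral_gauss_reflect[OF cs]) measurable
  also have "\<dots> = (\<integral>x. \<integral>y. h (lin I \<tau> 0 x x) \<partial>G \<partial>G)"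
    by (subst gauss_pair.integral_fst'[symmetric])
      (auto intro!: gauss_pair.bdd_integrable bdd_comp[OF \<open>bdd h\<close>])
  also have "\<dots> = (\<integral>x. h (lin I \<tau> 0 x x) \<partial>G)" by (simp add: gauss.prob_space)
  finally show "(\<integral>x. \<integral>y. h (lin I \<alpha> \<beta> x y) \<partial>G \<partial>G) = (\<integral>x. h (lin I \<tau> 0 x x) \<partial>G)" .
  note i1 = integrable_fst_comp[OF integrable_dotp, of w] integrable_snd_comp[OF integrable_dotp, of w]
  have i2: "integrable GG (\<lambda>z. h (lin I \<alpha> \<beta> (fst z) (snd z)) * dotp I w (snd z))"
    by (intro bdd_mult_integrable i1 bhp) measurable
  have i3: "integrable GG (\<lambda>z. h (lin I \<tau> 0 (fst z) (fst z)) * dotp I w (fst z))"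
    by (intro bdd_mult_integrable i1 bdd_comp[OF \<open>bdd h\<close>]) measurable
  have i4: "integrable GG (\<lambda>z. h (lin I \<tau> 0 (fst z) (fst z)) * dotp I w (snd z))"
    by (intro bdd_mult_integrable i1 bdd_comp[OF \<open>bdd h\<close>]) measurable
  define k where "k z = s * (h (lin I \<tau> 0 (fst z) (fst z)) * dotp I w (fst z)) - c * (h (lin I \<tau> 0 (fst z) (fst z)) * dotp I w (snd z))" for z
  have [measurable]: "k \<in> borel_measurable GG" unfolding k_def by measurable
  have "(\<integral>x. \<integral>y. h (lin I \<alpha> \<beta> x y) * dotp I w y \<partial>G \<partial>G) = (\<integral>z. h (lin I \<alpha> \<beta> (fst z) (snd z)) * dotp I w (snd z) \<partial>GG)"
    using i2 by (subst gauss_pair.integral_fst'[symmetric]) auto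
  also have "\<dots> = (\<integral>z. k (refl_map I c s z) \<partial>GG)"
  proof (rule Bochner_Integration.integral_cong[OF refl])
    fix z :: "('i \<Rightarrow> real) \<times> ('i \<Rightarrow> real)"
    obtain x y where z: "z = (x, y)" by (cases z)
    show "h (lin I \<alpha> \<beta> (fst z) (snd z)) * dotp I w (snd z) = k (refl_map I c s z)"
      unfolding k_def z fst_conv snd_conv lin[of x y] dot[of y x] by (simp add: algebra_simps)
  qed
  also have "\<dots> = (\<integral>z. k z \<partial>GG)"
    by (rule integral_gauss_reflect[OF cs]) measurable
  also have "\<dots> = s * (\<integral>z. h (lin I \<tau> 0 (fst z) (fst z)) * dotp I w (fst z) \<partial>GG) - c * (\<integral>z. h (lin I \<tau> 0 (fst z) (fst z)) * dotp I w (snd z) \<partial>GG)"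
    unfolding k_def using i3 i4 by simp
  also have "(\<integral>z. h (lin I \<tau> 0 (fst z) (fst z)) * dotp I w (fst z) \<partial>GG) = (\<integral>x. h (lin I \<tau> 0 x x) * dotp I w x \<partial>G)"
    using i3 by (subst gauss_pair.integral_fst'[symmetric]) (auto simp: gauss.prob_space)
  also have "(\<integral>z. h (lin I \<tau> 0 (fst z) (fst z)) * dotp I w (snd z) \<partial>GG) = 0"
    using i4 by (subst gauss_pair.integral_fst'[symmetric]) (auto simp: integral_dotp)
  finally show "(\<integral>x. \<integral>y. h (lin I \<alpha> \<beta> x y) * dotp I w y \<partial>G \<partial>G) = \<beta> / \<tau> * (\<integral>x. h (lin I \<tau> 0 x x) * dotp I w x \<partial>G)"
    by (simp add: s_def)
qed

end

lemma noise_mult: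
  fixes r r' :: real
  assumes "0 \<le> r" "r \<le> 1" "0 \<le> r'" "r' \<le> 1"
  shows "(r' * sqrt (1 - r\<^sup>2))\<^sup>2 + (sqrt (1 - r'\<^sup>2))\<^sup>2 = (sqrt (1 - (r' * r)\<^sup>2))\<^sup>2"
proof -
  have "r\<^sup>2 \<le> 1" "r'\<^sup>2 \<le> 1" "(r' * r)\<^sup>2 \<le> 1"
    using assms by (auto intro!: power_le_one mult_le_one)
  then show ?thesis by (simp add: power_mult_distrib algebra_simps)
qed

lemma noise_nonzero:
  fixes r :: real
  assumes "0 \<le> r" "r < 1"
  shows "0 < sqrt (1 - r\<^sup>2)"
  using assms by (simp add: power_less_one_iff)

context finite_index
begin

text \<open>
  \<open>ou r\<close> is the Ornstein--Uhlenbeck operator \<open>P\<^sub>t\<close> with \<open>r = e\<^bsup>-t\<^esup>\<close>, and \<open>ougrad r w f\<close> is the derivative of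
  \<open>ou r f\<close> in the direction \<open>w\<close>, put on the kernel by an integration by parts; no differentiability is
  ever used, see \<open>ou_remainder\<close>.
\<close>

definition ou :: "real \<Rightarrow> (('i \<Rightarrow> real) \<Rightarrow> real) \<Rightarrow> ('i \<Rightarrow> real) \<Rightarrow> real" where
  "ou r f x = (\<integral>y. f (lin I r (sqrt (1 - r\<^sup>2)) x y) \<partial>G)"

definition ougrad :: "real \<Rightarrow> ('i \<Rightarrow> real) \<Rightarrow> (('i \<Rightarrow> real) \<Rightarrow> real) \<Rightarrow> ('i \<Rightarrow> real) \<Rightarrow> real" where
  "ougrad r w f x = r / sqrt (1 - r\<^sup>2) * (\<integral>y. f (lin I r (sqrt (1 - r\<^sup>2)) x y) * dotp I w y \<partial>G)"

lemma measurable_lin_const [measurable]: "(\<lambda>y. lin I a b x y) \<in> measurable V V"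
  unfolding lin_def by measurable

lemma measurable_lin_const_gauss: "(\<lambda>y. lin I a b x y) \<in> measurable G V"
  unfolding measurable_gauss_iff by measurable

lemma measurable_ou [measurable]:
  assumes [measurable]: "f \<in> borel_measurable V"
  shows "ou r f \<in> borel_measurable V"
  unfolding ou_def by measurable

lemma measurable_ougrad [measurable]:
  assumes [measurable]: "f \<in> borel_measurable V"
  shows "ougrad r w f \<in> borel_measurable V"
  unfolding ougrad_def by measurable

lemma integrable_G: "f \<in> borel_measurable V \<Longrightarrow> bdd f \<Longrightarrow> integrable G f"
  by (rule gauss.bdd_integrable) (auto simp: measurable_gauss_iff)

lemma ou_abs_le:
  assumes [measurable]: "f \<in> borel_measurable V" and "\<And>x. \<bar>f x\<bar> \<le> B"
  shows "\<bar>ou r f x\<bar> \<le> B"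
  unfolding ou_def by (rule gauss.abs_integral_le) (use assms in auto)

lemma bdd_ou:
  assumes "f \<in> borel_measurable V" and "bdd f"
  shows "bdd (ou r f)"
  using assms(2) ou_abs_le[OF assms(1)] unfolding bdd_def by blast

lemma integral_mult_ou:
  assumes [measurable]: "f \<in> borel_measurable V" "g \<in> borel_measurable V" and "bdd f" "bdd g" and r: "0 \<le> r" "r \<le> 1"
  shows "(\<integral>x. f x * ou r g x \<partial>G) = (\<integral>x. ou r f x * g x \<partial>G)"
proof -
  let ?s = "sqrt (1 - r\<^sup>2)"
  have "r\<^sup>2 \<le> 1" using r by (simp add: power_le_one)
  then have cs: "r\<^sup>2 + ?s\<^sup>2 = 1" by simp
  then have cs': "r * r + ?s * ?s = 1" by (simp add: power2_eq_square)
  define k where "k z = f (fst z) * g (lin I r ?s (fst z) (snd z))" for z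
  have [measurable]: "k \<in> borel_measurable GG" unfolding k_def by measurable
  have bk: "bdd k" unfolding k_def by (intro bdd_mult bdd_comp[OF \<open>bdd f\<close>] bdd_comp[OF \<open>bdd g\<close>])
  have "(\<integral>x. f x * ou r g x \<partial>G) = (\<integral>z. k z \<partial>GG)"
    unfolding k_def
    by (subst gauss_pair.integral_fst'[symmetric]) (auto simp: ou_def intro!: gauss_pair.bdd_integrable bdd_mult bdd_comp[OF \<open>bdd f\<close>] bdd_comp[OF \<open>bdd g\<close>])
  also have "\<dots> = (\<integral>z. k (refl_map I r ?s z) \<partial>GG)"
    by (rule integral_gauss_reflect[OF cs, symmetric]) auto
  also have "\<dots> = (\<integral>z. f (lin I r ?s (fst z) (snd z)) * g (fst z) \<partial>GG)"
  proof (rule Bochner_Integration.integral_cong[OF refl])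
    fix z assume "z \<in> space GG"
    then obtain x y where z: "z = (x, y)" and x: "x \<in> extensional I" by (auto simp: space_pair_measure space_gauss)
    have "lin I r ?s (lin I r ?s x y) (lin I ?s (-r) x y) = x"
    proof -
      have "r * (r * x i + ?s * y i) + ?s * (?s * x i - r * y i) = x i" for i
      proof -
        have "r * (r * x i + ?s * y i) + ?s * (?s * x i - r * y i) = (r * r + ?s * ?s) * x i" by (simp only: algebra_simps)
        then show ?thesis using cs' by simp
      qed
      then show ?thesis using x by (auto simp: lin_def fun_eq_iff extensional_def)
    qed
    then show "k (refl_map I r ?s z) = f (lin I r ?s (fst z) (snd z)) * g (fst z)"
      by (simp add: k_def refl_map_def z)
  qed
  also have "\<dots> = (\<integral>x. ou r f x * g x \<partial>G)"
    by (subst gauss_pair.integral_fst'[symmetric])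
      (auto simp: ou_def intro!: gauss_pair.bdd_integrable bdd_mult bdd_comp[OF \<open>bdd f\<close>] bdd_comp[OF \<open>bdd g\<close>])
  finally show ?thesis .
qed

lemma integral_ou:
  assumes "f \<in> borel_measurable V" "bdd f" "0 \<le> r" "r \<le> 1"
  shows "(\<integral>x. ou r f x \<partial>G) = (\<integral>x. f x \<partial>G)"
  using integral_mult_ou[of "\<lambda>_. 1" f r] assms by (simp add: ou_def gauss.prob_space)

lemma lin_lin:
  "lin I r' s' (lin I r s x y) z = lin I (r' * r) 1 x (lin I (r' * s) s' y z)"
  "lin I r 1 x (lin I t 0 y y) = lin I r t x y"
  by (rule lin_cong; simp add: lin_apply algebra_simps)+

lemma ou_ou:
  assumes [measurable]: "f \<in> borel_measurable V" and "bdd f"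
    and r: "0 \<le> r" "r \<le> 1" "0 \<le> r'" "r' \<le> 1" "r' * r < 1"
  shows "ou r (ou r' f) x = ou (r' * r) f x"
proof -
  let ?s = "sqrt (1 - r\<^sup>2)" and ?s' = "sqrt (1 - r'\<^sup>2)" and ?t = "sqrt (1 - (r' * r)\<^sup>2)"
  define h where "h w = f (lin I (r' * r) 1 x w)" for w
  have [measurable]: "h \<in> borel_measurable V" unfolding h_def by measurable
  have "ou r (ou r' f) x = (\<integral>y. \<integral>z. h (lin I (r' * ?s) ?s' y z) \<partial>G \<partial>G)"
    unfolding ou_def h_def lin_lin ..
  also have "\<dots> = (\<integral>y. h (lin I ?t 0 y y) \<partial>G)"
    using noise_nonzero[of "r' * r"] r
    by (intro integral_sum_gauss(1) noise_mult) (auto simp: h_def intro: bdd_comp[OF \<open>bdd f\<close>])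
  also have "\<dots> = ou (r' * r) f x"
    unfolding ou_def h_def lin_lin ..
  finally show ?thesis .
qed

lemma ou_ougrad:
  assumes [measurable]: "f \<in> borel_measurable V" and "bdd f"
    and r: "0 < r" "r < 1" "0 < r'" "r' < 1"
  shows "ou r (ougrad r' w f) x = ougrad (r' * r) w f x / r"
proof -
  let ?s = "sqrt (1 - r\<^sup>2)" and ?s' = "sqrt (1 - r'\<^sup>2)" and ?t = "sqrt (1 - (r' * r)\<^sup>2)"
  define h where "h w = f (lin I (r' * r) 1 x w)" for w
  have [measurable]: "h \<in> borel_measurable V" unfolding h_def by measurable
  have rr: "r' * r < 1" using r mult_strict_mono[of r' 1 r 1] by simp
  have s': "0 < ?s'" and t: "0 < ?t" using noise_nonzero[of r'] noise_nonzero[of "r' * r"] r rr by auto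
  have "ou r (ougrad r' w f) x = r' / ?s' * (\<integral>y. \<integral>z. h (lin I (r' * ?s) ?s' y z) * dotp I w z \<partial>G \<partial>G)"
    unfolding ou_def ougrad_def h_def lin_lin by simp
  also have "\<dots> = r' / ?s' * (?s' / ?t * (\<integral>y. h (lin I ?t 0 y y) * dotp I w y \<partial>G))"
  proof -
    have "bdd h" unfolding h_def by (rule bdd_comp[OF \<open>bdd f\<close>])
    then show ?thesis using t r by (subst integral_sum_gauss(2)[OF noise_mult]) auto
  qed
  also have "\<dots> = r' / ?t * (\<integral>y. h (lin I ?t 0 y y) * dotp I w y \<partial>G)"
    using s' by simp
  also have "\<dots> = ougrad (r' * r) w f x / r"
    unfolding ougrad_def h_def lin_lin using r by simp
  finally show ?thesis .
qed

lemma integral_ougrad: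
  assumes [measurable]: "f \<in> borel_measurable V" and "bdd f" and r: "0 < r" "r < 1"
  shows "(\<integral>x. ougrad r w f x \<partial>G) = r * (\<integral>x. f x * dotp I w x \<partial>G)"
proof -
  let ?s = "sqrt (1 - r\<^sup>2)"
  have s: "0 < ?s" using noise_nonzero[of r] r by simp
  have "r\<^sup>2 \<le> 1" using r by (simp add: power_le_one)
  then have cs: "r\<^sup>2 + ?s\<^sup>2 = 1\<^sup>2" by simp
  have "(\<integral>x. ougrad r w f x \<partial>G) = r / ?s * (\<integral>x. \<integral>y. f (lin I r ?s x y) * dotp I w y \<partial>G \<partial>G)"
    unfolding ougrad_def by simp
  also have "\<dots> = r / ?s * (?s / 1 * (\<integral>x. f (lin I 1 0 x x) * dotp I w x \<partial>G))"
    by (subst integral_sum_gauss(2)[OF cs]) (use \<open>bdd f\<close> in auto)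
  also have "(\<integral>x. f (lin I 1 0 x x) * dotp I w x \<partial>G) = (\<integral>x. f x * dotp I w x \<partial>G)"
  proof (rule Bochner_Integration.integral_cong[OF refl])
    fix x assume "x \<in> space G"
    then have "lin I 1 0 x x = x" by (auto simp: space_gauss lin_def extensional_def)
    then show "f (lin I 1 0 x x) * dotp I w x = f x * dotp I w x" by simp
  qed
  finally show ?thesis using s by simp
qed

lemma integrable_ougrad_integrand:
  assumes [measurable]: "f \<in> borel_measurable V" and "bdd f"
  shows "integrable G (\<lambda>y. f (lin I a b x y) * dotp I w y)"
  by (intro bdd_mult_integrable integrable_dotp bdd_comp[OF \<open>bdd f\<close>] measurable_compose[OF measurable_lin_const_gauss assms(1)])

lemma ougrad_sum:
  assumes [measurable]: "f \<in> borel_measurable V" and "bdd f"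
    and w: "\<And>i. i \<in> I \<Longrightarrow> w i = (\<Sum>j\<in>J. a j * w' j i)"
  shows "ougrad r w f x = (\<Sum>j\<in>J. a j * ougrad r (w' j) f x)"
proof -
  have "dotp I w y = (\<Sum>j\<in>J. a j * dotp I (w' j) y)" for y
  proof -
    have "dotp I w y = (\<Sum>i\<in>I. \<Sum>j\<in>J. a j * (w' j i * y i))"
      unfolding dotp_def by (intro sum.cong refl) (simp add: w sum_distrib_right mult.assoc)
    also have "\<dots> = (\<Sum>j\<in>J. a j * dotp I (w' j) y)"
      unfolding dotp_def by (subst sum.swap) (simp add: sum_distrib_left)
    finally show ?thesis .
  qed
  then have "(\<integral>y. f (lin I r (sqrt (1 - r\<^sup>2)) x y) * dotp I w y \<partial>G)
    = (\<integral>y. (\<Sum>j\<in>J. a j * (f (lin I r (sqrt (1 - r\<^sup>2)) x y) * dotp I (w' j) y)) \<partial>G)"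
    by (simp add: sum_distrib_left mult.left_commute)
  also have "\<dots> = (\<Sum>j\<in>J. a j * (\<integral>y. f (lin I r (sqrt (1 - r\<^sup>2)) x y) * dotp I (w' j) y \<partial>G))"
    using integrable_ougrad_integrand[OF assms(1,2)] by (subst Bochner_Integration.integral_sum) auto
  finally show ?thesis
    by (simp add: ougrad_def sum_distrib_left algebra_simps)
qed

lemma ougrad_abs_le:
  assumes [measurable]: "f \<in> borel_measurable V" and f: "\<And>x. \<bar>f x\<bar> \<le> 1" and w: "(\<Sum>i\<in>I. (w i)\<^sup>2) \<le> 1" and r: "0 < r" "r < 1"
  shows "\<bar>ougrad r w f x\<bar> \<le> r / sqrt (1 - r\<^sup>2)"
proof -
  let ?g = "\<lambda>y. f (lin I r (sqrt (1 - r\<^sup>2)) x y) * dotp I w y"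
  have "bdd f" using f by (rule bddI)
  have i: "integrable G ?g" by (rule integrable_ougrad_integrand) fact+
  have pt: "\<bar>?g y\<bar> \<le> (1 + (dotp I w y)\<^sup>2) / 2" for y
  proof -
    have "\<bar>?g y\<bar> \<le> 1 * \<bar>dotp I w y\<bar>" unfolding abs_mult by (intro mult_right_mono f) simp
    moreover have "0 \<le> (1 - \<bar>dotp I w y\<bar>)\<^sup>2" by simp
    ultimately show ?thesis by (simp add: power2_diff)
  qed
  have "\<bar>\<integral>y. ?g y \<partial>G\<bar> \<le> (\<integral>y. \<bar>?g y\<bar> \<partial>G)" by (rule integral_abs_bound)
  also have "\<dots> \<le> (\<integral>y. (1 + (dotp I w y)\<^sup>2) / 2 \<partial>G)"
    using i integrable_dotp_square[of w] by (intro integral_mono pt) auto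
  also have "\<dots> = (1 + (\<Sum>i\<in>I. (w i)\<^sup>2)) / 2"
    using integrable_dotp_square[of w] by (simp add: gauss.prob_space integral_dotp_square)
  also have "\<dots> \<le> 1" using w by simp
  finally have le: "\<bar>\<integral>y. ?g y \<partial>G\<bar> \<le> 1" .
  have "0 \<le> r / sqrt (1 - r\<^sup>2)" using noise_nonzero[of r] r by simp
  then show ?thesis
    unfolding ougrad_def abs_mult using mult_left_mono[OF le, of "r / sqrt (1 - r\<^sup>2)"] by (simp only: abs_of_nonneg mult_1_right)
qed

lemma bdd_ougrad:
  assumes [measurable]: "f \<in> borel_measurable V" and "\<And>x. \<bar>f x\<bar> \<le> 1" "(\<Sum>i\<in>I. (w i)\<^sup>2) \<le> 1" "0 < r" "r < 1"
  shows "bdd (ougrad r w f)"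
  using ougrad_abs_le[OF assms] by (rule bddI)

end

section \<open>Decrease of the norm along the semigroup\<close>

lemma angle_square_le:
  fixes t :: real
  assumes "0 \<le> t" "t \<le> pi / 2"
  shows "t\<^sup>2 \<le> 4 * (1 - cos t)"
proof -
  define x where "x = t / 2"
  have x: "0 \<le> x" "x \<le> 1" using assms pi_less_4 by (auto simp: x_def)
  have "\<bar>sin x - (\<Sum>m<3. sin_coeff m * x ^ m)\<bar> \<le> inverse (fact 3) * \<bar>x\<bar> ^ 3"
    by (rule Maclaurin_sin_bound)
  have "x - x ^ 3 / 6 \<le> sin x"
  proof -
    have "(\<Sum>m<3. sin_coeff m * x ^ m) = x" by (simp add: numeral_3_eq_3 sin_coeff_def)
    then have "\<bar>sin x - x\<bar> \<le> x ^ 3 / 6"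
      using \<open>\<bar>sin x - _\<bar> \<le> _\<close> x by (simp add: fact_numeral)
    moreover have "x - sin x \<le> \<bar>sin x - x\<bar>" by simp
    ultimately show ?thesis by linarith
  qed
  moreover have "x ^ 3 \<le> x" using x power_decreasing[of 1 3 x] by simp
  ultimately have "5 / 6 * x \<le> sin x" by simp
  then have "(5 / 6 * x)\<^sup>2 \<le> (sin x)\<^sup>2" using x by (intro power_mono) auto
  moreover have "(5 / 6 * x)\<^sup>2 = 25 / 144 * t\<^sup>2" by (simp add: x_def power2_eq_square)
  ultimately have le: "25 / 144 * t\<^sup>2 \<le> (sin x)\<^sup>2" by (simp only:)
  have ct: "cos t = 1 - 2 * (sin x)\<^sup>2" using cos_double_sin[of x] by (simp add: x_def)
  have "t\<^sup>2 \<le> 8 * (25 / 144 * t\<^sup>2)" by simp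
  also have "\<dots> \<le> 8 * (sin x)\<^sup>2" using le by (intro mult_left_mono) auto
  also have "\<dots> = 4 * (1 - cos t)" using ct by simp
  finally show ?thesis .
qed

lemma dotp_scale: "dotp I (\<lambda>i. c * u i) x = c * dotp I u x"
  by (simp add: dotp_def sum_distrib_left mult.assoc)

context finite_index
begin

lemma integrable_exp_dotp: "integrable G (\<lambda>x. exp (dotp I v x - dotp I v v / 2))"
  and integral_exp_dotp: "(\<integral>x. exp (dotp I v x - dotp I v v / 2) \<partial>G) = 1"
  using integrable_gauss_shift[OF finite_I, of "\<lambda>_. 1" v] integral_gauss_shift[OF finite_I, of "\<lambda>_. 1" v]
  by (simp_all add: gauss.prob_space)

text \<open>
  The Cameron--Martin density satisfies \<open>exp (\<langle>v, z\<rangle> - |v|\<^sup>2/2) - 1 - \<langle>v, z\<rangle> \<ge> - |v|\<^sup>2/2\<close>, and its left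
  hand side has mean zero; hence the \<open>L\<^sup>1\<close> norm of the latter is at most \<open>|v|\<^sup>2\<close>.
\<close>

lemma integral_shift_remainder:
  assumes [measurable]: "h \<in> borel_measurable V" and h: "\<And>x. \<bar>h x\<bar> \<le> 1"
  shows "\<bar>(\<integral>x. h (lin I 1 1 x v) \<partial>G) - (\<integral>x. h x \<partial>G) - (\<integral>x. h x * dotp I v x \<partial>G)\<bar> \<le> dotp I v v"
proof -
  define X where "X x = exp (dotp I v x - dotp I v v / 2) - 1 - dotp I v x" for x
  have bh: "bdd h" using h by (rule bddI)
  have hm: "h \<in> borel_measurable G" by measurable
  have intX: "integrable G X" and eX: "(\<integral>x. X x \<partial>G) = 0"
    unfolding X_def using integrable_exp_dotp[of v] integrable_dotp[of v]
    by (simp_all add: integral_exp_dotp integral_dotp gauss.prob_space)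
  have vv: "0 \<le> dotp I v v" unfolding dotp_def by (intro sum_nonneg) auto
  have Xlow: "- (dotp I v v / 2) \<le> X x" for x
    using exp_ge_add_one_self[of "dotp I v x - dotp I v v / 2"] unfolding X_def by linarith
  have absX: "\<bar>X x\<bar> \<le> X x + dotp I v v" for x using Xlow[of x] vv by simp
  have i: "integrable G (\<lambda>x. exp (dotp I v x - dotp I v v / 2) * h x)" "integrable G h" "integrable G (\<lambda>x. h x * dotp I v x)"
      "integrable G (\<lambda>x. h x * X x)"
    using bdd_mult_integrable[OF bh hm integrable_exp_dotp[of v]] bdd_mult_integrable[OF bh hm integrable_dotp[of v]]
      bdd_mult_integrable[OF bh hm intX] gauss.bdd_integrable[OF bh hm] by (simp_all add: mult.commute)
  have "(\<integral>x. h (lin I 1 1 x v) \<partial>G) - (\<integral>x. h x \<partial>G) - (\<integral>x. h x * dotp I v x \<partial>G)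
    = (\<integral>x. exp (dotp I v x - dotp I v v / 2) * h x - h x - h x * dotp I v x \<partial>G)"
    using i integral_gauss_shift[OF finite_I hm, of v] by simp
  also have "\<dots> = (\<integral>x. h x * X x \<partial>G)"
    by (simp add: X_def algebra_simps)
  finally have eq: "(\<integral>x. h (lin I 1 1 x v) \<partial>G) - (\<integral>x. h x \<partial>G) - (\<integral>x. h x * dotp I v x \<partial>G) = (\<integral>x. h x * X x \<partial>G)" .
  have "\<bar>\<integral>x. h x * X x \<partial>G\<bar> \<le> (\<integral>x. \<bar>h x * X x\<bar> \<partial>G)" by (rule integral_abs_bound)
  also have "\<dots> \<le> (\<integral>x. X x + dotp I v v \<partial>G)"
  proof (rule integral_mono)
    fix x
    have "\<bar>h x * X x\<bar> \<le> 1 * \<bar>X x\<bar>" unfolding abs_mult by (intro mult_right_mono h) simp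
    then show "\<bar>h x * X x\<bar> \<le> X x + dotp I v v" using absX[of x] by simp
  qed (use i intX in auto)
  also have "\<dots> = dotp I v v" using intX eX by (simp add: gauss.prob_space)
  finally show ?thesis unfolding eq .
qed

lemma ou_remainder:
  assumes [measurable]: "f \<in> borel_measurable V" and f: "\<And>x. \<bar>f x\<bar> \<le> 1" and r: "0 < r" "r < 1"
  shows "\<bar>ou r f (lin I 1 1 x u) - ou r f x - ougrad r u f x\<bar> \<le> (r / sqrt (1 - r\<^sup>2))\<^sup>2 * dotp I u u"
proof -
  let ?s = "sqrt (1 - r\<^sup>2)"
  define v where "v i = r / ?s * u i" for i
  define h where "h y = f (lin I r ?s x y)" for y
  have [measurable]: "h \<in> borel_measurable V" unfolding h_def by measurable
  have s: "0 < ?s" using noise_nonzero[of r] r by simp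
  have "lin I r ?s (lin I 1 1 x u) y = lin I r ?s x (lin I 1 1 y v)" for y
    by (rule lin_cong) (use s in \<open>simp add: lin_apply v_def field_simps\<close>)
  then have 1: "ou r f (lin I 1 1 x u) = (\<integral>y. h (lin I 1 1 y v) \<partial>G)"
    unfolding ou_def h_def by simp
  have 2: "ougrad r u f x = (\<integral>y. h y * dotp I v y \<partial>G)"
    unfolding ougrad_def h_def v_def dotp_scale by (subst mult.left_commute) simp
  have "dotp I v v = (r / ?s)\<^sup>2 * dotp I u u"
  proof -
    have "v i * v i = (r / ?s)\<^sup>2 * (u i * u i)" for i
      by (simp add: v_def power2_eq_square)
    then show ?thesis unfolding dotp_def sum_distrib_left by simp
  qed
  then show ?thesis
    using integral_shift_remainder[of h v] f unfolding 1 2 by (simp add: h_def ou_def)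
qed

abbreviation unit :: "'i \<Rightarrow> 'i \<Rightarrow> real" where "unit i \<equiv> (\<lambda>j. if j = i then 1 else 0)"

definition energy :: "real \<Rightarrow> (('i \<Rightarrow> real) \<Rightarrow> real) \<Rightarrow> real" where
  "energy r f = (\<Sum>i\<in>I. \<integral>x. (ougrad r (unit i) f x)\<^sup>2 \<partial>G)"

lemma ougrad_unit:
  assumes "f \<in> borel_measurable V" and "bdd f"
  shows "ougrad r u f x = (\<Sum>i\<in>I. u i * ougrad r (unit i) f x)"
  by (rule ougrad_sum[OF assms]) (simp add: if_distrib cong: if_cong)

lemma unit_le: "(\<Sum>j\<in>I. (unit i j)\<^sup>2) \<le> 1"
proof -
  have "(\<Sum>j\<in>I. (unit i j)\<^sup>2) = (\<Sum>j\<in>I. if j = i then 1 else 0)" by (intro sum.cong) auto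
  then show ?thesis by simp
qed

lemma energy_nonneg: "0 \<le> energy r f"
  unfolding energy_def by (intro sum_nonneg) simp

lemma ou_rotation_step:
  assumes [measurable]: "f \<in> borel_measurable V" and f: "\<And>x. \<bar>f x\<bar> \<le> 1" and r: "0 < r" "r < 1"
  shows "\<exists>W\<ge>0. \<forall>e. (\<integral>z. (ou r f (fst z) - ou r f (lin I (cos e) (- sin e) (fst z) (snd z)))\<^sup>2 \<partial>GG)
     \<le> 2 * e\<^sup>2 * energy r f + e ^ 4 * W"
proof -
  let ?\<kappa> = "r / sqrt (1 - r\<^sup>2)"
  define g where "g = ou r f"
  define D where "D i = ougrad r (unit i) f" for i
  have bf: "bdd f" using f by (rule bddI)
  have \<kappa>: "0 \<le> ?\<kappa>" using noise_nonzero[of r] r by simp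
  have [measurable]: "g \<in> borel_measurable V" unfolding g_def by measurable
  have [measurable]: "D i \<in> borel_measurable V" for i unfolding D_def by measurable
  have bg: "bdd g" unfolding g_def using bf by (intro bdd_ou) auto
  have Dle: "\<bar>D i x\<bar> \<le> ?\<kappa>" for i x
    unfolding D_def by (rule ougrad_abs_le) (use f r unit_le in auto)
  have bD: "bdd (D i)" for i using Dle by (rule bddI)
  define a where "a z i = 1 + (fst z i)\<^sup>2 + (snd z i)\<^sup>2" for z :: "('i \<Rightarrow> real) \<times> ('i \<Rightarrow> real)" and i
  define C where "C = ?\<kappa> + 2 * ?\<kappa>\<^sup>2"
  define U where "U z = 2 * C\<^sup>2 * ((\<Sum>i\<in>I. 3 * (1 + (fst z i) ^ 4 + (snd z i) ^ 4)) * card I)" for z :: "('i \<Rightarrow> real) \<times> ('i \<Rightarrow> real)"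
  define L where "L z = (\<Sum>i\<in>I. \<Sum>j\<in>I. (D i (fst z) * D j (fst z)) * (snd z i * snd z j))" for z
  have C0: "0 \<le> C" unfolding C_def using \<kappa> by simp
  have Lsq: "L z = (\<Sum>i\<in>I. D i (fst z) * snd z i)\<^sup>2" for z
    unfolding L_def power2_eq_square sum_product by (intro sum.cong) auto
  have intU: "integrable GG U"
    unfolding U_def by (intro integrable_mult_right integrable_mult_left Bochner_Integration.integrable_sum Bochner_Integration.integrable_add
        integrable_fst_comp[where f="\<lambda>x. x i ^ 4" for i] integrable_snd_comp[where f="\<lambda>x. x i ^ 4" for i] integrable_gauss_power) auto
  have intL: "integrable GG L"
    unfolding L_def by (intro Bochner_Integration.integrable_sum bdd_mult_integrable bdd_mult bdd_comp[OF bD]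
        integrable_snd_comp[where f="\<lambda>x. x i * x j" for i j] integrable_coord_mult) auto
  have U0: "0 \<le> U z" for z
    unfolding U_def by (intro mult_nonneg_nonneg sum_nonneg) auto
  have eL: "(\<integral>z. L z \<partial>GG) = energy r f"
  proof -
    have "(\<integral>z. L z \<partial>GG) = (\<integral>x. \<integral>y. L (x, y) \<partial>G \<partial>G)"
      using intL by (simp add: gauss_pair.integral_fst')
    also have "\<dots> = (\<integral>x. (\<Sum>i\<in>I. (D i x)\<^sup>2) \<partial>G)"
    proof (intro Bochner_Integration.integral_cong refl)
      fix x
      have "(\<integral>y. L (x, y) \<partial>G) = (\<integral>y. (dotp I (\<lambda>i. D i x) y)\<^sup>2 \<partial>G)"
        unfolding Lsq by (simp add: dotp_def)
      then show "(\<integral>y. L (x, y) \<partial>G) = (\<Sum>i\<in>I. (D i x)\<^sup>2)" by (simp add: integral_dotp_square)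
    qed
    also have "\<dots> = energy r f"
      unfolding energy_def D_def[symmetric]
      by (intro Bochner_Integration.integral_sum integrable_G bdd_power bD) auto
    finally show ?thesis .
  qed
  have pt: "(g (fst z) - g (lin I (cos e) (- sin e) (fst z) (snd z)))\<^sup>2 \<le> 2 * e\<^sup>2 * L z + e ^ 4 * U z" for z e
  proof -
    obtain x y where z: "z = (x, y)" by (cases z)
    define u where "u i = (cos e - 1) * x i - sin e * y i" for i
    have c1: "\<bar>cos e - 1\<bar> \<le> e\<^sup>2 / 2"
    proof -
      have "cos e = 1 - 2 * (sin (e/2))\<^sup>2" using cos_double_sin[of "e/2"] by simp
      moreover have "(sin (e/2))\<^sup>2 \<le> (e/2)\<^sup>2" using abs_sin_x_le_abs_x[of "e/2"] unfolding abs_le_square_iff .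
      ultimately show ?thesis by (simp add: power_divide)
    qed
    have s1: "(sin e)\<^sup>2 \<le> e\<^sup>2" using abs_sin_x_le_abs_x[of e] unfolding abs_le_square_iff .
    have c2: "(cos e - 1)\<^sup>2 \<le> e\<^sup>2"
    proof -
      have "(cos e - 1)\<^sup>2 = \<bar>cos e - 1\<bar> * \<bar>cos e - 1\<bar>" by (simp only: power2_eq_square abs_mult_self)
      also have "\<dots> \<le> 2 * (e\<^sup>2 / 2)"
        by (intro mult_mono c1) (use abs_cos_le_one[of e] in linarith)+
      finally show ?thesis by simp
    qed
    have l: "lin I (cos e) (- sin e) x y = lin I 1 1 x u"
      by (rule lin_cong) (simp add: u_def algebra_simps)
    have uu: "dotp I u u \<le> 2 * e\<^sup>2 * (\<Sum>i\<in>I. a z i)"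
      unfolding dotp_def sum_distrib_left
    proof (rule sum_mono)
      fix i
      have "u i * u i \<le> 2 * ((cos e - 1) * x i)\<^sup>2 + 2 * (sin e * y i)\<^sup>2"
      proof -
        have "2 * p\<^sup>2 + 2 * q\<^sup>2 - (p - q) * (p - q) = (p + q)\<^sup>2" for p q :: real
          by (simp add: power2_eq_square algebra_simps)
        from this[of "(cos e - 1) * x i" "sin e * y i"] show ?thesis
          unfolding u_def by (smt (verit) zero_le_power2)
      qed
      also have "\<dots> \<le> 2 * (e\<^sup>2 * (x i)\<^sup>2) + 2 * (e\<^sup>2 * (y i)\<^sup>2)"
        unfolding power_mult_distrib by (intro add_mono mult_left_mono mult_right_mono c2 s1) auto
      also have "\<dots> \<le> 2 * e\<^sup>2 * a z i"
        by (simp add: a_def z algebra_simps)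
      finally show "u i * u i \<le> 2 * e\<^sup>2 * a z i" .
    qed
    define lp where "lp = (\<Sum>i\<in>I. D i x * y i)"
    define R where "R = g (lin I 1 1 x u) - g x + sin e * lp"
    have og: "ougrad r u f x = (cos e - 1) * (\<Sum>i\<in>I. D i x * x i) - sin e * lp"
      unfolding lp_def by (subst ougrad_unit[OF assms(1) bf])
        (simp add: D_def u_def sum_distrib_left sum_subtractf sum.distrib algebra_simps)
    have Dx: "\<bar>\<Sum>i\<in>I. D i x * x i\<bar> \<le> ?\<kappa> * (\<Sum>i\<in>I. a z i)"
    proof -
      have "\<bar>\<Sum>i\<in>I. D i x * x i\<bar> \<le> (\<Sum>i\<in>I. \<bar>D i x * x i\<bar>)" by (rule sum_abs)
      also have "\<dots> \<le> (\<Sum>i\<in>I. ?\<kappa> * a z i)"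
      proof (rule sum_mono)
        fix i
        have "\<bar>x i\<bar> \<le> a z i"
        proof -
          have "0 \<le> (1 - \<bar>x i\<bar>)\<^sup>2" by simp
          then have "2 * \<bar>x i\<bar> \<le> 1 + (x i)\<^sup>2" by (simp add: power2_diff)
          moreover have "0 \<le> (x i)\<^sup>2" "0 \<le> (y i)\<^sup>2" by simp_all
          ultimately show ?thesis unfolding a_def z fst_conv snd_conv by linarith
        qed
        then show "\<bar>D i x * x i\<bar> \<le> ?\<kappa> * a z i" unfolding abs_mult by (intro mult_mono Dle \<kappa>) auto
      qed
      finally show ?thesis by (simp add: sum_distrib_left)
    qed
    have a0: "0 \<le> (\<Sum>i\<in>I. a z i)" by (intro sum_nonneg) (simp add: a_def)
    have "\<bar>R\<bar> \<le> \<bar>g (lin I 1 1 x u) - g x - ougrad r u f x\<bar> + \<bar>(cos e - 1) * (\<Sum>i\<in>I. D i x * x i)\<bar>"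
      unfolding R_def og by linarith
    also have "\<dots> \<le> ?\<kappa>\<^sup>2 * dotp I u u + e\<^sup>2 / 2 * (?\<kappa> * (\<Sum>i\<in>I. a z i))"
      unfolding abs_mult g_def
      by (intro add_mono ou_remainder mult_mono c1 Dx) (use f r in auto)
    also have "\<dots> \<le> ?\<kappa>\<^sup>2 * (2 * e\<^sup>2 * (\<Sum>i\<in>I. a z i)) + e\<^sup>2 * (?\<kappa> * (\<Sum>i\<in>I. a z i))"
      by (intro add_mono mult_left_mono mult_right_mono uu) (use mult_nonneg_nonneg[OF \<kappa> a0] in auto)
    also have "\<dots> = e\<^sup>2 * (C * (\<Sum>i\<in>I. a z i))" by (simp add: C_def algebra_simps)
    finally have "\<bar>R\<bar>\<^sup>2 \<le> (e\<^sup>2 * (C * (\<Sum>i\<in>I. a z i)))\<^sup>2" by (rule power_mono) simp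
    then have R2: "R\<^sup>2 \<le> e ^ 4 * (C\<^sup>2 * (\<Sum>i\<in>I. a z i)\<^sup>2)" by (simp add: power_mult_distrib)
    have a2: "(\<Sum>i\<in>I. a z i)\<^sup>2 \<le> (\<Sum>i\<in>I. 3 * (1 + (x i) ^ 4 + (y i) ^ 4)) * card I"
    proof -
      have "(\<Sum>i\<in>I. a z i)\<^sup>2 \<le> (\<Sum>i\<in>I. (a z i)\<^sup>2) * card I" by (rule sum_squared_le_sum_of_squares)
      also have "\<dots> \<le> (\<Sum>i\<in>I. 3 * (1 + (x i) ^ 4 + (y i) ^ 4)) * card I"
      proof (intro mult_right_mono sum_mono)
        fix i
        have "3 * (1 + p\<^sup>2 + q\<^sup>2) - (1 + p + q)\<^sup>2 = (1 - p)\<^sup>2 + (1 - q)\<^sup>2 + (p - q)\<^sup>2" for p q :: real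
          by (simp add: power2_eq_square algebra_simps)
        from this[of "(x i)\<^sup>2" "(y i)\<^sup>2"] show "(a z i)\<^sup>2 \<le> 3 * (1 + (x i) ^ 4 + (y i) ^ 4)"
          unfolding a_def z by (simp flip: power_mult) (smt (verit) zero_le_power2)
      qed simp
      finally show ?thesis .
    qed
    have "(g x - g (lin I 1 1 x u))\<^sup>2 = (sin e * lp - R)\<^sup>2" by (simp add: R_def)
    also have "\<dots> \<le> 2 * (sin e * lp)\<^sup>2 + 2 * R\<^sup>2"
    proof -
      have "2 * p\<^sup>2 + 2 * q\<^sup>2 - (p - q)\<^sup>2 = (p + q)\<^sup>2" for p q :: real
        by (simp add: power2_eq_square algebra_simps)
      from this[of "sin e * lp" R] show ?thesis by (smt (verit) zero_le_power2)
    qed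
    also have "\<dots> \<le> 2 * (e\<^sup>2 * lp\<^sup>2) + 2 * (e ^ 4 * (C\<^sup>2 * ((\<Sum>i\<in>I. 3 * (1 + (x i) ^ 4 + (y i) ^ 4)) * card I)))"
      unfolding power_mult_distrib
    proof (intro add_mono mult_left_mono mult_right_mono s1)
      show "R\<^sup>2 \<le> e ^ 4 * (C\<^sup>2 * ((\<Sum>i\<in>I. 3 * (1 + (x i) ^ 4 + (y i) ^ 4)) * card I))"
        by (rule order_trans[OF R2]) (intro mult_left_mono a2; simp)
    qed auto
    also have "\<dots> = 2 * e\<^sup>2 * L z + e ^ 4 * U z"
      unfolding Lsq U_def lp_def z by simp
    finally show ?thesis unfolding z fst_conv snd_conv l .
  qed
  have "(\<integral>z. (g (fst z) - g (lin I (cos e) (- sin e) (fst z) (snd z)))\<^sup>2 \<partial>GG) \<le> 2 * e\<^sup>2 * energy r f + e ^ 4 * (\<integral>z. U z \<partial>GG)" for e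
  proof -
    have "(\<integral>z. (g (fst z) - g (lin I (cos e) (- sin e) (fst z) (snd z)))\<^sup>2 \<partial>GG) \<le> (\<integral>z. 2 * e\<^sup>2 * L z + e ^ 4 * U z \<partial>GG)"
    proof (intro integral_mono pt)
      show "integrable GG (\<lambda>z. (g (fst z) - g (lin I (cos e) (- sin e) (fst z) (snd z)))\<^sup>2)"
        by (intro gauss_pair.bdd_integrable bdd_power bdd_diff bdd_comp[OF bg]) measurable
    qed (use intL intU in auto)
    also have "\<dots> = 2 * e\<^sup>2 * energy r f + e ^ 4 * (\<integral>z. U z \<partial>GG)"
      using intL intU eL by simp
    finally show ?thesis .
  qed
  then show ?thesis
    unfolding g_def using U0 by (intro exI[of _ "\<integral>z. U z \<partial>GG"]) (auto intro: integral_nonneg_AE)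
qed

lemma ou_rotation:
  assumes [measurable]: "f \<in> borel_measurable V" and f: "\<And>x. \<bar>f x\<bar> \<le> 1" and r: "0 < r" "r < 1"
  shows "(\<integral>z. (ou r f (fst z) - ou r f (lin I (cos t) (sin t) (fst z) (snd z)))\<^sup>2 \<partial>GG) \<le> 2 * t\<^sup>2 * energy r f"
proof -
  obtain W where W: "0 \<le> W" "\<And>e. (\<integral>z. (ou r f (fst z) - ou r f (lin I (cos e) (- sin e) (fst z) (snd z)))\<^sup>2 \<partial>GG)
     \<le> 2 * e\<^sup>2 * energy r f + e ^ 4 * W"
    using ou_rotation_step[OF assms] by blast
  define g where "g = ou r f"
  have bf: "bdd f" using f by (rule bddI)
  have [measurable]: "g \<in> borel_measurable V" unfolding g_def by measurable
  have bg: "bdd g" unfolding g_def using bf by (intro bdd_ou) auto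
  let ?T = "(\<integral>z. (g (fst z) - g (lin I (cos t) (sin t) (fst z) (snd z)))\<^sup>2 \<partial>GG)"
  have bound: "?T \<le> 2 * t\<^sup>2 * energy r f + t ^ 4 * W * inverse (real (Suc m))" for m
  proof -
    define M where "M = Suc m"
    define e where "e = t / M"
    define X where "X k z = g (lin I (cos (k * e)) (sin (k * e)) (fst z) (snd z))" for k :: nat and z
    have M: "1 \<le> real M" by (simp add: M_def)
    have Me: "M * e = t" using M by (simp add: e_def)
    have step: "(\<integral>z. (X k z - X (Suc k) z)\<^sup>2 \<partial>GG) \<le> 2 * e\<^sup>2 * energy r f + e ^ 4 * W" for k
    proof -
      let ?c = "cos (k * e)" and ?s = "sin (k * e)"
      define q where "q z = (g (fst z) - g (lin I (cos e) (- sin e) (fst z) (snd z)))\<^sup>2" for z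
      have [measurable]: "q \<in> borel_measurable GG" unfolding q_def by measurable
      have "(\<integral>z. (X k z - X (Suc k) z)\<^sup>2 \<partial>GG) = (\<integral>z. q (refl_map I ?c ?s z) \<partial>GG)"
      proof (rule Bochner_Integration.integral_cong[OF refl])
        fix z :: "('i \<Rightarrow> real) \<times> ('i \<Rightarrow> real)"
        obtain x y where z: "z = (x, y)" by (cases z)
        have "lin I (cos (Suc k * e)) (sin (Suc k * e)) x y = lin I (cos e) (- sin e) (lin I ?c ?s x y) (lin I ?s (- ?c) x y)"
          by (rule lin_cong) (simp add: lin_apply distrib_right cos_add sin_add algebra_simps)
        then show "(X k z - X (Suc k) z)\<^sup>2 = q (refl_map I ?c ?s z)"
          by (simp add: X_def q_def refl_map_def z)
      qed
      also have "\<dots> = (\<integral>z. q z \<partial>GG)"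
        by (rule integral_gauss_reflect) auto
      also have "\<dots> \<le> 2 * e\<^sup>2 * energy r f + e ^ 4 * W"
        unfolding q_def g_def by (rule W)
      finally show ?thesis .
    qed
    have bX: "bdd (X k)" for k unfolding X_def by (rule bdd_comp[OF bg])
    have [measurable]: "X k \<in> borel_measurable GG" for k unfolding X_def by measurable
    have iX: "integrable GG (\<lambda>z. (X k z - X (Suc k) z)\<^sup>2)" "integrable GG (\<lambda>z. (X k z - X l z)\<^sup>2)" for k l
      by (intro gauss_pair.bdd_integrable bdd_power bdd_diff bX; measurable)+
    have "?T = (\<integral>z. (X 0 z - X M z)\<^sup>2 \<partial>GG)"
    proof (rule Bochner_Integration.integral_cong[OF refl])
      fix z assume "z \<in> space GG"
      then have "lin I 1 0 (fst z) (snd z) = fst z"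
        by (auto simp: space_pair_measure space_gauss lin_def extensional_def)
      then show "(g (fst z) - g (lin I (cos t) (sin t) (fst z) (snd z)))\<^sup>2 = (X 0 z - X M z)\<^sup>2"
        using Me by (simp add: X_def)
    qed
    also have "\<dots> \<le> (\<integral>z. (\<Sum>k<M. (X k z - X (Suc k) z)\<^sup>2) * M \<partial>GG)"
    proof (rule integral_mono)
      fix z
      have "X 0 z - X M z = (\<Sum>k<M. X k z - X (Suc k) z)"
        by (rule sum_lessThan_telescope'[symmetric])
      then show "(X 0 z - X M z)\<^sup>2 \<le> (\<Sum>k<M. (X k z - X (Suc k) z)\<^sup>2) * M"
        using sum_squared_le_sum_of_squares[of "\<lambda>k. X k z - X (Suc k) z" "{..<M}"] by simp
    qed (use iX in auto)
    also have "\<dots> = (\<Sum>k<M. \<integral>z. (X k z - X (Suc k) z)\<^sup>2 \<partial>GG) * M"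
      using iX by (subst integral_mult_left_zero, subst Bochner_Integration.integral_sum) auto
    also have "\<dots> \<le> (\<Sum>k<M. 2 * e\<^sup>2 * energy r f + e ^ 4 * W) * M"
      by (intro mult_right_mono sum_mono step) simp
    also have "\<dots> = 2 * (M * e)\<^sup>2 * energy r f + (M * e) ^ 4 * W * inverse (M\<^sup>2)"
      using M by (simp add: power_mult_distrib field_simps power2_eq_square power4_eq_xxxx)
    also have "\<dots> \<le> 2 * t\<^sup>2 * energy r f + t ^ 4 * W * inverse (real M)"
    proof -
      have "inverse ((real M)\<^sup>2) \<le> inverse (real M)"
        using M by (intro le_imp_inverse_le) (auto simp: power2_eq_square)
      then show ?thesis unfolding Me using W(1) by (intro add_left_mono mult_left_mono) auto
    qed
    finally show ?thesis unfolding M_def .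
  qed
  have "(\<lambda>m. 2 * t\<^sup>2 * energy r f + t ^ 4 * W * inverse (real (Suc m))) \<longlonglongrightarrow> 2 * t\<^sup>2 * energy r f + t ^ 4 * W * 0"
    by (intro tendsto_intros LIMSEQ_inverse_real_of_nat)
  then have "?T \<le> 2 * t\<^sup>2 * energy r f + t ^ 4 * W * 0"
    by (rule LIMSEQ_le_const) (use bound in auto)
  then show ?thesis unfolding g_def by simp
qed

definition corr :: "(('i \<Rightarrow> real) \<Rightarrow> real) \<Rightarrow> real \<Rightarrow> real" where
  "corr f r = (\<integral>x. f x * ou r f x \<partial>G)"

lemma corr_ou:
  assumes [measurable]: "f \<in> borel_measurable V" and bf: "bdd f" and "0 \<le> r" "r < 1" "0 \<le> c" "c \<le> 1"
  shows "(\<integral>x. ou r f x * ou c (ou r f) x \<partial>G) = corr f (r\<^sup>2 * c)"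
proof -
  have rc: "r * c < 1" using assms(3-6) by (meson le_less_trans mult_left_le)
  have rr: "(r * c) * r < 1" using assms(3-6) rc by (smt (verit) mult_left_le mult_nonneg_nonneg)
  have eq: "ou c (ou r f) = ou (r * c) f"
    using assms rc by (intro ext ou_ou) auto
  have "(\<integral>x. ou r f x * ou c (ou r f) x \<partial>G) = (\<integral>x. f x * ou r (ou (r * c) f) x \<partial>G)"
    unfolding eq using assms rc by (intro integral_mult_ou[symmetric] bdd_ou) auto
  also have "\<dots> = (\<integral>x. f x * ou ((r * c) * r) f x \<partial>G)"
    using assms rc rr by (intro Bochner_Integration.integral_cong refl arg_cong2[where f="(*)"] ou_ou) auto
  finally show ?thesis by (simp add: corr_def power2_eq_square mult_ac)
qed

lemma ou_one: "x \<in> extensional I \<Longrightarrow> ou 1 f x = f x"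
proof -
  assume "x \<in> extensional I"
  then have "lin I 1 0 x y = x" for y by (auto simp: lin_def extensional_def)
  then show ?thesis by (simp add: ou_def gauss.prob_space)
qed

lemma ou_zero: "ou 0 f x = (\<integral>x. f x \<partial>G)"
proof -
  have "(\<integral>y. f (lin I 0 1 x y) \<partial>G) = (\<integral>y. f y \<partial>G)"
  proof (rule Bochner_Integration.integral_cong[OF refl])
    fix y assume "y \<in> space G"
    then have "lin I 0 1 x y = y" by (auto simp: space_gauss lin_def extensional_def)
    then show "f (lin I 0 1 x y) = f y" by simp
  qed
  then show ?thesis by (simp add: ou_def)
qed

lemma corr_zero: "corr f 0 = (\<integral>x. f x \<partial>G)\<^sup>2"
  by (simp add: corr_def ou_zero power2_eq_square)

lemma corr_square:
  assumes [measurable]: "f \<in> borel_measurable V" and "bdd f" and "0 \<le> r" "r < 1"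
  shows "corr f (r\<^sup>2) = (\<integral>x. (ou r f x)\<^sup>2 \<partial>G)"
proof -
  have "(\<integral>x. ou r f x * ou 1 (ou r f) x \<partial>G) = (\<integral>x. (ou r f x)\<^sup>2 \<partial>G)"
    by (rule Bochner_Integration.integral_cong) (auto simp: space_gauss ou_one power2_eq_square)
  then show ?thesis using corr_ou[OF assms, of 1] by simp
qed

lemma corr_decrement:
  assumes [measurable]: "f \<in> borel_measurable V" and f: "\<And>x. \<bar>f x\<bar> \<le> 1" and r: "0 < r" "r < 1" and c: "0 \<le> c" "c \<le> 1"
  shows "corr f (r\<^sup>2) - corr f (r\<^sup>2 * c) \<le> 4 * (1 - c) * energy r f"
proof -
  define g where "g = ou r f"
  define t where "t = arccos c"
  have t: "0 \<le> t" "t \<le> pi / 2" "cos t = c" "sin t = sqrt (1 - c\<^sup>2)"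
    using c arccos_le_pi2[of c] by (auto simp: t_def arccos_lbound sin_arccos)
  have bf: "bdd f" using f by (rule bddI)
  have [measurable]: "g \<in> borel_measurable V" unfolding g_def by measurable
  have bg: "bdd g" unfolding g_def using bf by (intro bdd_ou) auto
  let ?h = "\<lambda>z. g (lin I c (sqrt (1 - c\<^sup>2)) (fst z) (snd z))"
  have i: "integrable GG (\<lambda>z. (g (fst z))\<^sup>2)" "integrable GG (\<lambda>z. (?h z)\<^sup>2)" "integrable GG (\<lambda>z. g (fst z) * ?h z)"
    by (intro gauss_pair.bdd_integrable bdd_power bdd_mult bdd_comp[OF bg]; measurable)+
  have e1: "(\<integral>z. (g (fst z))\<^sup>2 \<partial>GG) = (\<integral>x. (g x)\<^sup>2 \<partial>G)"
    using i(1) by (subst gauss_pair.integral_fst'[symmetric]) (auto simp: gauss.prob_space)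
  have e2: "(\<integral>z. (?h z)\<^sup>2 \<partial>GG) = (\<integral>x. (g x)\<^sup>2 \<partial>G)"
  proof -
    have "(\<integral>z. (?h z)\<^sup>2 \<partial>GG) = (\<integral>x. ou c (\<lambda>x. (g x)\<^sup>2) x \<partial>G)"
      using i(2) by (subst gauss_pair.integral_fst'[symmetric]) (auto simp: ou_def[abs_def])
    also have "\<dots> = (\<integral>x. (g x)\<^sup>2 \<partial>G)" using c by (intro integral_ou bdd_power bg) auto
    finally show ?thesis .
  qed
  have e3: "(\<integral>z. g (fst z) * ?h z \<partial>GG) = (\<integral>x. g x * ou c g x \<partial>G)"
    using i(3) by (subst gauss_pair.integral_fst'[symmetric]) (auto simp: ou_def)
  have "2 * (corr f (r\<^sup>2) - corr f (r\<^sup>2 * c)) = 2 * ((\<integral>x. (g x)\<^sup>2 \<partial>G) - (\<integral>x. g x * ou c g x \<partial>G))"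
    using corr_square[OF assms(1) bf, of r] corr_ou[OF assms(1) bf, of r c] r c by (simp add: g_def)
  also have "\<dots> = (\<integral>z. (g (fst z))\<^sup>2 \<partial>GG) + (\<integral>z. (?h z)\<^sup>2 \<partial>GG) - 2 * (\<integral>z. g (fst z) * ?h z \<partial>GG)"
    unfolding e1 e2 e3 by simp
  also have "\<dots> = (\<integral>z. (g (fst z) - ?h z)\<^sup>2 \<partial>GG)"
    using i by (simp add: power2_diff mult.assoc)
  also have "\<dots> \<le> 2 * t\<^sup>2 * energy r f"
    using ou_rotation[OF assms(1) f r, of t] by (simp add: g_def t)
  also have "\<dots> \<le> 2 * (4 * (1 - c)) * energy r f"
    using angle_square_le[OF t(1,2)] by (intro mult_right_mono energy_nonneg) (simp add: t)
  also have "\<dots> = 2 * (4 * (1 - c) * energy r f)" by (simp only: mult.assoc)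
  finally show ?thesis by (simp only: mult_le_cancel_left_pos[of 2] zero_less_numeral)
qed

end

section \<open>Energies at dyadic times\<close>

definition level_time :: "nat \<Rightarrow> real" where
  "level_time k = ln 4 / 4 ^ k"

lemma ln4_bounds: "1 \<le> ln (4::real)" "ln (4::real) \<le> 2"
proof -
  have "exp 1 \<le> (4::real)" using exp_le by linarith
  then show "1 \<le> ln (4::real)" by (simp add: ln_ge_iff)
  have "ln (4::real) = 2 * ln 2" using ln_realpow[of 2 2] by simp
  also have "\<dots> \<le> 2" using ln_2_less_1 by simp
  finally show "ln (4::real) \<le> 2" .
qed

lemma level_time_pos: "0 < level_time k" and level_time_Suc: "level_time k = 4 * level_time (Suc k)"
  and level_time_le: "level_time k \<le> 2 / 4 ^ k" "1 / 4 ^ k \<le> level_time k"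
  using ln4_bounds by (auto simp: level_time_def divide_right_mono)

lemma arctan_step:
  fixes u :: real
  assumes "0 \<le> u"
  shows "u * exp (- u\<^sup>2) \<le> 2 * (arctan u - arctan (u / 2))"
proof (cases "u = 0")
  case False
  then have u: "0 < u" using assms by simp
  have "\<exists>z. u / 2 < z \<and> z < u \<and> arctan u - arctan (u / 2) = (u - u / 2) * inverse (1 + z\<^sup>2)"
    by (rule MVT2) (use u in \<open>auto intro!: DERIV_arctan\<close>)
  then obtain z where z: "u / 2 < z" "z < u" and eq: "arctan u - arctan (u / 2) = u / 2 * inverse (1 + z\<^sup>2)" by auto
  have "exp (- u\<^sup>2) = inverse (exp (u\<^sup>2))" by (simp add: exp_minus)
  also have "\<dots> \<le> inverse (1 + u\<^sup>2)"
    by (intro le_imp_inverse_le exp_ge_add_one_self) (simp add: add_pos_nonneg)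
  also have "\<dots> \<le> inverse (1 + z\<^sup>2)"
    using z u by (intro le_imp_inverse_le add_left_mono power_mono) (auto simp: add_pos_nonneg)
  finally have "u * exp (- u\<^sup>2) \<le> u * inverse (1 + z\<^sup>2)" using u by (intro mult_left_mono) auto
  then show ?thesis unfolding eq by simp
qed simp

lemma sum_levels:
  fixes y :: real
  assumes "0 < y"
  shows "(\<Sum>k\<le>m. (1/2) ^ k * exp (- y\<^sup>2 / 4 ^ k)) \<le> 4 / y"
proof -
  have "y * (\<Sum>k\<le>m. (1/2) ^ k * exp (- y\<^sup>2 / 4 ^ k)) \<le> (\<Sum>k\<le>m. 2 * (arctan (y / 2 ^ k) - arctan (y / 2 ^ Suc k)))"
    unfolding sum_distrib_left
  proof (rule sum_mono)
    fix k
    have "(y / 2 ^ k)\<^sup>2 = y\<^sup>2 / 4 ^ k" by (simp add: power_divide) (simp add: power2_eq_square flip: power_mult_distrib)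
    then show "y * ((1/2) ^ k * exp (- y\<^sup>2 / 4 ^ k)) \<le> 2 * (arctan (y / 2 ^ k) - arctan (y / 2 ^ Suc k))"
      using arctan_step[of "y / 2 ^ k"] assms by (simp add: power_one_over mult.commute)
  qed
  also have "\<dots> = 2 * (arctan y - arctan (y / 2 ^ Suc m))"
    using sum_telescope[of "\<lambda>k. arctan (y / 2 ^ k)" m]
    by (simp only: sum_distrib_left[symmetric]) simp
  also have "\<dots> \<le> 4"
  proof -
    have "arctan y < pi / 2" by (rule arctan_ubound)
    moreover have "0 \<le> arctan (y / 2 ^ Suc m)" using assms by simp
    ultimately have "arctan y - arctan (y / 2 ^ Suc m) \<le> 2" using pi_less_4 by linarith
    then show ?thesis by simp
  qed
  finally show ?thesis using assms by (simp add: pos_le_divide_eq mult.commute)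
qed

context finite_index
begin

lemma noise_small_set:
  assumes [measurable]: "g \<in> borel_measurable V" and g: "\<And>x. \<bar>g x\<bar> \<le> M" and a: "(\<integral>x. \<bar>g x\<bar> \<partial>G) \<le> a"
  shows "(\<integral>x. (ou (1/4) g x)\<^sup>2 \<partial>G)\<^sup>2 \<le> M * a ^ 3"
proof -
  have bg: "bdd g" using g by (rule bddI)
  have M: "0 \<le> M" using g by (meson abs_ge_zero order_trans)
  define k where "k x = root 3 (g x)" for x
  define f where "f = ou (1/4) g"
  have k3: "k x ^ 3 = g x" for x by (simp add: k_def odd_real_root_pow)
  have kle: "\<bar>k x\<bar> \<le> root 3 M" for x
    using g[of x] by (simp add: k_def flip: real_root_abs)
  have k4: "k x ^ 4 = \<bar>k x\<bar> * \<bar>g x\<bar>" for x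
    unfolding k3[symmetric, of x] by (simp add: power_abs power4_eq_xxxx power3_eq_cube abs_mult)
  have [measurable]: "k \<in> borel_measurable V" unfolding k_def
    by (rule borel_measurable_continuous_on[OF _ assms(1)]) (intro continuous_on_real_root continuous_on_id)
  have [measurable]: "f \<in> borel_measurable V" unfolding f_def by measurable
  have bk: "bdd k" using kle by (rule bddI)
  have bf: "bdd f" unfolding f_def using bg by (intro bdd_ou) auto
  have s: "sqrt (1 - (1/4)\<^sup>2) = sqrt 15 / 4"
    by (simp add: power2_eq_square real_sqrt_divide)
  have "(\<integral>x. \<integral>y. f x * k (lin I (1/4) (sqrt 15 / 4) x y) ^ 3 \<partial>G \<partial>G) = (\<integral>x. (f x)\<^sup>2 \<partial>G)"
  proof -
    have fx: "f x = (\<integral>y. g (lin I (1/4) (sqrt 15 / 4) x y) \<partial>G)" for x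
      unfolding f_def ou_def s ..
    show ?thesis unfolding k3 by (simp add: fx[symmetric] power2_eq_square)
  qed
  then have "(norm2 G f)\<^sup>2 \<le> norm2 G f * norm4 G k ^ 3"
    using noise_two_function[of I f k] bf bk by (simp add: norm2_pow)
  then have "norm2 G f \<le> norm4 G k ^ 3"
    by (metis norm2_nonneg norm4_nonneg power2_eq_square mult_le_cancel_left_pos order_le_less zero_le_power)
  then have "norm2 G f ^ 4 \<le> (norm4 G k ^ 3) ^ 4" by (intro power_mono) auto
  also have "\<dots> = (\<integral>x. k x ^ 4 \<partial>G) ^ 3" unfolding norm4_pow[symmetric] by (simp flip: power_mult)
  also have "\<dots> \<le> (root 3 M * a) ^ 3"
  proof (rule power_mono)
    have "(\<integral>x. k x ^ 4 \<partial>G) \<le> (\<integral>x. root 3 M * \<bar>g x\<bar> \<partial>G)"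
      by (intro integral_mono integrable_mult_right integrable_G bdd_power bdd_abs bg bk) (auto simp: k4 intro: mult_right_mono kle)
    also have "\<dots> \<le> root 3 M * a" using a M by (simp add: mult_left_mono)
    finally show "(\<integral>x. k x ^ 4 \<partial>G) \<le> root 3 M * a" .
  qed simp
  also have "\<dots> = M * a ^ 3" by (simp add: power_mult_distrib odd_real_root_pow)
  also have "norm2 G f ^ 4 = ((norm2 G f)\<^sup>2)\<^sup>2" by simp
  finally show ?thesis unfolding norm2_pow f_def .
qed

text \<open>
  Halving the time costs a square root: \<open>|P\<^bsub>t/2\<^esub> g|\<^sup>2 = \<langle>g, P\<^bsub>t\<^esub> g\<rangle> \<le> |g| |P\<^bsub>t\<^esub> g|\<close>.
\<close>

lemma noise_small_set_dyadic:
  assumes [measurable]: "g \<in> borel_measurable V" and g: "\<And>x. \<bar>g x\<bar> \<le> M" and a: "(\<integral>x. \<bar>g x\<bar> \<partial>G) \<le> a"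
    and M: "1 \<le> M" and L: "a \<le> exp (- L)"
  shows "(\<integral>x. (ou (exp (- ln 4 / 2 ^ k)) g x)\<^sup>2 \<partial>G) \<le> M * a * exp (- L / 2 ^ Suc k)"
proof (induction k)
  have bg: "bdd g" using g by (rule bddI)
  have ig: "integrable G g" using bg by (intro integrable_G) auto
  have "0 \<le> (\<integral>x. \<bar>g x\<bar> \<partial>G)" by simp
  then have a0: "0 \<le> a" using a by linarith
  {
    case 0
    have "(\<integral>x. (ou (1/4) g x)\<^sup>2 \<partial>G)\<^sup>2 \<le> M * a ^ 3"
      by (rule noise_small_set) (use g a in auto)
    also have "\<dots> = M * a\<^sup>2 * a" by (simp add: power3_eq_cube power2_eq_square)
    also have "\<dots> \<le> M * a\<^sup>2 * (M * exp (- L))"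
    proof (rule mult_left_mono)
      have "a \<le> 1 * exp (- L)" using L by simp
      also have "\<dots> \<le> M * exp (- L)" using M by (intro mult_right_mono) auto
      finally show "a \<le> M * exp (- L)" .
    qed (use M a0 in auto)
    also have "\<dots> = (M * a * exp (- L / 2))\<^sup>2"
      by (simp add: power_mult_distrib power2_eq_square exp_add[symmetric])
    finally have "(\<integral>x. (ou (1/4) g x)\<^sup>2 \<partial>G) \<le> M * a * exp (- L / 2)"
      by (rule power2_le_imp_le) (use M a0 in auto)
    moreover have e: "exp (- ln 4 / 2 ^ 0) = (1/4 :: real)" by (simp add: exp_minus)
    ultimately show ?case unfolding e by simp
  next
    case (Suc k)
    let ?r = "exp (- ln 4 / 2 ^ Suc k) :: real"
    have r: "0 \<le> ?r" "?r < 1" by simp_all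
    have r2: "?r\<^sup>2 = exp (- ln 4 / 2 ^ k)" by (simp add: exp_double[symmetric])
    have "(\<integral>x. (ou ?r g x)\<^sup>2 \<partial>G)\<^sup>2 = (\<integral>x. g x * ou (exp (- ln 4 / 2 ^ k)) g x \<partial>G)\<^sup>2"
      using corr_square[OF assms(1) bg r] unfolding r2 corr_def by simp
    also have "\<dots> \<le> (\<integral>x. (g x)\<^sup>2 \<partial>G) * (\<integral>x. (ou (exp (- ln 4 / 2 ^ k)) g x)\<^sup>2 \<partial>G)"
      by (rule integral_Cauchy_Schwarz) (use bg in \<open>auto intro!: integrable_G bdd_power bdd_ou\<close>)
    also have "\<dots> \<le> (M * a) * (M * a * exp (- L / 2 ^ Suc k))"
    proof (rule mult_mono[OF _ Suc.IH])
      have "(\<integral>x. (g x)\<^sup>2 \<partial>G) \<le> (\<integral>x. M * \<bar>g x\<bar> \<partial>G)"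
      proof (intro integral_mono integrable_G bdd_power bg)
        fix x
        have "(g x)\<^sup>2 = \<bar>g x\<bar> * \<bar>g x\<bar>" by (simp add: power2_eq_square)
        also have "\<dots> \<le> M * \<bar>g x\<bar>" by (intro mult_right_mono g) auto
        finally show "(g x)\<^sup>2 \<le> M * \<bar>g x\<bar>" .
      qed (use bg in \<open>auto intro: bdd_intros\<close>)
      also have "\<dots> \<le> M * a" using a M by (simp add: mult_left_mono)
      finally show "(\<integral>x. (g x)\<^sup>2 \<partial>G) \<le> M * a" .
    qed (use M a0 in auto)
    also have "\<dots> = (M * a * exp (- L / 2 ^ Suc (Suc k)))\<^sup>2"
    proof -
      have "exp (- L / 2 ^ Suc k) = (exp (- L / 2 ^ Suc (Suc k)))\<^sup>2"
        by (simp add: exp_double[symmetric])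
      then show ?thesis by (simp only: power_mult_distrib) (simp add: power2_eq_square)
    qed
    finally show ?case by (rule power2_le_imp_le) (use M a0 in auto)
  }
qed

lemma energy_level:
  assumes [measurable]: "f \<in> borel_measurable V" and f: "\<And>x. \<bar>f x\<bar> \<le> 1"
    and a: "\<And>i r. i \<in> I \<Longrightarrow> 0 < r \<Longrightarrow> r < 1 \<Longrightarrow> (\<integral>x. \<bar>ougrad r (unit i) f x\<bar> \<partial>G) \<le> a i"
    and L: "\<And>i. i \<in> I \<Longrightarrow> a i \<le> exp (- L)"
  shows "energy (exp (- 2 * level_time k)) f \<le> 2 ^ k * exp (- (L / 2) / 4 ^ k) * (\<Sum>i\<in>I. a i)"
proof -
  define r where "r = exp (- level_time k)"
  have r: "0 < r" "r < 1" using level_time_pos[of k] by (auto simp: r_def)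
  have rr: "exp (- 2 * level_time k) = r * r" by (simp add: r_def exp_add[symmetric])
  have bf: "bdd f" using f by (rule bddI)
  have rk: "r = exp (- ln 4 / 2 ^ (2 * k))" by (simp add: r_def level_time_def power_mult)
  have M: "r / sqrt (1 - r\<^sup>2) \<le> 2 ^ k"
  proof -
    have pos: "0 < 1 - r\<^sup>2" using noise_nonzero[of r] r by simp
    have e: "1 + 2 * level_time k \<le> exp (2 * level_time k)" by (rule exp_ge_add_one_self)
    have "r\<^sup>2 * exp (2 * level_time k) = 1" by (simp add: r_def power2_eq_square exp_add[symmetric])
    moreover have "r\<^sup>2 * (1 + 2 * level_time k) \<le> r\<^sup>2 * exp (2 * level_time k)" by (intro mult_left_mono e) simp
    ultimately have "r\<^sup>2 * (2 * level_time k) \<le> 1 - r\<^sup>2" by (simp add: algebra_simps)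
    moreover have "r\<^sup>2 * (1 / 4 ^ k) \<le> r\<^sup>2 * (2 * level_time k)"
      using level_time_le(2)[of k] level_time_pos[of k] by (intro mult_left_mono) auto
    ultimately have "r\<^sup>2 * (1 / 4 ^ k) \<le> 1 - r\<^sup>2" by (rule order_trans[rotated])
    then have r4: "r\<^sup>2 \<le> 4 ^ k * (1 - r\<^sup>2)" by (simp add: pos_divide_le_eq mult.commute)
    have "r\<^sup>2 \<le> (2 ^ k * sqrt (1 - r\<^sup>2))\<^sup>2"
    proof -
      have "((2::real) ^ k)\<^sup>2 = 4 ^ k" by (simp add: power2_eq_square flip: power_mult_distrib)
      then show ?thesis using r4 pos by (simp only: power_mult_distrib) simp
    qed
    then have "r \<le> 2 ^ k * sqrt (1 - r\<^sup>2)"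
      by (rule power2_le_imp_le) (use pos in simp)
    then show ?thesis using noise_nonzero[of r] r by (simp add: pos_divide_le_eq)
  qed
  have "(\<integral>x. (ougrad (r * r) (unit i) f x)\<^sup>2 \<partial>G) \<le> 2 ^ k * a i * exp (- (L / 2) / 4 ^ k)" if i: "i \<in> I" for i
  proof -
    define g where "g = ougrad r (unit i) f"
    have [measurable]: "g \<in> borel_measurable V" unfolding g_def by measurable
    have gle: "\<bar>g x\<bar> \<le> 2 ^ k" for x
    proof -
      have "\<bar>g x\<bar> \<le> r / sqrt (1 - r\<^sup>2)"
        unfolding g_def by (rule ougrad_abs_le[OF assms(1) f unit_le r])
      then show ?thesis using M by linarith
    qed
    have bg: "bdd g" using gle by (rule bddI)
    have og: "ougrad (r * r) (unit i) f x = r * ou r g x" for x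
      using ou_ougrad[OF assms(1) bf r r, of "unit i" x] r by (simp add: g_def)
    have "(\<integral>x. (ougrad (r * r) (unit i) f x)\<^sup>2 \<partial>G) = r\<^sup>2 * (\<integral>x. (ou r g x)\<^sup>2 \<partial>G)"
      unfolding og by (simp add: power_mult_distrib)
    also have "\<dots> \<le> 1 * (\<integral>x. (ou r g x)\<^sup>2 \<partial>G)"
      using r by (intro mult_right_mono) (auto simp: power_le_one)
    also have "\<dots> \<le> 2 ^ k * a i * exp (- L / 2 ^ Suc (2 * k))"
      unfolding mult_1 rk by (rule noise_small_set_dyadic) (use gle a[OF i r] L[OF i] in \<open>auto simp: g_def\<close>)
    finally show ?thesis by (simp add: power_mult)
  qed
  then have "energy (r * r) f \<le> (\<Sum>i\<in>I. 2 ^ k * a i * exp (- (L / 2) / 4 ^ k))"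
    unfolding energy_def by (intro sum_mono)
  also have "\<dots> = 2 ^ k * exp (- (L / 2) / 4 ^ k) * (\<Sum>i\<in>I. a i)"
    unfolding sum_distrib_left by (intro sum.cong refl) simp
  finally show ?thesis unfolding rr .
qed

lemma corr_bound:
  assumes [measurable]: "f \<in> borel_measurable V" and f: "\<And>x. \<bar>f x\<bar> \<le> 1"
    and a: "\<And>i r. i \<in> I \<Longrightarrow> 0 < r \<Longrightarrow> r < 1 \<Longrightarrow> (\<integral>x. \<bar>ougrad r (unit i) f x\<bar> \<partial>G) \<le> a i"
    and L: "\<And>i. i \<in> I \<Longrightarrow> a i \<le> exp (- L)" "0 < L"
  shows "corr f (exp (- 4 * level_time m)) - (\<integral>x. f x \<partial>G)\<^sup>2 \<le> 1024 * (\<Sum>i\<in>I. a i) / sqrt L"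
proof -
  define A where "A = (\<Sum>i\<in>I. a i)"
  have "0 \<le> a i" if "i \<in> I" for i
  proof -
    have "0 \<le> (\<integral>x. \<bar>ougrad (1/2) (unit i) f x\<bar> \<partial>G)" by simp
    also have "\<dots> \<le> a i" using that by (intro a) auto
    finally show ?thesis .
  qed
  then have A0: "0 \<le> A" unfolding A_def by (intro sum_nonneg) auto
  define y where "y = sqrt (L / 2)"
  have y: "0 < y" "y\<^sup>2 = L / 2" using L by (auto simp: y_def)
  define E where "E k = (1/2) ^ k * exp (- y\<^sup>2 / 4 ^ k)" for k :: nat
  have E0: "0 \<le> E k" for k by (simp add: E_def)
  have en: "energy (exp (- 2 * level_time k)) f \<le> 4 ^ k * E k * A" for k
  proof -
    have "(4::real) ^ k * (1/2) ^ k = 2 ^ k" by (simp flip: power_mult_distrib)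
    then have "4 ^ k * E k = 2 ^ k * exp (- (L / 2) / 4 ^ k)" unfolding E_def y by (simp flip: mult.assoc)
    then show ?thesis using energy_level[OF assms(1) f a L(1), of k] by (simp add: A_def)
  qed
  have dec: "corr f (exp (- 4 * level_time k)) - corr f (exp (- 4 * level_time k) * c) \<le> 4 * (1 - c) * (4 ^ k * E k * A)"
    if "0 \<le> c" "c \<le> 1" for k c
  proof -
    let ?r = "exp (- 2 * level_time k)"
    have "?r\<^sup>2 = exp (- 4 * level_time k)" by (simp add: exp_double[symmetric])
    then have "corr f (exp (- 4 * level_time k)) - corr f (exp (- 4 * level_time k) * c) \<le> 4 * (1 - c) * energy ?r f"
      using corr_decrement[OF assms(1) f, of ?r c] that level_time_pos[of k] by simp
    also have "\<dots> \<le> 4 * (1 - c) * (4 ^ k * E k * A)" using that by (intro mult_left_mono en) auto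
    finally show ?thesis .
  qed
  have "corr f (exp (- 4 * level_time m)) - corr f 0 \<le> (\<Sum>k\<le>m. 128 * A * E k)"
  proof (induction m)
    case 0
    have "corr f (exp (- 4 * level_time 0)) - corr f 0 \<le> 4 * (E 0 * A)" using dec[of 0 0] by simp
    also have "\<dots> \<le> 128 * (E 0 * A)" using E0[of 0] A0 by (intro mult_right_mono) auto
    finally show ?case by (simp add: mult_ac)
  next
    case (Suc m)
    define c where "c = exp (- 4 * (level_time m - level_time (Suc m)))"
    have c: "0 \<le> c" "c \<le> 1" using level_time_Suc[of m] level_time_pos[of "Suc m"] by (auto simp: c_def)
    have ec: "exp (- 4 * level_time (Suc m)) * c = exp (- 4 * level_time m)"
      by (simp add: c_def exp_add[symmetric])
    have "1 - c \<le> 4 * (level_time m - level_time (Suc m))"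
      using exp_ge_add_one_self[of "- 4 * (level_time m - level_time (Suc m))"] unfolding c_def by linarith
    also have "\<dots> \<le> 16 * level_time (Suc m)"
      using level_time_Suc[of m] level_time_pos[of "Suc m"] by simp
    also have "\<dots> \<le> 32 / 4 ^ Suc m" using level_time_le(1)[of "Suc m"] by simp
    finally have c1: "1 - c \<le> 32 / 4 ^ Suc m" .
    have "corr f (exp (- 4 * level_time (Suc m))) - corr f (exp (- 4 * level_time m)) \<le> 4 * (1 - c) * (4 ^ Suc m * E (Suc m) * A)"
      using dec[OF c, of "Suc m"] unfolding ec .
    also have "\<dots> \<le> 4 * (32 / 4 ^ Suc m) * (4 ^ Suc m * E (Suc m) * A)"
      using E0[of "Suc m"] A0 c1 by (intro mult_right_mono mult_left_mono) auto
    also have "\<dots> = 128 * A * E (Suc m)" by simp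
    finally show ?case using Suc.IH by simp
  qed
  also have "\<dots> = 128 * A * (\<Sum>k\<le>m. E k)" by (simp add: sum_distrib_left)
  also have "\<dots> \<le> 128 * A * (4 / y)"
    unfolding E_def using A0 y by (intro mult_left_mono sum_levels) auto
  also have "\<dots> \<le> 1024 * A / sqrt L"
  proof -
    have "sqrt L / 2 \<le> y"
    proof (rule power2_le_imp_le)
      show "(sqrt L / 2)\<^sup>2 \<le> y\<^sup>2" using L by (simp add: y power_divide)
    qed (use y in simp)
    then have "4 / y \<le> 8 / sqrt L" using y L by (simp add: field_simps)
    then have "128 * A * (4 / y) \<le> 128 * A * (8 / sqrt L)" using A0 by (intro mult_left_mono) auto
    then show ?thesis by simp
  qed
  finally show ?thesis unfolding corr_zero A_def .
qed

end

section \<open>Preimages of increasing sets under linear maps\<close>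

lemma dotp_lin: "dotp I v (lin I a b x y) = a * dotp I v x + b * dotp I v y"
  unfolding dotp_def by (simp add: lin_apply sum.distrib sum_distrib_left algebra_simps)

text \<open>
  \<open>dotp I (S j) x\<close> is the \<open>j\<close>-th coordinate of \<open>S x\<close>, the vectors \<open>w j\<close> are the columns of the inverse
  of \<open>S\<close>, and \<open>F\<close> is the indicator function of the preimage under \<open>S\<close> of an increasing set.
\<close>

locale monotone_set = finite_index I for I :: "'i set" +
  fixes S w :: "'i \<Rightarrow> 'i \<Rightarrow> real" and F :: "('i \<Rightarrow> real) \<Rightarrow> real" and K :: real
  assumes F_measurable [measurable]: "F \<in> borel_measurable (Pi\<^sub>M I (\<lambda>_. borel))"
    and F_01: "F x = 0 \<or> F x = 1"
    and F_mono: "\<lbrakk>x \<in> extensional I; y \<in> extensional I; \<And>j. j \<in> I \<Longrightarrow> dotp I (S j) x \<le> dotp I (S j) y\<rbrakk> \<Longrightarrow> F x \<le> F y"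
    and S_w: "\<lbrakk>j \<in> I; l \<in> I\<rbrakk> \<Longrightarrow> dotp I (S l) (w j) = (if l = j then 1 else 0)"
    and w_S: "\<lbrakk>i \<in> I; l \<in> I\<rbrakk> \<Longrightarrow> (\<Sum>j\<in>I. S j i * w j l) = (if l = i then 1 else 0)"
    and row_le: "i \<in> I \<Longrightarrow> (\<Sum>j\<in>I. \<bar>S j i\<bar>) \<le> K"
    and col_le: "j \<in> I \<Longrightarrow> (\<Sum>i\<in>I. \<bar>S j i\<bar>) \<le> K"
begin

lemma F_abs_le: "\<bar>F x\<bar> \<le> 1" and F_nonneg: "0 \<le> F x" and F_le_1: "F x \<le> 1" and F_square: "(F x)\<^sup>2 = F x"
  using F_01[of x] by auto

lemma bdd_F: "bdd F"
  using F_abs_le by (rule bddI)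

text \<open>
  A lower bound for the influence of the \<open>j\<close>-th coordinate; unlike the influence it is linear in the
  direction.
\<close>

definition infl :: "'i \<Rightarrow> real" where
  "infl j = (\<integral>x. F x * dotp I (w j) x \<partial>G)"

lemma integral_mult_dotp_nonneg:
  assumes [measurable]: "h \<in> borel_measurable V" and h: "\<And>x. \<bar>h x\<bar> \<le> 1"
    and mono: "\<And>x t. x \<in> extensional I \<Longrightarrow> 0 \<le> t \<Longrightarrow> h x \<le> h (lin I 1 1 x (\<lambda>i. t * v i))"
  shows "0 \<le> (\<integral>x. h x * dotp I v x \<partial>G)"
proof -
  let ?E = "\<integral>x. h x * dotp I v x \<partial>G"
  have bh: "bdd h" using h by (rule bddI)
  have *: "- (t * dotp I v v) \<le> ?E" if t: "0 < t" for t
  proof -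
    have "(\<integral>x. h x \<partial>G) \<le> (\<integral>x. h (lin I 1 1 x (\<lambda>i. t * v i)) \<partial>G)"
    proof (rule integral_mono)
      show "integrable G h" using bh by (intro integrable_G) auto
      show "integrable G (\<lambda>x. h (lin I 1 1 x (\<lambda>i. t * v i)))"
        by (rule gauss.bdd_integrable[OF bdd_comp[OF bh]])
          (rule measurable_compose[OF measurable_shift], simp add: measurable_gauss_iff)
    qed (use mono t in \<open>auto simp: space_gauss\<close>)
    moreover have "dotp I (\<lambda>i. t * v i) (\<lambda>i. t * v i) = t * (t * dotp I v v)"
      unfolding dotp_scale by (simp add: dotp_def sum_distrib_left mult_ac)
    moreover have "(\<integral>x. h x * dotp I (\<lambda>i. t * v i) x \<partial>G) = t * ?E"
      unfolding dotp_scale mult.left_commute[of _ t] by simp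
    ultimately have "- (t * (t * dotp I v v)) \<le> t * ?E"
      using integral_shift_remainder[OF assms(1) h, of "\<lambda>i. t * v i"] by linarith
    then have "t * - (t * dotp I v v) \<le> t * ?E" by simp
    then show ?thesis using t by (simp only: mult_le_cancel_left_pos)
  qed
  have "((\<lambda>t. - (t * dotp I v v)) \<longlongrightarrow> - (0 * dotp I v v)) (at_right 0)"
    by (intro tendsto_intros)
  then have "- (0 * dotp I v v) \<le> ?E"
    by (rule tendsto_upperbound) (use * in \<open>auto simp: eventually_at_filter intro!: always_eventually\<close>)
  then show ?thesis by simp
qed

lemma F_mono_direction:
  assumes "0 \<le> r" "0 \<le> s" "0 \<le> t" "j \<in> I"
  shows "F (lin I r s x y) \<le> F (lin I r s x (lin I 1 1 y (\<lambda>i. t * w j i)))"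
proof (rule F_mono)
  fix l assume l: "l \<in> I"
  have "dotp I (S l) (\<lambda>i. t * w j i) = t * dotp I (S l) (w j)"
    by (simp add: dotp_def sum_distrib_left mult_ac)
  then have "0 \<le> dotp I (S l) (\<lambda>i. t * w j i)" using assms l by (simp add: S_w)
  then show "dotp I (S l) (lin I r s x y) \<le> dotp I (S l) (lin I r s x (lin I 1 1 y (\<lambda>i. t * w j i)))"
    using assms by (simp add: dotp_lin mult_left_mono)
qed simp_all

lemma ougrad_w_nonneg:
  assumes "j \<in> I" "0 < r" "r < 1"
  shows "0 \<le> ougrad r (w j) F x"
proof -
  let ?s = "sqrt (1 - r\<^sup>2)"
  have s: "0 < ?s" using noise_nonzero[of r] assms by simp
  have "0 \<le> (\<integral>y. F (lin I r ?s x y) * dotp I (w j) y \<partial>G)"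
    by (rule integral_mult_dotp_nonneg) (use F_abs_le F_mono_direction s assms in auto)
  then show ?thesis unfolding ougrad_def using s assms by simp
qed

lemma infl_nonneg:
  assumes "j \<in> I" shows "0 \<le> infl j"
proof -
  have "0 \<le> (\<integral>x. ougrad (1/2) (w j) F x \<partial>G)"
    using assms ougrad_w_nonneg by (intro Bochner_Integration.integral_nonneg) auto
  then show ?thesis
    using integral_ougrad[OF F_measurable bdd_F, of "1/2" "w j"] unfolding infl_def by simp
qed

lemma integrable_ougrad_w:
  assumes "j \<in> I" "0 < r" "r < 1"
  shows "integrable G (ougrad r (w j) F)"
proof (rule Bochner_Integration.integrable_bound)
  let ?s = "sqrt (1 - r\<^sup>2)"
  show "integrable G (\<lambda>x. r / ?s * (\<integral>y. \<bar>dotp I (w j) y\<bar> \<partial>G))" by simp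
  show "ougrad r (w j) F \<in> borel_measurable G" by measurable
  have s: "0 < ?s" using noise_nonzero[of r] assms by simp
  have "\<bar>ougrad r (w j) F x\<bar> \<le> r / ?s * (\<integral>y. \<bar>dotp I (w j) y\<bar> \<partial>G)" for x
  proof -
    have "\<bar>\<integral>y. F (lin I r ?s x y) * dotp I (w j) y \<partial>G\<bar> \<le> (\<integral>y. \<bar>F (lin I r ?s x y) * dotp I (w j) y\<bar> \<partial>G)"
      by (rule integral_abs_bound)
    also have "\<dots> \<le> (\<integral>y. \<bar>dotp I (w j) y\<bar> \<partial>G)"
    proof (rule integral_mono)
      show "integrable G (\<lambda>y. \<bar>F (lin I r ?s x y) * dotp I (w j) y\<bar>)"
        by (intro integrable_abs integrable_ougrad_integrand bdd_F F_measurable)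
      fix y
      have "\<bar>F (lin I r ?s x y) * dotp I (w j) y\<bar> \<le> 1 * \<bar>dotp I (w j) y\<bar>"
        unfolding abs_mult by (intro mult_right_mono F_abs_le) simp
      then show "\<bar>F (lin I r ?s x y) * dotp I (w j) y\<bar> \<le> \<bar>dotp I (w j) y\<bar>" by simp
    qed (use integrable_dotp in auto)
    finally have "r / ?s * \<bar>\<integral>y. F (lin I r ?s x y) * dotp I (w j) y \<partial>G\<bar> \<le> r / ?s * (\<integral>y. \<bar>dotp I (w j) y\<bar> \<partial>G)"
      using s assms by (intro mult_left_mono) auto
    then show ?thesis unfolding ougrad_def abs_mult using s assms by simp
  qed
  then show "AE x in G. norm (ougrad r (w j) F x) \<le> norm (r / ?s * (\<integral>y. \<bar>dotp I (w j) y\<bar> \<partial>G))"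
    by (intro AE_I2) (metis abs_ge_self order_trans real_norm_def)
qed

lemma integral_abs_ougrad_unit_le:
  assumes "i \<in> I" "0 < r" "r < 1"
  shows "(\<integral>x. \<bar>ougrad r (unit i) F x\<bar> \<partial>G) \<le> (\<Sum>j\<in>I. \<bar>S j i\<bar> * infl j)"
proof -
  have eq: "ougrad r (unit i) F x = (\<Sum>j\<in>I. S j i * ougrad r (w j) F x)" for x
    by (rule ougrad_sum[OF F_measurable bdd_F]) (use assms w_S in auto)
  have int: "integrable G (\<lambda>x. \<Sum>j\<in>I. \<bar>S j i\<bar> * ougrad r (w j) F x)"
    using assms by (intro Bochner_Integration.integrable_sum integrable_mult_right integrable_ougrad_w) auto
  have "(\<integral>x. \<bar>ougrad r (unit i) F x\<bar> \<partial>G) \<le> (\<integral>x. (\<Sum>j\<in>I. \<bar>S j i\<bar> * ougrad r (w j) F x) \<partial>G)"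
  proof (rule integral_mono)
    show "integrable G (\<lambda>x. \<bar>ougrad r (unit i) F x\<bar>)"
      by (intro integrable_G bdd_abs bdd_ougrad) (use assms F_abs_le unit_le in auto)
    fix x
    have "\<bar>ougrad r (unit i) F x\<bar> \<le> (\<Sum>j\<in>I. \<bar>S j i * ougrad r (w j) F x\<bar>)"
      unfolding eq by (rule sum_abs)
    also have "\<dots> = (\<Sum>j\<in>I. \<bar>S j i\<bar> * ougrad r (w j) F x)"
      using ougrad_w_nonneg assms by (intro sum.cong) (auto simp: abs_mult)
    finally show "\<bar>ougrad r (unit i) F x\<bar> \<le> (\<Sum>j\<in>I. \<bar>S j i\<bar> * ougrad r (w j) F x)" .
  qed (rule int)
  also have "\<dots> = (\<Sum>j\<in>I. \<bar>S j i\<bar> * (r * infl j))"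
    unfolding infl_def integral_ougrad[OF F_measurable bdd_F assms(2,3), symmetric] using assms
    by (subst Bochner_Integration.integral_sum) (auto intro: integrable_mult_right integrable_ougrad_w)
  also have "\<dots> \<le> (\<Sum>j\<in>I. \<bar>S j i\<bar> * infl j)"
    using assms infl_nonneg by (intro sum_mono mult_left_mono) (auto simp: mult_left_le_one_le)
  finally show ?thesis .
qed

text \<open>
  Monotonicity replaces the usual density argument for the \<open>L\<^sup>2\<close> continuity at time \<open>0\<close>: unless some
  coordinate of \<open>S\<close> applied to the noise is below \<open>- h\<close>, the noise decreases \<open>F\<close> by no more than the
  shift by \<open>- h u\<close> does, where \<open>S u = (1, \<dots>, 1)\<close>.
\<close>

lemma corr_near_one:
  assumes r: "0 \<le> r" "r \<le> 1" and h: "0 < h"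
  defines "u \<equiv> (\<lambda>i. \<Sum>j\<in>I. w j i)"
  shows "(\<integral>x. F x \<partial>G) \<le> corr F r + h * \<bar>\<integral>x. F x * dotp I u x \<partial>G\<bar> + h\<^sup>2 * dotp I u u
    + 2 * (1 - r) / h\<^sup>2 * (\<Sum>l\<in>I. \<Sum>i\<in>I. (S l i)\<^sup>2)"
proof -
  let ?s = "sqrt (1 - r\<^sup>2)"
  have r2: "r\<^sup>2 \<le> 1" using r by (simp add: power_le_one)
  define v where "v i = - h * u i" for i
  have Su: "dotp I (S l) u = 1" if "l \<in> I" for l
  proof -
    have "dotp I (S l) u = (\<Sum>i\<in>I. \<Sum>j\<in>I. S l i * w j i)"
      unfolding dotp_def u_def by (simp add: sum_distrib_left)
    also have "\<dots> = (\<Sum>j\<in>I. dotp I (S l) (w j))"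
      unfolding dotp_def by (rule sum.swap)
    also have "\<dots> = 1" using that S_w by (simp cong: if_cong)
    finally show ?thesis .
  qed
  have Sv: "dotp I (S l) v = - h" if "l \<in> I" for l
  proof -
    have "dotp I (S l) v = - h * dotp I (S l) u"
      by (simp add: dotp_def v_def sum_distrib_left sum_negf mult_ac)
    then show ?thesis using Su[OF that] by simp
  qed
  define Q where "Q z = (\<Sum>l\<in>I. ((r - 1) * dotp I (S l) (fst z) + ?s * dotp I (S l) (snd z))\<^sup>2)" for z
  have pt: "F (lin I 1 1 (fst z) v) \<le> F (fst z) * F (lin I r ?s (fst z) (snd z)) + Q z / h\<^sup>2" if z: "z \<in> space GG" for z
  proof -
    obtain x y where zxy: "z = (x, y)" and x: "x \<in> extensional I" using z by (auto simp: space_pair_measure space_gauss)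
    have le: "F (lin I 1 1 x v) \<le> F x"
      by (rule F_mono) (use x h Sv in \<open>auto simp: dotp_lin\<close>)
    have Q0: "0 \<le> Q z" unfolding Q_def by (intro sum_nonneg) simp
    show ?thesis
    proof (cases "\<forall>l\<in>I. - h \<le> (r - 1) * dotp I (S l) x + ?s * dotp I (S l) y")
      case True
      have "F (lin I 1 1 x v) \<le> F (lin I r ?s x y)"
      proof (rule F_mono)
        fix l assume "l \<in> I"
        then show "dotp I (S l) (lin I 1 1 x v) \<le> dotp I (S l) (lin I r ?s x y)"
          using True Sv[of l] by (auto simp: dotp_lin algebra_simps)
      qed simp_all
      then have "F (lin I 1 1 x v) \<le> F x * F (lin I r ?s x y)"
        using le F_01[of x] F_01[of "lin I r ?s x y"] F_01[of "lin I 1 1 x v"] by auto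
      then show ?thesis using Q0 h by (simp add: zxy add_increasing2)
    next
      case False
      then obtain l where l: "l \<in> I" "(r - 1) * dotp I (S l) x + ?s * dotp I (S l) y < - h" by auto
      have "h\<^sup>2 \<le> ((r - 1) * dotp I (S l) x + ?s * dotp I (S l) y)\<^sup>2"
        using l h by (subst abs_le_square_iff[symmetric]) auto
      also have "\<dots> \<le> Q z" unfolding Q_def zxy fst_conv snd_conv
        using l by (intro member_le_sum) auto
      finally have "1 \<le> Q z / h\<^sup>2" using h by simp
      moreover have "0 \<le> F (fst z) * F (lin I r ?s (fst z) (snd z))" by (intro mult_nonneg_nonneg F_nonneg)
      ultimately show ?thesis using F_le_1[of "lin I 1 1 (fst z) v"] by linarith
    qed
  qed
  have Qeq: "Q z = (\<Sum>l\<in>I. (r - 1)\<^sup>2 * (dotp I (S l) (fst z))\<^sup>2 + 2 * (r - 1) * ?s * (dotp I (S l) (fst z) * dotp I (S l) (snd z))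
      + ?s\<^sup>2 * (dotp I (S l) (snd z))\<^sup>2)" for z
    unfolding Q_def by (intro sum.cong refl) (simp only: power2_sum power_mult_distrib mult_ac)
  have iD: "integrable GG (\<lambda>z. (dotp I (S l) (fst z))\<^sup>2)" "integrable GG (\<lambda>z. (dotp I (S l) (snd z))\<^sup>2)" for l
    using integrable_fst_comp[OF integrable_dotp_square[of "S l"]] integrable_snd_comp[OF integrable_dotp_square[of "S l"]] .
  have iX: "integrable GG (\<lambda>z. dotp I (S l) (fst z) * dotp I (S l) (snd z))" for l
  proof (rule Bochner_Integration.integrable_bound)
    show "integrable GG (\<lambda>z. (dotp I (S l) (fst z))\<^sup>2 + (dotp I (S l) (snd z))\<^sup>2)" using iD by simp
    show "AE z in GG. norm (dotp I (S l) (fst z) * dotp I (S l) (snd z)) \<le> norm ((dotp I (S l) (fst z))\<^sup>2 + (dotp I (S l) (snd z))\<^sup>2)"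
      using abs_mult_le_squares by simp
  qed measurable
  have E1: "(\<integral>z. (dotp I (S l) (fst z))\<^sup>2 \<partial>GG) = (\<Sum>i\<in>I. (S l i)\<^sup>2)" for l
    using iD(1)[of l] by (subst gauss_pair.integral_fst'[symmetric]) (auto simp: gauss.prob_space integral_dotp_square)
  have E2: "(\<integral>z. (dotp I (S l) (snd z))\<^sup>2 \<partial>GG) = (\<Sum>i\<in>I. (S l i)\<^sup>2)" for l
    using iD(2)[of l] by (subst gauss_pair.integral_fst'[symmetric]) (auto simp: gauss.prob_space integral_dotp_square)
  have EX: "(\<integral>z. dotp I (S l) (fst z) * dotp I (S l) (snd z) \<partial>GG) = 0" for l
    using iX[of l] by (subst gauss_pair.integral_fst'[symmetric]) (auto simp: integral_dotp)
  have iQ: "integrable GG Q"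
    unfolding Qeq[abs_def] using iD iX by (intro Bochner_Integration.integrable_sum) auto
  have EQ: "(\<integral>z. Q z \<partial>GG) = 2 * (1 - r) * (\<Sum>l\<in>I. \<Sum>i\<in>I. (S l i)\<^sup>2)"
  proof -
    have "(\<integral>z. Q z \<partial>GG) = (\<Sum>l\<in>I. (r - 1)\<^sup>2 * (\<Sum>i\<in>I. (S l i)\<^sup>2) + ?s\<^sup>2 * (\<Sum>i\<in>I. (S l i)\<^sup>2))"
      unfolding Qeq using iD iX by (subst Bochner_Integration.integral_sum) (auto simp: E1 E2 EX)
    also have "\<dots> = (\<Sum>l\<in>I. 2 * (1 - r) * (\<Sum>i\<in>I. (S l i)\<^sup>2))"
    proof (intro sum.cong refl)
      fix l
      have "(r - 1)\<^sup>2 + ?s\<^sup>2 = 2 * (1 - r)" using r2 by (simp add: power2_eq_square algebra_simps)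
      then show "(r - 1)\<^sup>2 * (\<Sum>i\<in>I. (S l i)\<^sup>2) + ?s\<^sup>2 * (\<Sum>i\<in>I. (S l i)\<^sup>2) = 2 * (1 - r) * (\<Sum>i\<in>I. (S l i)\<^sup>2)"
        by (metis distrib_right)
    qed
    finally show ?thesis by (simp add: sum_distrib_left)
  qed
  have iF: "integrable GG (\<lambda>z. F (fst z) * F (lin I r ?s (fst z) (snd z)))"
    by (intro gauss_pair.bdd_integrable bdd_mult bdd_comp[OF bdd_F]) measurable
  have mS: "(\<lambda>x. F (lin I 1 1 x v)) \<in> borel_measurable G"
    by (rule measurable_compose[OF measurable_shift]) (simp add: measurable_gauss_iff)
  have iFs: "integrable G (\<lambda>x. F (lin I 1 1 x v))"
    by (rule gauss.bdd_integrable[OF bdd_comp[OF bdd_F] mS])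
  have "(\<integral>x. F (lin I 1 1 x v) \<partial>G) = (\<integral>z. F (lin I 1 1 (fst z) v) \<partial>GG)"
    using integrable_fst_comp[OF iFs] by (subst gauss_pair.integral_fst'[symmetric]) (auto simp: gauss.prob_space)
  also have "\<dots> \<le> (\<integral>z. F (fst z) * F (lin I r ?s (fst z) (snd z)) + Q z / h\<^sup>2 \<partial>GG)"
    by (rule integral_mono[OF integrable_fst_comp[OF iFs] _ pt]) (use iF iQ in auto)
  also have "\<dots> = corr F r + 2 * (1 - r) / h\<^sup>2 * (\<Sum>l\<in>I. \<Sum>i\<in>I. (S l i)\<^sup>2)"
  proof -
    have "(\<integral>z. F (fst z) * F (lin I r ?s (fst z) (snd z)) \<partial>GG) = corr F r"
      using iF by (subst gauss_pair.integral_fst'[symmetric]) (auto simp: corr_def ou_def)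
    then show ?thesis using iF iQ EQ by simp
  qed
  finally have up: "(\<integral>x. F (lin I 1 1 x v) \<partial>G) \<le> corr F r + 2 * (1 - r) / h\<^sup>2 * (\<Sum>l\<in>I. \<Sum>i\<in>I. (S l i)\<^sup>2)" .
  have dv: "dotp I v x = - (h * dotp I u x)" for x
    by (simp add: dotp_def v_def sum_distrib_left sum_negf mult_ac)
  have dvv: "dotp I v v = h\<^sup>2 * dotp I u u"
    by (simp add: dotp_def v_def sum_distrib_left power2_eq_square mult_ac)
  have "(\<integral>x. F x * dotp I v x \<partial>G) = - (h * (\<integral>x. F x * dotp I u x \<partial>G))"
    unfolding dv by (simp add: mult.left_commute)
  then have "(\<integral>x. F x \<partial>G) - h * (\<integral>x. F x * dotp I u x \<partial>G) - h\<^sup>2 * dotp I u u \<le> (\<integral>x. F (lin I 1 1 x v) \<partial>G)"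
    using integral_shift_remainder[OF F_measurable F_abs_le, of v] unfolding dvv by linarith
  moreover have "h * (\<integral>x. F x * dotp I u x \<partial>G) \<le> h * \<bar>\<integral>x. F x * dotp I u x \<partial>G\<bar>"
    using h by (intro mult_left_mono) auto
  ultimately show ?thesis using up by linarith
qed

theorem variance_bound:
  assumes \<delta>: "\<And>j. j \<in> I \<Longrightarrow> K * infl j \<le> \<delta>" "0 < \<delta>" "\<delta> < 1"
  shows "(\<integral>x. F x \<partial>G) * (1 - (\<integral>x. F x \<partial>G)) * sqrt (ln (1 / \<delta>)) \<le> 1024 * K * (\<Sum>j\<in>I. infl j)"
proof -
  define L where "L = ln (1 / \<delta>)"
  have L: "0 < L" "exp (- L) = \<delta>" using \<delta> by (auto simp: L_def ln_div)
  define a where "a i = (\<Sum>j\<in>I. \<bar>S j i\<bar> * infl j)" for i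
  define p where "p = (\<integral>x. F x \<partial>G)"
  have a_le: "a i \<le> exp (- L)" if i: "i \<in> I" for i
  proof -
    have Imax: "finite (infl ` I)" "infl ` I \<noteq> {}" using i by auto
    define m where "m = Max (infl ` I)"
    have m: "infl j \<le> m" if "j \<in> I" for j unfolding m_def using that Imax by auto
    obtain j where j: "j \<in> I" "m = infl j" unfolding m_def using Max_in[OF Imax] by auto
    have "a i \<le> (\<Sum>j\<in>I. \<bar>S j i\<bar> * m)" unfolding a_def by (intro sum_mono mult_left_mono m) auto
    also have "\<dots> = (\<Sum>j\<in>I. \<bar>S j i\<bar>) * m" by (simp add: sum_distrib_right)
    also have "\<dots> \<le> K * m" using row_le[OF i] infl_nonneg[OF j(1)] j(2) by (intro mult_right_mono) auto
    also have "\<dots> \<le> \<delta>" using \<delta>(1)[OF j(1)] j(2) by simp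
    finally show ?thesis unfolding L(2) .
  qed
  have A: "(\<Sum>i\<in>I. a i) \<le> K * (\<Sum>j\<in>I. infl j)"
  proof -
    have "(\<Sum>i\<in>I. a i) = (\<Sum>j\<in>I. \<Sum>i\<in>I. \<bar>S j i\<bar> * infl j)" unfolding a_def by (rule sum.swap)
    also have "\<dots> \<le> (\<Sum>j\<in>I. K * infl j)"
      using col_le infl_nonneg by (intro sum_mono) (auto simp: sum_distrib_right[symmetric] intro: mult_right_mono)
    finally show ?thesis by (simp add: sum_distrib_left)
  qed
  have cb: "corr F (exp (- 4 * level_time m)) \<le> p\<^sup>2 + 1024 * (\<Sum>i\<in>I. a i) / sqrt L" for m
    using corr_bound[OF F_measurable F_abs_le integral_abs_ougrad_unit_le[folded a_def] a_le L(1), of m] by (simp add: p_def)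
  define u where "u i = (\<Sum>j\<in>I. w j i)" for i
  define C1 where "C1 = \<bar>\<integral>x. F x * dotp I u x \<partial>G\<bar>"
  define C2 where "C2 = dotp I u u"
  define C3 where "C3 = (\<Sum>l\<in>I. \<Sum>i\<in>I. (S l i)\<^sup>2)"
  have C3: "0 \<le> C3" unfolding C3_def by (intro sum_nonneg) auto
  have bound: "p \<le> p\<^sup>2 + 1024 * (\<Sum>i\<in>I. a i) / sqrt L + (1/2) ^ m * C1 + (1/4) ^ m * C2 + (1/4) ^ m * (16 * C3)" for m
  proof -
    let ?r = "exp (- 4 * level_time (2 * m))"
    let ?h = "(1/2) ^ m :: real"
    have r: "0 \<le> ?r" "?r \<le> 1" using level_time_pos[of "2 * m"] by auto
    have h: "0 < ?h" by simp
    have h2: "?h\<^sup>2 = (1/4) ^ m" by (simp add: power2_eq_square flip: power_mult_distrib)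
    have "1 - ?r \<le> 4 * level_time (2 * m)"
      using exp_ge_add_one_self[of "- 4 * level_time (2 * m)"] by linarith
    also have "\<dots> \<le> 8 / 4 ^ (2 * m)" using level_time_le(1)[of "2 * m"] by simp
    also have "\<dots> = 8 * ?h\<^sup>2 * ?h\<^sup>2"
      unfolding h2 by (simp add: power_mult power_one_over power2_eq_square power_mult_distrib[symmetric] flip: power_mult_distrib)
    finally have "2 * (1 - ?r) / ?h\<^sup>2 \<le> 16 * ?h\<^sup>2" using h by (simp add: pos_divide_le_eq)
    then have "2 * (1 - ?r) / ?h\<^sup>2 * C3 \<le> 16 * ?h\<^sup>2 * C3" using C3 by (intro mult_right_mono)
    moreover have "p \<le> corr F ?r + ?h * C1 + ?h\<^sup>2 * C2 + 2 * (1 - ?r) / ?h\<^sup>2 * C3"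
      using corr_near_one[OF r h] unfolding p_def C1_def C2_def C3_def u_def[abs_def] .
    ultimately show ?thesis using cb[of "2 * m"] unfolding h2 by (simp add: mult_ac)
  qed
  have "(\<lambda>m. p\<^sup>2 + 1024 * (\<Sum>i\<in>I. a i) / sqrt L + (1/2) ^ m * C1 + (1/4) ^ m * C2 + (1/4) ^ m * (16 * C3))
     \<longlonglongrightarrow> p\<^sup>2 + 1024 * (\<Sum>i\<in>I. a i) / sqrt L + 0 * C1 + 0 * C2 + 0 * (16 * C3)"
    by (intro tendsto_intros LIMSEQ_power_zero) auto
  then have "p \<le> p\<^sup>2 + 1024 * (\<Sum>i\<in>I. a i) / sqrt L + 0 * C1 + 0 * C2 + 0 * (16 * C3)"
    by (rule LIMSEQ_le_const) (use bound in auto)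
  then have "p * (1 - p) \<le> 1024 * (\<Sum>i\<in>I. a i) / sqrt L" by (simp add: power2_eq_square algebra_simps)
  then have "p * (1 - p) * sqrt L \<le> 1024 * (\<Sum>i\<in>I. a i)" using L(1) by (simp add: pos_le_divide_eq)
  also have "\<dots> \<le> 1024 * K * (\<Sum>j\<in>I. infl j)" using A by simp
  finally show ?thesis unfolding p_def L_def .
qed

end

section \<open>Linear substitution in Lebesgue integrals\<close>

interpretation lborel_prod: product_sigma_finite "\<lambda>_. lborel :: real measure"
  by standard

abbreviation leb :: "nat \<Rightarrow> (nat \<Rightarrow> real) measure" where
  "leb n \<equiv> Pi\<^sub>M {..<n} (\<lambda>_. lborel)"

lemma sets_leb [measurable_cong]: "sets (Pi\<^sub>M I (\<lambda>_. lborel :: real measure)) = sets (Pi\<^sub>M I (\<lambda>_. borel))"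
  by (rule sets_PiM_cong) auto

lemma nn_integral_leb_insert:
  assumes "finite I" "i \<notin> I"
    and [measurable]: "f \<in> borel_measurable (Pi\<^sub>M (insert i I) (\<lambda>_. borel :: real measure))"
  shows "(\<integral>\<^sup>+x. f x \<partial>Pi\<^sub>M (insert i I) (\<lambda>_. lborel)) = (\<integral>\<^sup>+x. \<integral>\<^sup>+u. f (x(i := u)) \<partial>lborel \<partial>Pi\<^sub>M I (\<lambda>_. lborel))"
proof -
  have "f \<in> borel_measurable (Pi\<^sub>M (insert i I) (\<lambda>_. lborel))"
    by measurable
  then show ?thesis
    using assms by (simp add: lborel_prod.product_nn_integral_insert)
qed

definition mv :: "nat \<Rightarrow> real mat \<Rightarrow> (nat \<Rightarrow> real) \<Rightarrow> (nat \<Rightarrow> real)" where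
  "mv n M x = (\<lambda>i\<in>{..<n}. \<Sum>j<n. M $$ (i, j) * x j)"

lemma measurable_mv [measurable]: "mv n M \<in> measurable (Pi\<^sub>M {..<n} (\<lambda>_. borel)) (Pi\<^sub>M {..<n} (\<lambda>_. borel))"
  unfolding mv_def by measurable

lemma mult_mat_index:
  assumes "A \<in> carrier_mat n n" "B \<in> carrier_mat n n" "i < n" "j < n"
  shows "(A * B) $$ (i, j) = (\<Sum>l<n. A $$ (i, l) * B $$ (l, j))"
  using assms by (simp add: scalar_prod_def atLeast0LessThan)

lemma mv_mult:
  assumes "A \<in> carrier_mat n n" "B \<in> carrier_mat n n"
  shows "mv n (A * B) x = mv n A (mv n B x)"
proof (rule ext)
  fix i show "mv n (A * B) x i = mv n A (mv n B x) i"
  proof (cases "i < n")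
    case True
    then have "mv n (A * B) x i = (\<Sum>j<n. \<Sum>l<n. A $$ (i, l) * B $$ (l, j) * x j)"
      using assms unfolding mv_def by (simp add: mult_mat_index sum_distrib_right del: index_mult_mat)
    also have "\<dots> = (\<Sum>l<n. \<Sum>j<n. A $$ (i, l) * B $$ (l, j) * x j)" by (rule sum.swap)
    also have "\<dots> = mv n A (mv n B x) i"
      using True by (simp add: mv_def sum_distrib_left mult.assoc)
    finally show ?thesis .
  qed (simp add: mv_def)
qed

definition row_mat :: "nat \<Rightarrow> nat \<Rightarrow> (nat \<Rightarrow> real) \<Rightarrow> real mat" where
  "row_mat n k r = mat n n (\<lambda>(i, j). if i = k then r j else if i = j then 1 else 0)"

lemma row_mat_carrier [simp]: "row_mat n k r \<in> carrier_mat n n"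
  by (simp add: row_mat_def)

lemma mult_row_mat_index:
  assumes "A \<in> carrier_mat n n" "i < n" "j < n" "k < n"
  shows "(A * row_mat n k r) $$ (i, j) = A $$ (i, k) * r j + (if j = k then 0 else A $$ (i, j))"
proof -
  have "(A * row_mat n k r) $$ (i, j) = (\<Sum>l<n. A $$ (i, l) * row_mat n k r $$ (l, j))"
    using assms by (simp add: mult_mat_index del: index_mult_mat)
  also have "\<dots> = A $$ (i, k) * row_mat n k r $$ (k, j) + (\<Sum>l\<in>{..<n} - {k}. A $$ (i, l) * row_mat n k r $$ (l, j))"
    using assms by (subst sum.remove[of _ k]) auto
  also have "(\<Sum>l\<in>{..<n} - {k}. A $$ (i, l) * row_mat n k r $$ (l, j)) = (\<Sum>l\<in>{..<n} - {k}. if l = j then A $$ (i, l) else 0)"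
    using assms by (intro sum.cong) (auto simp: row_mat_def)
  also have "\<dots> = (if j = k then 0 else A $$ (i, j))"
    using assms by (simp add: sum.delta)
  finally show ?thesis using assms by (simp add: row_mat_def)
qed

lemma det_row_mat:
  assumes k: "k < n"
  shows "det (row_mat n k r) = r k"
proof -
  have "det (row_mat n k r) = (\<Sum>i<n. row_mat n k r $$ (i, k) * cofactor (row_mat n k r) i k)"
    by (rule laplace_expansion_column[OF _ k]) simp
  also have "\<dots> = (\<Sum>i<n. if i = k then r k * cofactor (row_mat n k r) k k else 0)"
    using k by (intro sum.cong) (auto simp: row_mat_def)
  also have "\<dots> = r k * cofactor (row_mat n k r) k k" using k by simp
  also have "mat_delete (row_mat n k r) k k = 1\<^sub>m (n - 1)"
    by (rule eq_matI) (auto simp: mat_delete_def row_mat_def)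
  then have "cofactor (row_mat n k r) k k = 1"
    by (simp add: cofactor_def)
  finally show ?thesis by simp
qed

definition subst_ok :: "nat \<Rightarrow> real mat \<Rightarrow> bool" where
  "subst_ok n M \<longleftrightarrow> (\<forall>f\<in>borel_measurable (Pi\<^sub>M {..<n} (\<lambda>_. borel)).
     (\<integral>\<^sup>+x. f x \<partial>leb n) = ennreal \<bar>det M\<bar> * (\<integral>\<^sup>+x. f (mv n M x) \<partial>leb n))"

lemma subst_ok_mult:
  assumes A: "A \<in> carrier_mat n n" "subst_ok n A" and B: "B \<in> carrier_mat n n" "subst_ok n B"
  shows "subst_ok n (A * B)"
  unfolding subst_ok_def
proof
  fix f :: "(nat \<Rightarrow> real) \<Rightarrow> ennreal" assume [measurable]: "f \<in> borel_measurable (Pi\<^sub>M {..<n} (\<lambda>_. borel))"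
  have "(\<integral>\<^sup>+x. f x \<partial>leb n) = ennreal \<bar>det A\<bar> * (\<integral>\<^sup>+x. f (mv n A x) \<partial>leb n)"
    using A(2) \<open>f \<in> _\<close> unfolding subst_ok_def by blast
  also have "(\<lambda>x. f (mv n A x)) \<in> borel_measurable (Pi\<^sub>M {..<n} (\<lambda>_. borel))" by measurable
  then have "(\<integral>\<^sup>+x. f (mv n A x) \<partial>leb n) = ennreal \<bar>det B\<bar> * (\<integral>\<^sup>+x. f (mv n A (mv n B x)) \<partial>leb n)"
    using B(2) unfolding subst_ok_def by blast
  finally show "(\<integral>\<^sup>+x. f x \<partial>leb n) = ennreal \<bar>det (A * B)\<bar> * (\<integral>\<^sup>+x. f (mv n (A * B) x) \<partial>leb n)"
    using A B by (simp add: mv_mult det_mult abs_mult ennreal_mult mult.assoc)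
qed

lemma subst_ok_row_mat:
  assumes k: "k < n" and r: "r k \<noteq> 0"
  shows "subst_ok n (row_mat n k r)"
  unfolding subst_ok_def
proof
  fix f :: "(nat \<Rightarrow> real) \<Rightarrow> ennreal" assume f[measurable]: "f \<in> borel_measurable (Pi\<^sub>M {..<n} (\<lambda>_. borel))"
  define I where "I = {..<n} - {k}"
  have I: "finite I" "k \<notin> I" and n: "{..<n} = insert k I" using k by (auto simp: I_def)
  note f' = f[unfolded n]
  have mvf: "mv n (row_mat n k r) (x(k := u)) = x(k := (\<Sum>j\<in>I. r j * x j) + r k * u)"
    if x: "x \<in> extensional I" for x u
  proof (rule ext)
    fix i
    consider "i = k" | "i \<in> I" | "i \<notin> insert k I" by auto
    then show "mv n (row_mat n k r) (x(k := u)) i = (x(k := (\<Sum>j\<in>I. r j * x j) + r k * u)) i"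
    proof cases
      case 1
      have "(\<Sum>j<n. row_mat n k r $$ (k, j) * (x(k := u)) j) = (\<Sum>j<n. r j * (x(k := u)) j)"
        using k by (intro sum.cong) (auto simp: row_mat_def)
      also have "\<dots> = r k * u + (\<Sum>j\<in>I. r j * (x(k := u)) j)"
        unfolding n using I by simp
      also have "(\<Sum>j\<in>I. r j * (x(k := u)) j) = (\<Sum>j\<in>I. r j * x j)"
        using I by (intro sum.cong) auto
      finally show ?thesis using k 1 by (simp add: mv_def)
    next
      case 2
      then have i: "i < n" "i \<noteq> k" using n I by auto
      have "(\<Sum>j<n. row_mat n k r $$ (i, j) * (x(k := u)) j) = (\<Sum>j<n. if j = i then x i else 0)"
        using i by (intro sum.cong) (auto simp: row_mat_def)
      also have "\<dots> = x i" using i by simp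
      finally show ?thesis using i by (simp add: mv_def)
    next
      case 3
      then have "i \<notin> {..<n}" using n by auto
      then have "mv n (row_mat n k r) (x(k := u)) i = undefined" by (simp add: mv_def)
      moreover have "x i = undefined" "i \<noteq> k" using x 3 by (auto simp: extensional_def)
      ultimately show ?thesis by simp
    qed
  qed
  have sl: "(\<lambda>u. f (x(k := u))) \<in> borel_measurable borel" if "x \<in> extensional I" for x
  proof -
    have [measurable]: "x \<in> space (Pi\<^sub>M I (\<lambda>_. borel))" using that by (simp add: space_PiM PiE_def)
    show ?thesis using f' by measurable
  qed
  have fm: "(\<lambda>x. f (mv n (row_mat n k r) x)) \<in> borel_measurable (Pi\<^sub>M (insert k I) (\<lambda>_. borel))"
    unfolding n[symmetric] by measurable
  have "(\<integral>\<^sup>+x. f x \<partial>leb n) = (\<integral>\<^sup>+x. \<integral>\<^sup>+u. f (x(k := u)) \<partial>lborel \<partial>Pi\<^sub>M I (\<lambda>_. lborel))"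
    unfolding n by (rule nn_integral_leb_insert[OF I f'])
  also have "\<dots> = (\<integral>\<^sup>+x. ennreal \<bar>r k\<bar> * (\<integral>\<^sup>+u. f (x(k := (\<Sum>j\<in>I. r j * x j) + r k * u)) \<partial>lborel) \<partial>Pi\<^sub>M I (\<lambda>_. lborel))"
  proof (rule nn_integral_cong)
    fix x assume "x \<in> space (Pi\<^sub>M I (\<lambda>_. lborel :: real measure))"
    then have "x \<in> extensional I" by (simp add: space_PiM PiE_def)
    from nn_integral_real_affine[OF sl[OF this] r, of "\<Sum>j\<in>I. r j * x j"]
    show "(\<integral>\<^sup>+u. f (x(k := u)) \<partial>lborel) = ennreal \<bar>r k\<bar> * (\<integral>\<^sup>+u. f (x(k := (\<Sum>j\<in>I. r j * x j) + r k * u)) \<partial>lborel)" .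
  qed
  also have "\<dots> = (\<integral>\<^sup>+x. ennreal \<bar>r k\<bar> * (\<integral>\<^sup>+u. f (mv n (row_mat n k r) (x(k := u))) \<partial>lborel) \<partial>Pi\<^sub>M I (\<lambda>_. lborel))"
    by (intro nn_integral_cong) (simp add: mvf space_PiM PiE_def)
  also have "\<dots> = ennreal \<bar>r k\<bar> * (\<integral>\<^sup>+x. \<integral>\<^sup>+u. f (mv n (row_mat n k r) (x(k := u))) \<partial>lborel \<partial>Pi\<^sub>M I (\<lambda>_. lborel))"
    by (rule nn_integral_cmult) (use fm in measurable)
  also have "\<dots> = ennreal \<bar>r k\<bar> * (\<integral>\<^sup>+x. f (mv n (row_mat n k r) x) \<partial>leb n)"
    unfolding n by (subst nn_integral_leb_insert[OF I fm]) simp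
  finally show "(\<integral>\<^sup>+x. f x \<partial>leb n) = ennreal \<bar>det (row_mat n k r)\<bar> * (\<integral>\<^sup>+x. f (mv n (row_mat n k r) x) \<partial>leb n)"
    using det_row_mat[OF k] by simp
qed

lemma mv_one: "x \<in> extensional {..<n} \<Longrightarrow> mv n (1\<^sub>m n) x = x"
  by (auto simp: mv_def fun_eq_iff extensional_def if_distrib[where f="\<lambda>c. c * _"] cong: if_cong)

lemma subst_ok_one: "subst_ok n (1\<^sub>m n)"
  unfolding subst_ok_def by (auto intro!: nn_integral_cong simp: mv_one space_PiM PiE_def)

lemma subst_ok_pivot:
  assumes M: "M \<in> carrier_mat n n" and k: "k < n"
    and id: "\<And>i j. k < i \<Longrightarrow> i < n \<Longrightarrow> j < n \<Longrightarrow> M $$ (i, j) = (if i = j then 1 else 0)"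
    and pivot: "M $$ (k, k) \<noteq> 0" and det: "det M \<noteq> 0"
    and IH: "\<And>M'. M' \<in> carrier_mat n n \<Longrightarrow> det M' \<noteq> 0 \<Longrightarrow>
      (\<And>i j. k \<le> i \<Longrightarrow> i < n \<Longrightarrow> j < n \<Longrightarrow> M' $$ (i, j) = (if i = j then 1 else 0)) \<Longrightarrow> subst_ok n M'"
  shows "subst_ok n M"
proof -
  define p where "p = M $$ (k, k)"
  define r where "r j = M $$ (k, j)" for j
  define r' where "r' j = (if j = k then 1 / p else - r j / p)" for j
  define M' where "M' = M * row_mat n k r'"
  have p: "p \<noteq> 0" "r k = p" using pivot by (simp_all add: p_def r_def)
  have M': "M' \<in> carrier_mat n n" unfolding M'_def using M by simp
  have inv: "row_mat n k r' * row_mat n k r = 1\<^sub>m n"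
  proof (rule eq_matI)
    fix i j assume "i < dim_row (1\<^sub>m n)" "j < dim_col (1\<^sub>m n)"
    then have ij: "i < n" "j < n" by auto
    show "(row_mat n k r' * row_mat n k r) $$ (i, j) = 1\<^sub>m n $$ (i, j)"
      using ij k p by (subst mult_row_mat_index) (auto simp: row_mat_def r'_def)
  qed (simp_all add: row_mat_def)
  have eq: "M' * row_mat n k r = M"
    unfolding M'_def using M inv by (subst assoc_mult_mat[of _ n n _ n _ n]) auto
  have "det M' \<noteq> 0"
  proof
    assume "det M' = 0"
    then have "det (M' * row_mat n k r) = 0" using M' by (subst det_mult[of _ n]) auto
    then show False using eq det by simp
  qed
  moreover have "M' $$ (i, j) = (if i = j then 1 else 0)" if "k \<le> i" "i < n" "j < n" for i j
  proof (cases "i = k")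
    case True
    then show ?thesis
      unfolding M'_def using that M k p by (subst mult_row_mat_index) (auto simp: r'_def r_def p_def)
  next
    case False
    then have "k < i" using that by simp
    then show ?thesis
      unfolding M'_def using that M k id[of i k] id[of i j] by (subst mult_row_mat_index) auto
  qed
  ultimately have "subst_ok n M'" using IH M' by blast
  then have "subst_ok n (M' * row_mat n k r)"
    using M' k p by (intro subst_ok_mult subst_ok_row_mat) auto
  then show ?thesis unfolding eq .
qed

text \<open>
  Elimination of the nontrivial rows one at a time: if \<open>M\<close> is a nonsingular matrix whose rows below
  row \<open>k\<close> are trivial, then row \<open>k\<close> can be split off as a factor \<open>row_mat n k r\<close>, once a column
  operation has made the entry \<open>(k, k)\<close> nonzero.
\<close>

lemma subst_ok_identity_rows:
  assumes "k \<le> n" "M \<in> carrier_mat n n" "det M \<noteq> 0"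
    and "\<And>i j. k \<le> i \<Longrightarrow> i < n \<Longrightarrow> j < n \<Longrightarrow> M $$ (i, j) = (if i = j then 1 else 0)"
  shows "subst_ok n M"
  using assms
proof (induction k arbitrary: M)
  case 0
  then have "M = 1\<^sub>m n" by (intro eq_matI) auto
  then show ?case using subst_ok_one by simp
next
  case (Suc k)
  have k: "k < n" and M: "M \<in> carrier_mat n n" using Suc.prems by auto
  have id: "M $$ (i, j) = (if i = j then 1 else 0)" if "k < i" "i < n" "j < n" for i j
    using Suc.prems(4)[of i j] that by auto
  have step: "subst_ok n M'" if "M' \<in> carrier_mat n n" "det M' \<noteq> 0" "M' $$ (k, k) \<noteq> 0"
    "\<And>i j. k < i \<Longrightarrow> i < n \<Longrightarrow> j < n \<Longrightarrow> M' $$ (i, j) = (if i = j then 1 else 0)" for M'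
    by (rule subst_ok_pivot[OF that(1) k that(4) that(3) that(2)]) (use Suc.IH k in auto)
  show ?case
  proof (cases "M $$ (k, k) = 0")
    case False
    then show ?thesis using step[OF M _ _ id] Suc.prems(3) by blast
  next
    case True
    have "\<exists>j<k. M $$ (k, j) \<noteq> 0"
    proof (rule ccontr)
      assume "\<not> (\<exists>j<k. M $$ (k, j) \<noteq> 0)"
      then have z: "M $$ (k, j) = 0" if "j \<le> k" for j using True that by (cases "j = k") auto
      define v where "v = vec n (\<lambda>i. if i = k then 1 else if k < i then - M $$ (k, i) else 0)"
      have v: "v \<in> carrier_vec n" "v \<noteq> 0\<^sub>v n"
        using k by (auto simp: v_def vec_eq_iff intro!: exI[of _ k])
      have "transpose_mat M *\<^sub>v v = 0\<^sub>v n"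
      proof (rule eq_vecI)
        fix j assume "j < dim_vec (0\<^sub>v n)"
        then have j: "j < n" by simp
        have "(transpose_mat M *\<^sub>v v) $ j = (\<Sum>i<n. M $$ (i, j) * v $ i)"
          using j M v by (simp add: scalar_prod_def atLeast0LessThan)
        also have "\<dots> = M $$ (k, j) + (\<Sum>i\<in>{..<n} - {k}. M $$ (i, j) * v $ i)"
          using k by (subst sum.remove[of _ k]) (auto simp: v_def)
        also have "(\<Sum>i\<in>{..<n} - {k}. M $$ (i, j) * v $ i) = (\<Sum>i\<in>{..<n} - {k}. if i = j then (if k < j then - M $$ (k, j) else 0) else 0)"
          using id j by (intro sum.cong) (auto simp: v_def)
        also have "M $$ (k, j) + \<dots> = 0" using z[of j] j k by (auto simp: sum.delta)
        finally show "(transpose_mat M *\<^sub>v v) $ j = 0\<^sub>v n $ j" using j by simp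
      qed (use M in simp)
      then have "det (transpose_mat M) = 0"
        using v M by (subst det_0_iff_vec_prod_zero[of _ n]) auto
      then show False using Suc.prems(3) M det_transpose[of M n] by simp
    qed
    then obtain j where j: "j < k" "M $$ (k, j) \<noteq> 0" by auto
    define a where "a l = (if l = j \<or> l = k then 1 else 0 :: real)" for l
    define b where "b l = (if l = j then 1 else if l = k then - 1 else 0 :: real)" for l
    define M' where "M' = M * row_mat n j a"
    have jn: "j < n" using j k by simp
    have M': "M' \<in> carrier_mat n n" unfolding M'_def using M by simp
    have ent: "M' $$ (i, l) = M $$ (i, j) * a l + (if l = j then 0 else M $$ (i, l))" if "i < n" "l < n" for i l
      unfolding M'_def using M jn that by (intro mult_row_mat_index)
    have "subst_ok n M'"
    proof (rule step[OF M'])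
      show "det M' \<noteq> 0"
        unfolding M'_def using Suc.prems(3) M jn by (subst det_mult[of _ n]) (auto simp: det_row_mat a_def)
      show "M' $$ (k, k) \<noteq> 0" using ent[of k k] j k True by (auto simp: a_def)
      fix i l assume "k < i" "i < n" "l < n"
      then show "M' $$ (i, l) = (if i = l then 1 else 0)"
        using ent[of i l] id[of i j] id[of i l] jn j by auto
    qed
    moreover have "M' * row_mat n j b = M"
    proof -
      have "row_mat n j a * row_mat n j b = 1\<^sub>m n"
      proof (rule eq_matI)
        fix i l assume "i < dim_row (1\<^sub>m n)" "l < dim_col (1\<^sub>m n)"
        then have "i < n" "l < n" by auto
        then show "(row_mat n j a * row_mat n j b) $$ (i, l) = 1\<^sub>m n $$ (i, l)"
          using jn j(1) by (subst mult_row_mat_index) (auto simp: row_mat_def a_def b_def)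
      qed (simp_all add: row_mat_def)
      then show ?thesis unfolding M'_def using M by (subst assoc_mult_mat[of _ n n _ n _ n]) auto
    qed
    ultimately show ?thesis
      using subst_ok_mult[OF M' _ row_mat_carrier subst_ok_row_mat[OF jn, of b]] by (auto simp: b_def)
  qed
qed

lemma nn_integral_linear_substitution:
  assumes "M \<in> carrier_mat n n" "det M \<noteq> 0" "f \<in> borel_measurable (Pi\<^sub>M {..<n} (\<lambda>_. borel))"
  shows "(\<integral>\<^sup>+x. f x \<partial>leb n) = ennreal \<bar>det M\<bar> * (\<integral>\<^sup>+x. f (mv n M x) \<partial>leb n)"
proof -
  have "subst_ok n M" using assms by (intro subst_ok_identity_rows[of n]) auto
  then show ?thesis using assms(3) unfolding subst_ok_def by blast
qed

lemma nn_integral_gauss_density: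
  assumes "finite I" "f \<in> borel_measurable (Pi\<^sub>M I (\<lambda>_. borel))"
  shows "(\<integral>\<^sup>+x. f x \<partial>gauss I) = (\<integral>\<^sup>+x. ennreal (\<Prod>i\<in>I. std_normal_density (x i)) * f x \<partial>Pi\<^sub>M I (\<lambda>_. lborel))"
  using assms
proof (induction I arbitrary: f rule: finite_induct)
  case empty
  have e: "gauss {} = Pi\<^sub>M {} (\<lambda>_. lborel)"
    unfolding gauss_def by (simp add: PiM_empty)
  show ?case unfolding e by simp
next
  case (insert i I)
  note [measurable] = insert.prems
  have sl: "(\<lambda>u. f (x(i := u))) \<in> borel_measurable borel" if "x \<in> extensional I" for x
  proof -
    have [measurable]: "x \<in> space (Pi\<^sub>M I (\<lambda>_. borel))" using that by (simp add: space_PiM PiE_def)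
    show ?thesis by measurable
  qed
  have "(\<integral>\<^sup>+x. f x \<partial>gauss (insert i I)) = (\<integral>\<^sup>+x. \<integral>\<^sup>+u. f (x(i := u)) \<partial>gauss1 \<partial>gauss I)"
    by (rule nn_integral_gauss_insert) (use insert in auto)
  also have "\<dots> = (\<integral>\<^sup>+x. ennreal (\<Prod>i\<in>I. std_normal_density (x i)) * (\<integral>\<^sup>+u. f (x(i := u)) \<partial>gauss1) \<partial>Pi\<^sub>M I (\<lambda>_. lborel))"
    by (rule insert.IH) measurable
  also have "\<dots> = (\<integral>\<^sup>+x. \<integral>\<^sup>+u. ennreal (\<Prod>j\<in>insert i I. std_normal_density ((x(i := u)) j)) * f (x(i := u)) \<partial>lborel \<partial>Pi\<^sub>M I (\<lambda>_. lborel))"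
  proof (rule nn_integral_cong)
    fix x assume "x \<in> space (Pi\<^sub>M I (\<lambda>_. lborel :: real measure))"
    then have x: "x \<in> extensional I" by (simp add: space_PiM PiE_def)
    have pr: "(\<Prod>j\<in>insert i I. std_normal_density ((x(i := u)) j)) = (\<Prod>j\<in>I. std_normal_density (x j)) * std_normal_density u" for u
    proof -
      have "(\<Prod>j\<in>I. std_normal_density ((x(i := u)) j)) = (\<Prod>j\<in>I. std_normal_density (x j))"
        using insert by (intro prod.cong) auto
      then show ?thesis using insert by (simp add: mult.commute)
    qed
    have "ennreal (\<Prod>i\<in>I. std_normal_density (x i)) * (\<integral>\<^sup>+u. f (x(i := u)) \<partial>gauss1)
      = ennreal (\<Prod>i\<in>I. std_normal_density (x i)) * (\<integral>\<^sup>+u. ennreal (std_normal_density u) * f (x(i := u)) \<partial>lborel)"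
      using sl[OF x] by (simp add: nn_integral_gauss1)
    also have "\<dots> = (\<integral>\<^sup>+u. ennreal (\<Prod>i\<in>I. std_normal_density (x i)) * (ennreal (std_normal_density u) * f (x(i := u))) \<partial>lborel)"
      using sl[OF x] by (subst nn_integral_cmult) auto
    also have "\<dots> = (\<integral>\<^sup>+u. ennreal (\<Prod>j\<in>insert i I. std_normal_density ((x(i := u)) j)) * f (x(i := u)) \<partial>lborel)"
      unfolding pr by (intro nn_integral_cong) (simp add: ennreal_mult prod_nonneg mult.assoc)
    finally show "ennreal (\<Prod>i\<in>I. std_normal_density (x i)) * (\<integral>\<^sup>+u. f (x(i := u)) \<partial>gauss1)
      = (\<integral>\<^sup>+u. ennreal (\<Prod>j\<in>insert i I. std_normal_density ((x(i := u)) j)) * f (x(i := u)) \<partial>lborel)" .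
  qed
  also have "\<dots> = (\<integral>\<^sup>+x. ennreal (\<Prod>j\<in>insert i I. std_normal_density (x j)) * f x \<partial>Pi\<^sub>M (insert i I) (\<lambda>_. lborel))"
    by (rule nn_integral_leb_insert[symmetric]) (use insert in auto)
  finally show ?case .
qed

section \<open>Gaussian measures with general covariance\<close>

lemma linf_norm_nonneg: "0 < dim_vec x \<Longrightarrow> 0 \<le> linf_norm x"
  unfolding linf_norm_def
  by (subst Max_ge_iff) auto

lemma abs_le_linf_norm: "i < dim_vec x \<Longrightarrow> \<bar>x $ i\<bar> \<le> linf_norm x"
  unfolding linf_norm_def by (rule Max_ge) auto

lemma linf_norm_le: "0 < dim_vec x \<Longrightarrow> (\<And>i. i < dim_vec x \<Longrightarrow> \<bar>x $ i\<bar> \<le> B) \<Longrightarrow> linf_norm x \<le> B"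
  unfolding linf_norm_def by (subst Max_le_iff) auto

lemma mult_mat_vec_sum:
  assumes "A \<in> carrier_mat n n" "x \<in> carrier_vec n" "i < n"
  shows "(A *\<^sub>v x) $ i = (\<Sum>j<n. A $$ (i, j) * x $ j)"
  using assms by (simp add: scalar_prod_def atLeast0LessThan)

lemma row_sum_le_linf_op_norm:
  assumes n: "0 < n" and A: "A \<in> carrier_mat n n" and i: "i < n"
  shows "(\<Sum>j<n. \<bar>A $$ (i, j)\<bar>) \<le> linf_op_norm n A"
proof -
  define B where "B = (\<Sum>i<n. \<Sum>j<n. \<bar>A $$ (i, j)\<bar>)"
  have B0: "0 \<le> B" unfolding B_def by (intro sum_nonneg) auto
  have bound: "linf_norm (A *\<^sub>v x) / linf_norm x \<le> B" if x: "x \<in> carrier_vec n" for x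
  proof -
    have nn: "0 \<le> linf_norm x" using x n by (intro linf_norm_nonneg) auto
    have "linf_norm (A *\<^sub>v x) \<le> B * linf_norm x"
    proof (rule linf_norm_le)
      fix i assume "i < dim_vec (A *\<^sub>v x)"
      then have i: "i < n" using A by simp
      have "\<bar>(A *\<^sub>v x) $ i\<bar> \<le> (\<Sum>j<n. \<bar>A $$ (i, j)\<bar> * \<bar>x $ j\<bar>)"
        unfolding mult_mat_vec_sum[OF A x i] abs_mult[symmetric] by (rule sum_abs)
      also have "\<dots> \<le> (\<Sum>j<n. \<bar>A $$ (i, j)\<bar> * linf_norm x)"
        using x by (intro sum_mono mult_left_mono abs_le_linf_norm) auto
      also have "\<dots> = (\<Sum>j<n. \<bar>A $$ (i, j)\<bar>) * linf_norm x" by (simp add: sum_distrib_right)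
      also have "\<dots> \<le> B * linf_norm x"
        unfolding B_def using i nn by (intro mult_right_mono member_le_sum sum_nonneg) (auto intro: sum_nonneg)
      finally show "\<bar>(A *\<^sub>v x) $ i\<bar> \<le> B * linf_norm x" .
    qed (use A n in simp)
    then show ?thesis using nn B0 by (cases "linf_norm x = 0") (auto simp: pos_divide_le_eq)
  qed
  define x where "x = vec n (\<lambda>j. if 0 \<le> A $$ (i, j) then 1 else - 1 :: real)"
  have x: "x \<in> carrier_vec n" "x \<noteq> 0\<^sub>v n"
    using n by (auto simp: x_def vec_eq_iff intro!: exI[of _ 0])
  have "linf_norm x \<le> 1" using n by (intro linf_norm_le) (auto simp: x_def)
  moreover have "1 \<le> linf_norm x" using abs_le_linf_norm[of 0 x] n by (simp add: x_def split: if_splits)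
  ultimately have x1: "linf_norm x = 1" by simp
  have "(A *\<^sub>v x) $ i = (\<Sum>j<n. \<bar>A $$ (i, j)\<bar>)"
    unfolding mult_mat_vec_sum[OF A x(1) i] by (intro sum.cong) (auto simp: x_def)
  then have "(\<Sum>j<n. \<bar>A $$ (i, j)\<bar>) \<le> linf_norm (A *\<^sub>v x)"
    using abs_le_linf_norm[of i "A *\<^sub>v x"] A i by simp
  also have "\<dots> = linf_norm (A *\<^sub>v x) / linf_norm x" using x1 by simp
  also have "\<dots> \<le> linf_op_norm n A"
    unfolding linf_op_norm_def
  proof (rule cSUP_upper)
    show "bdd_above ((\<lambda>x. linf_norm (A *\<^sub>v x) / linf_norm x) ` {x \<in> carrier_vec n. x \<noteq> 0\<^sub>v n})"
      by (rule bdd_aboveI2[of _ _ B]) (use bound in auto)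
  qed (use x in auto)
  finally show ?thesis .
qed

lemma influence_inequality_of_bound:
  fixes n :: nat and K p :: real and J :: "nat \<Rightarrow> real" and Infl :: "nat \<Rightarrow> ennreal"
  assumes K: "0 < K" and J: "\<And>i. i < n \<Longrightarrow> 0 \<le> J i" "\<And>i. i < n \<Longrightarrow> ennreal (J i) \<le> Infl i"
    and p: "0 \<le> p" "p \<le> 1"
    and bound: "\<And>\<delta>. (\<And>i. i < n \<Longrightarrow> K * J i \<le> \<delta>) \<Longrightarrow> 0 < \<delta> \<Longrightarrow> \<delta> < 1 \<Longrightarrow>
      p * (1 - p) * sqrt (ln (1 / \<delta>)) \<le> 1024 * K * (\<Sum>i<n. J i)"
  shows "ennreal (1 / 1024 * inverse K * p * (1 - p)) * sqrt_ennreal (log_plus (1 / (ennreal K * (MAX i\<in>{..<n}. Infl i))))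
    \<le> (\<Sum>i<n. Infl i)"
proof -
  define m where "m = (MAX i\<in>{..<n}. Infl i)"
  have le_m: "Infl i \<le> m" if "i < n" for i unfolding m_def using that by (intro Max_ge) auto
  have p0: "0 \<le> p * (1 - p)" using p by simp
  show ?thesis unfolding m_def[symmetric]
  proof (cases m)
    case top
    then have "ennreal K * m = \<infinity>" using K by (simp add: ennreal_mult_top)
    then have "1 / (ennreal K * m) = 0" by simp
    then show "ennreal (1 / 1024 * inverse K * p * (1 - p)) * sqrt_ennreal (log_plus (1 / (ennreal K * m))) \<le> (\<Sum>i<n. Infl i)"
      by (simp add: log_plus_def sqrt_ennreal_def)
  next
    case (real m')
    have Jm: "J i \<le> m'" if "i < n" for i
      using J(2)[OF that] le_m[OF that] real by (metis ennreal_le_iff order_trans)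
    show "ennreal (1 / 1024 * inverse K * p * (1 - p)) * sqrt_ennreal (log_plus (1 / (ennreal K * m))) \<le> (\<Sum>i<n. Infl i)"
    proof (cases "m' = 0")
      case True
      then have J0: "J i = 0" if "i < n" for i using Jm[OF that] J(1)[OF that] by simp
      have "p * (1 - p) * sqrt (ln (1 / exp (- 1))) \<le> 1024 * K * (\<Sum>i<n. J i)"
        by (rule bound) (use J0 in auto)
      then have "p * (1 - p) \<le> 0" using J0 by (simp add: ln_div)
      then have "p * (1 - p) = 0" using p0 by linarith
      then have z: "1 / 1024 * inverse K * p * (1 - p) = 0" by auto
      show ?thesis unfolding z by simp
    next
      case False
      then have m': "0 < m'" using real by simp
      define \<delta> where "\<delta> = K * m'"
      have \<delta>: "0 < \<delta>" using K m' by (simp add: \<delta>_def)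
      have "1 / (ennreal K * m) = ennreal (1 / \<delta>)"
        using real K m' \<delta> by (simp add: \<delta>_def ennreal_mult[symmetric] divide_ennreal[of 1, simplified])
      then have "log_plus (1 / (ennreal K * m)) = ennreal (max (ln (1 / \<delta>)) 0)"
        using \<delta> by (simp add: log_plus_def)
      moreover have "sqrt_ennreal (ennreal t) = ennreal (sqrt t)" if "0 \<le> t" for t
        using that by (simp add: sqrt_ennreal_def)
      ultimately have eq: "sqrt_ennreal (log_plus (1 / (ennreal K * m))) = ennreal (sqrt (max (ln (1 / \<delta>)) 0))"
        by (metis max.cobounded2)
      show ?thesis
      proof (cases "\<delta> < 1")
        case False
        then have "ln (1 / \<delta>) \<le> 0" using \<delta> by (simp add: ln_div)
        then show ?thesis unfolding eq by (simp add: max_def)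
      next
        case True
        have "p * (1 - p) * sqrt (ln (1 / \<delta>)) \<le> 1024 * K * (\<Sum>i<n. J i)"
          by (rule bound) (use \<delta> True K Jm in \<open>auto simp: \<delta>_def\<close>)
        then have "1 / 1024 * inverse K * p * (1 - p) * sqrt (ln (1 / \<delta>)) \<le> (\<Sum>i<n. J i)"
          using K by (simp add: field_simps)
        moreover have "0 \<le> ln (1 / \<delta>)" using True \<delta> by (simp add: ln_div)
        ultimately have "ennreal (1 / 1024 * inverse K * p * (1 - p)) * sqrt_ennreal (log_plus (1 / (ennreal K * m))) \<le> ennreal (\<Sum>i<n. J i)"
          unfolding eq by (subst ennreal_mult''[symmetric]) (auto simp: max_def intro!: ennreal_leI)
        also have "\<dots> = (\<Sum>i<n. ennreal (J i))" using J by (subst sum_ennreal) auto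
        also have "\<dots> \<le> (\<Sum>i<n. Infl i)" using J by (intro sum_mono) auto
        finally show ?thesis .
      qed
    qed
  qed
qed

locale covariance_root = finite_index "{..<n}" for n :: nat +
  fixes C S :: "real mat"
  assumes n: "0 < n" and C: "C \<in> carrier_mat n n" "positive_definite n C"
    and S: "S \<in> carrier_mat n n" "symmetric_mat S" "S * S = C"
begin

definition S_inv :: "real mat" where
  "S_inv = the (mat_inverse C) * S"

lemma det_C: "det C \<noteq> 0"
proof
  assume "det C = 0"
  then obtain v where v: "v \<in> carrier_vec n" "v \<noteq> 0\<^sub>v n" "C *\<^sub>v v = 0\<^sub>v n"
    using det_0_iff_vec_prod_zero[OF C(1)] by auto
  then have "scalar_prod v (C *\<^sub>v v) = 0" by simp
  then show False using C(2) v unfolding positive_definite_def by force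
qed

lemma det_S: "det S \<noteq> 0" "det C = (det S)\<^sup>2"
  using det_C det_mult[OF S(1) S(1)] S(3) by (auto simp: power2_eq_square)

lemma C_inv: "the (mat_inverse C) \<in> carrier_mat n n" "the (mat_inverse C) * C = 1\<^sub>m n"
proof -
  have "mat_inverse C \<noteq> None"
    using mat_inverse(1)[OF C(1), where b="()"] det_non_zero_imp_unit[OF C(1) det_C, where b="()"] by blast
  then obtain B where "mat_inverse C = Some B" by auto
  then show "the (mat_inverse C) \<in> carrier_mat n n" "the (mat_inverse C) * C = 1\<^sub>m n"
    using mat_inverse(2)[OF C(1)] by auto
qed

lemma S_inv: "S_inv \<in> carrier_mat n n" "S_inv * S = 1\<^sub>m n" "S * S_inv = 1\<^sub>m n"
proof -
  show c: "S_inv \<in> carrier_mat n n" using C_inv S by (simp add: S_inv_def)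
  show "S_inv * S = 1\<^sub>m n"
    unfolding S_inv_def using C_inv S by (subst assoc_mult_mat[of _ n n _ n _ n]) auto
  then show "S * S_inv = 1\<^sub>m n" using mat_mult_left_right_inverse[OF c S(1)] by simp
qed

lemma S_sym: "i < n \<Longrightarrow> j < n \<Longrightarrow> S $$ (i, j) = S $$ (j, i)"
  using S(1,2) unfolding symmetric_mat_def by (metis carrier_matD index_transpose_mat(1))

lemma vec_mv: "vec n (mv n S z) = S *\<^sub>v vec n z"
  using S(1) by (intro eq_vecI) (simp_all add: mult_mat_vec_sum mv_def del: index_mult_mat_vec)

lemma gaussian_density_mv:
  "\<bar>det S\<bar> * gaussian_density n C (mv n S z) = (\<Prod>i<n. std_normal_density (z i))"
proof -
  define Z where "Z = vec n z"
  have Z: "Z \<in> carrier_vec n" by (simp add: Z_def)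
  note B = C_inv(1)
  have SZ: "S *\<^sub>v Z \<in> carrier_vec n" using S Z by simp
  have "scalar_prod (S *\<^sub>v Z) (the (mat_inverse C) *\<^sub>v (S *\<^sub>v Z)) = scalar_prod Z (S *\<^sub>v (the (mat_inverse C) *\<^sub>v (S *\<^sub>v Z)))"
    using transpose_vec_mult_scalar[OF S(1), of "the (mat_inverse C) *\<^sub>v (S *\<^sub>v Z)" Z] S(2) B SZ Z
    unfolding symmetric_mat_def by simp
  also have "S *\<^sub>v (the (mat_inverse C) *\<^sub>v (S *\<^sub>v Z)) = (S * S_inv) *\<^sub>v Z"
    unfolding S_inv_def using S(1) B Z assoc_mult_mat_vec[OF S(1) mult_carrier_mat[OF B S(1)] Z] assoc_mult_mat_vec[OF B S(1) Z]
    by simp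
  also have "\<dots> = Z" using S_inv(3) Z by simp
  also have "scalar_prod Z Z = (\<Sum>i<n. (z i)\<^sup>2)"
    by (simp add: Z_def scalar_prod_def atLeast0LessThan power2_eq_square)
  finally have q: "scalar_prod (S *\<^sub>v Z) (the (mat_inverse C) *\<^sub>v (S *\<^sub>v Z)) = (\<Sum>i<n. (z i)\<^sup>2)" .
  have d: "sqrt ((2 * pi) ^ n * det C) = sqrt (2 * pi) ^ n * \<bar>det S\<bar>"
    unfolding det_S(2) real_sqrt_mult[of "(2 * pi) ^ n"] real_sqrt_abs by (simp only: real_sqrt_power)
  have "gaussian_density n C (mv n S z) = exp (- (\<Sum>i<n. (z i)\<^sup>2) / 2) / (sqrt (2 * pi) ^ n * \<bar>det S\<bar>)"
    unfolding gaussian_density_def vec_mv Z_def[symmetric] q d ..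
  then have "\<bar>det S\<bar> * gaussian_density n C (mv n S z) = exp (- (\<Sum>i<n. (z i)\<^sup>2) / 2) / sqrt (2 * pi) ^ n"
    using det_S(1) by simp
  also have "- (\<Sum>i<n. (z i)\<^sup>2) / 2 = (\<Sum>i<n. - (z i)\<^sup>2 / 2)"
    by (simp add: sum_negf sum_divide_distrib)
  also have "exp \<dots> / sqrt (2 * pi) ^ n = (\<Prod>i<n. exp (- (z i)\<^sup>2 / 2) / sqrt (2 * pi))"
    by (simp add: exp_sum prod_dividef)
  also have "\<dots> = (\<Prod>i<n. std_normal_density (z i))"
    by (intro prod.cong) (simp_all add: std_normal_density_def)
  finally show ?thesis .
qed

abbreviation \<mu> :: "(nat \<Rightarrow> real) measure" where "\<mu> \<equiv> gaussian_measure n C"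

lemma sets_\<mu>: "sets \<mu> = sets (Rn n)"
  unfolding gaussian_measure_def Rn_def by (simp add: sets_leb)

lemma gaussian_density_nonneg: "0 \<le> gaussian_density n C x"
  unfolding gaussian_density_def det_S(2) by (intro divide_nonneg_nonneg real_sqrt_ge_zero mult_nonneg_nonneg) auto

lemma measurable_gaussian_density [measurable]: "gaussian_density n C \<in> borel_measurable (Pi\<^sub>M {..<n} (\<lambda>_. borel))"
proof -
  let ?B = "the (mat_inverse C)"
  have "scalar_prod (vec n x) (?B *\<^sub>v vec n x) = (\<Sum>i<n. x i * (\<Sum>j<n. ?B $$ (i, j) * x j))" for x
    using C_inv(1) by (simp add: scalar_prod_def atLeast0LessThan)
  then have "gaussian_density n C = (\<lambda>x. exp (- (\<Sum>i<n. x i * (\<Sum>j<n. ?B $$ (i, j) * x j)) / 2) / sqrt ((2 * pi) ^ n * det C))"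
    by (simp add: gaussian_density_def fun_eq_iff)
  then show ?thesis by simp
qed

lemma nn_integral_\<mu>:
  assumes [measurable]: "f \<in> borel_measurable (Pi\<^sub>M {..<n} (\<lambda>_. borel))"
  shows "(\<integral>\<^sup>+x. f x \<partial>\<mu>) = (\<integral>\<^sup>+z. f (mv n S z) \<partial>G)"
proof -
  have "(\<integral>\<^sup>+x. f x \<partial>\<mu>) = (\<integral>\<^sup>+x. ennreal (gaussian_density n C x) * f x \<partial>leb n)"
    unfolding gaussian_measure_def by (subst nn_integral_density) auto
  also have "\<dots> = ennreal \<bar>det S\<bar> * (\<integral>\<^sup>+z. ennreal (gaussian_density n C (mv n S z)) * f (mv n S z) \<partial>leb n)"
    by (rule nn_integral_linear_substitution[OF S(1) det_S(1)]) measurable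
  also have "\<dots> = (\<integral>\<^sup>+z. ennreal \<bar>det S\<bar> * (ennreal (gaussian_density n C (mv n S z)) * f (mv n S z)) \<partial>leb n)"
    by (rule nn_integral_cmult[symmetric]) measurable
  also have "\<dots> = (\<integral>\<^sup>+z. ennreal (\<Prod>i<n. std_normal_density (z i)) * f (mv n S z) \<partial>leb n)"
    unfolding gaussian_density_mv[symmetric]
    by (simp add: ennreal_mult gaussian_density_nonneg mult.assoc)
  also have "\<dots> = (\<integral>\<^sup>+z. f (mv n S z) \<partial>G)"
    by (rule nn_integral_gauss_density[symmetric]) auto
  finally show ?thesis .
qed

definition pull :: "(nat \<Rightarrow> real) set \<Rightarrow> (nat \<Rightarrow> real) \<Rightarrow> real" where
  "pull X z = indicator X (mv n S z)"

lemma measurable_pull [measurable]: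
  assumes "X \<in> sets (Rn n)"
  shows "pull X \<in> borel_measurable (Pi\<^sub>M {..<n} (\<lambda>_. borel))"
proof -
  have [measurable]: "X \<in> sets (Pi\<^sub>M {..<n} (\<lambda>_. borel))" using assms by (simp add: Rn_def)
  show ?thesis unfolding pull_def by measurable
qed

lemma pull_01: "pull X z = 0 \<or> pull X z = 1" and pull_nonneg: "0 \<le> pull X z" and pull_le_1: "pull X z \<le> 1" and abs_pull_le: "\<bar>pull X z\<bar> \<le> 1"
  by (auto simp: pull_def indicator_def)

lemma emeasure_\<mu>:
  assumes X: "X \<in> sets (Rn n)"
  shows "emeasure \<mu> X = ennreal (\<integral>z. pull X z \<partial>G)" "measure \<mu> X = (\<integral>z. pull X z \<partial>G)"
proof -
  have X': "X \<in> sets (Pi\<^sub>M {..<n} (\<lambda>_. borel))" using X by (simp add: Rn_def)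
  have m: "pull X \<in> borel_measurable G" using measurable_pull[OF X] by (simp add: measurable_gauss_iff)
  have "emeasure \<mu> X = (\<integral>\<^sup>+x. indicator X x \<partial>\<mu>)" using X by (simp add: sets_\<mu>)
  also have "\<dots> = (\<integral>\<^sup>+z. indicator X (mv n S z) \<partial>G)"
    by (rule nn_integral_\<mu>) (use X' in measurable)
  also have "\<dots> = (\<integral>\<^sup>+z. ennreal (pull X z) \<partial>G)"
    by (intro nn_integral_cong) (auto simp: pull_def indicator_def)
  also have "\<dots> = ennreal (\<integral>z. pull X z \<partial>G)"
    by (rule nn_integral_eq_integral[OF gauss.bdd_integrable[OF bddI[of _ 1] m]]) (auto simp: abs_pull_le pull_nonneg pull_le_1)
  finally show e: "emeasure \<mu> X = ennreal (\<integral>z. pull X z \<partial>G)" .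
  show "measure \<mu> X = (\<integral>z. pull X z \<partial>G)"
    unfolding measure_def e by (simp add: pull_nonneg)
qed

definition S_dir :: "nat \<Rightarrow> nat \<Rightarrow> real" where
  "S_dir j i = S_inv $$ (i, j)"

lemma mv_shift:
  assumes "j < n"
  shows "mv n S (lin {..<n} 1 1 z (\<lambda>i. t * S_dir j i)) = (\<lambda>i\<in>{..<n}. mv n S z i + t * (if i = j then 1 else 0))"
proof (rule ext)
  fix i
  show "mv n S (lin {..<n} 1 1 z (\<lambda>i. t * S_dir j i)) i = (\<lambda>i\<in>{..<n}. mv n S z i + t * (if i = j then 1 else 0)) i"
  proof (cases "i < n")
    case True
    have "(\<Sum>l<n. S $$ (i, l) * lin {..<n} 1 1 z (\<lambda>i. t * S_dir j i) l) = (\<Sum>l<n. S $$ (i, l) * z l + t * (S $$ (i, l) * S_inv $$ (l, j)))"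
      by (intro sum.cong) (auto simp: lin_def S_dir_def algebra_simps)
    also have "\<dots> = (\<Sum>l<n. S $$ (i, l) * z l) + t * (S * S_inv) $$ (i, j)"
      using mult_mat_index[OF S(1) S_inv(1) True assms] by (simp add: sum.distrib sum_distrib_left)
    also have "(S * S_inv) $$ (i, j) = (if i = j then 1 else 0)" using S_inv(3) True assms by simp
    finally show ?thesis using True by (simp add: mv_def)
  qed (simp add: mv_def)
qed

text \<open>The sign \<open>s\<close> is \<open>1\<close> for increasing and \<open>- 1\<close> for decreasing sets.\<close>

lemma thicken_eq:
  assumes X: "X \<subseteq> space (Rn n)" and s: "s = 1 \<or> s = -1"
    and up: "\<And>a y. a \<in> X \<Longrightarrow> y \<in> space (Rn n) \<Longrightarrow> (\<And>i. i < n \<Longrightarrow> s * a i \<le> s * y i) \<Longrightarrow> y \<in> X"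
    and j: "j < n" and r: "0 < r"
  shows "thicken n (basis_vector n j) r X = {x \<in> space (Rn n). (\<lambda>i\<in>{..<n}. x i + s * r * (if i = j then 1 else 0)) \<in> X}"
proof (intro equalityI subsetI)
  fix x assume "x \<in> thicken n (basis_vector n j) r X"
  then obtain a t where a: "a \<in> X" and t: "- r \<le> t" "t \<le> r" and x: "x = (\<lambda>i\<in>{..<n}. a i + t * basis_vector n j i)"
    unfolding thicken_def by auto
  have "(\<lambda>i\<in>{..<n}. x i + s * r * (if i = j then 1 else 0)) \<in> X"
  proof (rule up[OF a])
    fix i assume "i < n"
    then show "s * a i \<le> s * (\<lambda>i\<in>{..<n}. x i + s * r * (if i = j then 1 else 0)) i"
      using t s by (auto simp: x basis_vector_def)
  qed (simp add: Rn_def space_PiM)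
  moreover have "x \<in> space (Rn n)" by (simp add: x Rn_def space_PiM)
  ultimately show "x \<in> {x \<in> space (Rn n). (\<lambda>i\<in>{..<n}. x i + s * r * (if i = j then 1 else 0)) \<in> X}" by simp
next
  fix x assume "x \<in> {x \<in> space (Rn n). (\<lambda>i\<in>{..<n}. x i + s * r * (if i = j then 1 else 0)) \<in> X}"
  then have x: "x \<in> extensional {..<n}" and a: "(\<lambda>i\<in>{..<n}. x i + s * r * (if i = j then 1 else 0)) \<in> X" (is "?a \<in> X")
    by (auto simp: Rn_def space_PiM PiE_def)
  have "x = (\<lambda>i\<in>{..<n}. ?a i + (- s * r) * basis_vector n j i)"
    using x by (auto simp: fun_eq_iff extensional_def basis_vector_def)
  moreover have "- s * r \<in> {- r..r}" using s r by auto
  ultimately show "x \<in> thicken n (basis_vector n j) r X"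
    unfolding thicken_def using a by blast
qed

lemma coord_influence_ge:
  assumes X: "X \<in> sets (Rn n)" and s: "s = 1 \<or> s = -1"
    and up: "\<And>a y. a \<in> X \<Longrightarrow> y \<in> space (Rn n) \<Longrightarrow> (\<And>i. i < n \<Longrightarrow> s * a i \<le> s * y i) \<Longrightarrow> y \<in> X"
    and j: "j < n"
  shows "ennreal (s * (\<integral>z. pull X z * dotp {..<n} (S_dir j) z \<partial>G)) \<le> coord_influence n \<mu> j X"
proof -
  let ?J = "s * (\<integral>z. pull X z * dotp {..<n} (S_dir j) z \<partial>G)"
  let ?D = "dotp {..<n} (S_dir j) (S_dir j)"
  have XRn[measurable]: "X \<in> sets (Pi\<^sub>M {..<n} (\<lambda>_. borel))" using X by (simp add: Rn_def)
  have quot: "ennreal (?J - r * ?D) \<le> (emeasure (completion \<mu>) (thicken n (basis_vector n j) r X) - emeasure (completion \<mu>) X) / ennreal r"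
    if r: "0 < r" for r
  proof -
    define T where "T = {x \<in> space (Rn n). (\<lambda>i\<in>{..<n}. x i + s * r * (if i = j then 1 else 0)) \<in> X}"
    have T: "thicken n (basis_vector n j) r X = T"
      unfolding T_def using sets.sets_into_space[OF X] s up j r by (rule thicken_eq)
    have Ts: "T \<in> sets (Rn n)"
    proof -
      have "(\<lambda>x. \<lambda>i\<in>{..<n}. x i + s * r * (if i = j then 1 else 0)) -` X \<inter> space (Pi\<^sub>M {..<n} (\<lambda>_. borel)) \<in> sets (Pi\<^sub>M {..<n} (\<lambda>_. borel))"
        by (rule measurable_sets[OF _ XRn]) measurable
      moreover have "T = (\<lambda>x. \<lambda>i\<in>{..<n}. x i + s * r * (if i = j then 1 else 0)) -` X \<inter> space (Pi\<^sub>M {..<n} (\<lambda>_. borel))"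
        by (auto simp: T_def Rn_def)
      ultimately show ?thesis by (simp add: Rn_def)
    qed
    let ?v = "\<lambda>i. s * r * S_dir j i"
    have pT: "pull T z = pull X (lin {..<n} 1 1 z ?v)" for z
      unfolding pull_def mv_shift[OF j] T_def by (auto simp: indicator_def Rn_def space_PiM mv_def)
    have dv: "dotp {..<n} ?v z = s * r * dotp {..<n} (S_dir j) z" for z
      by (simp add: dotp_def sum_distrib_left mult.assoc)
    have dvv: "dotp {..<n} ?v ?v = r * r * ?D"
      using s by (auto simp: dotp_def sum_distrib_left mult_ac)
    have "(\<integral>z. pull X z * dotp {..<n} ?v z \<partial>G) = r * ?J"
      unfolding dv mult.left_commute[of _ "s * r"] by simp
    then have le: "r * (?J - r * ?D) \<le> (\<integral>z. pull T z \<partial>G) - (\<integral>z. pull X z \<partial>G)"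
      using integral_shift_remainder[OF measurable_pull[OF X] abs_pull_le, of ?v]
      unfolding pT dvv by (simp add: right_diff_distrib mult.assoc)
    then have "?J - r * ?D \<le> ((\<integral>z. pull T z \<partial>G) - (\<integral>z. pull X z \<partial>G)) / r"
      using r by (simp add: pos_le_divide_eq mult.commute)
    then have "ennreal (?J - r * ?D) \<le> ennreal (((\<integral>z. pull T z \<partial>G) - (\<integral>z. pull X z \<partial>G)) / r)"
      by (rule ennreal_leI)
    also have "\<dots> \<le> ennreal ((\<integral>z. pull T z \<partial>G) - (\<integral>z. pull X z \<partial>G)) / ennreal r"
      using r by (cases "0 \<le> (\<integral>z. pull T z \<partial>G) - (\<integral>z. pull X z \<partial>G)")
        (auto simp: divide_ennreal ennreal_neg divide_nonpos_pos)
    also have "\<dots> = (emeasure (completion \<mu>) T - emeasure (completion \<mu>) X) / ennreal r"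
      using X Ts by (simp add: emeasure_completion sets_\<mu> emeasure_\<mu> ennreal_minus pull_nonneg)
    finally show ?thesis unfolding T .
  qed
  have "((\<lambda>r. ennreal (?J - r * ?D)) \<longlongrightarrow> ennreal (?J - 0 * ?D)) (at_right 0)"
    by (intro tendsto_ennrealI tendsto_intros)
  then have "ennreal ?J = Liminf (at_right 0) (\<lambda>r. ennreal (?J - r * ?D))"
    by (subst lim_imp_Liminf) auto
  also have "\<dots> \<le> coord_influence n \<mu> j X"
    unfolding coord_influence_def influence_def
    by (rule Liminf_mono) (use quot in \<open>auto simp: eventually_at_filter intro!: always_eventually\<close>)
  finally show ?thesis .
qed

lemma monotone_set_increasing:
  assumes X: "X \<in> sets (Rn n)" and up: "increasing_set n X"
  shows "monotone_set {..<n} (\<lambda>j i. S $$ (j, i)) S_dir (pull X) (linf_op_norm n S)"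
proof (standard, goal_cases)
  case 1 show ?case by (rule measurable_pull[OF X])
next
  case 2 show ?case by (rule pull_01)
next
  case (3 x y)
  have le: "mv n S x i \<le> mv n S y i" if "i < n" for i
    using 3(3)[of i] that by (simp add: mv_def dotp_def)
  have "mv n S y \<in> space (Rn n)" by (simp add: mv_def Rn_def space_PiM)
  then show ?case using le up unfolding increasing_set_def pull_def by (auto simp: indicator_def)
next
  case (4 j l)
  then show ?case using mult_mat_index[OF S(1) S_inv(1), of l j] S_inv(3) by (simp add: dotp_def S_dir_def)
next
  case (5 i l)
  then show ?case using mult_mat_index[OF S_inv(1) S(1), of l i] S_inv(2) by (simp add: S_dir_def mult.commute)
next
  case (6 i)
  then have "(\<Sum>j<n. \<bar>S $$ (j, i)\<bar>) = (\<Sum>j<n. \<bar>S $$ (i, j)\<bar>)" by (intro sum.cong) (auto simp: S_sym)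
  then show ?case using row_sum_le_linf_op_norm[OF n S(1)] 6 by simp
next
  case (7 j)
  then show ?case using row_sum_le_linf_op_norm[OF n S(1)] by simp
qed

lemma linf_op_norm_pos: "0 < linf_op_norm n S"
proof (rule ccontr)
  assume "\<not> 0 < linf_op_norm n S"
  then have "(\<Sum>j<n. \<bar>S $$ (0, j)\<bar>) \<le> 0" using row_sum_le_linf_op_norm[OF n S(1) n] by linarith
  moreover have "0 \<le> (\<Sum>j<n. \<bar>S $$ (0, j)\<bar>)" by (intro sum_nonneg) auto
  ultimately have "(\<Sum>j<n. \<bar>S $$ (0, j)\<bar>) = 0" by linarith
  then have "S $$ (0, j) = 0" if "j < n" for j using that by (simp add: sum_nonneg_eq_0_iff)
  then have "(S * S_inv) $$ (0, 0) = 0" using mult_mat_index[OF S(1) S_inv(1) n n] by simp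
  then show False using S_inv(3) n by simp
qed

lemma influence_inequality:
  assumes X: "X \<in> sets (Rn n)" and mono: "monotonic_set n X"
  shows "ennreal (1 / 1024 * inverse (linf_op_norm n S) * measure \<mu> X * (1 - measure \<mu> X)) *
      sqrt_ennreal (log_plus (1 / (ennreal (linf_op_norm n S) * (MAX i\<in>{..<n}. coord_influence n \<mu> i X))))
    \<le> (\<Sum>i<n. coord_influence n \<mu> i X)"
proof -
  let ?p = "measure \<mu> X"
  have bX: "bdd (pull X)" using abs_pull_le by (rule bddI)
  have iX: "integrable G (pull X)" using measurable_pull[OF X] bX by (rule integrable_G)
  have pX: "?p = (\<integral>z. pull X z \<partial>G)" using emeasure_\<mu>(2)[OF X] .
  have p: "0 \<le> ?p" "?p \<le> 1"
  proof -
    show "0 \<le> ?p" by simp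
    have "?p \<le> (\<integral>z. 1 \<partial>G)" unfolding pX using iX by (intro integral_mono) (auto simp: pull_def indicator_def)
    then show "?p \<le> 1" by (simp add: gauss.prob_space)
  qed
  from mono consider "increasing_set n X" | "decreasing_set n X" unfolding monotonic_set_def by auto
  then show ?thesis
  proof cases
    case 1
    interpret M: monotone_set "{..<n}" "\<lambda>j i. S $$ (j, i)" S_dir "pull X" "linf_op_norm n S"
      using X 1 by (rule monotone_set_increasing)
    show ?thesis
    proof (rule influence_inequality_of_bound[OF linf_op_norm_pos _ _ p])
      fix i assume i: "i < n"
      then show "0 \<le> M.infl i" by (intro M.infl_nonneg) simp
      have "ennreal (1 * (\<integral>z. pull X z * dotp {..<n} (S_dir i) z \<partial>G)) \<le> coord_influence n \<mu> i X"
        by (rule coord_influence_ge[OF X]) (use 1 i in \<open>auto simp: increasing_set_def\<close>)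
      then show "ennreal (M.infl i) \<le> coord_influence n \<mu> i X" by (simp add: M.infl_def)
    next
      fix \<delta> assume "\<And>i. i < n \<Longrightarrow> linf_op_norm n S * M.infl i \<le> \<delta>" "0 < \<delta>" "\<delta> < 1"
      then show "?p * (1 - ?p) * sqrt (ln (1 / \<delta>)) \<le> 1024 * linf_op_norm n S * (\<Sum>i<n. M.infl i)"
        unfolding pX by (intro M.variance_bound) auto
    qed
  next
    case 2
    define Y where "Y = space (Rn n) - X"
    have Y: "Y \<in> sets (Rn n)" "increasing_set n Y" using X 2 by (auto simp: Y_def decreasing_set_def)
    interpret M: monotone_set "{..<n}" "\<lambda>j i. S $$ (j, i)" S_dir "pull Y" "linf_op_norm n S"
      using Y by (rule monotone_set_increasing)
    have Yp: "pull Y z = 1 - pull X z" for z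
      by (auto simp: pull_def Y_def indicator_def Rn_def space_PiM mv_def)
    have pY: "(\<integral>z. pull Y z \<partial>G) = 1 - ?p"
      unfolding Yp pX using iX by (simp add: gauss.prob_space)
    have infl: "M.infl i = - 1 * (\<integral>z. pull X z * dotp {..<n} (S_dir i) z \<partial>G)" for i
    proof -
      have "integrable G (\<lambda>z. pull X z * dotp {..<n} (S_dir i) z)"
        using bX by (rule bdd_mult_integrable) (use measurable_pull[OF X] in \<open>auto simp: measurable_gauss_iff integrable_dotp\<close>)
      then show ?thesis
        unfolding M.infl_def Yp by (simp add: left_diff_distrib integrable_dotp integral_dotp)
    qed
    have down: "y \<in> X" if "a \<in> X" "y \<in> space (Rn n)" "\<And>i. i < n \<Longrightarrow> - 1 * a i \<le> - 1 * y i" for a y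
    proof (rule ccontr)
      assume "y \<notin> X"
      then have "y \<in> Y" using that by (simp add: Y_def)
      moreover have "a \<in> space (Rn n)" using sets.sets_into_space[OF X] that by auto
      ultimately have "a \<in> Y" using Y(2) that(3) unfolding increasing_set_def by simp
      then show False using that by (simp add: Y_def)
    qed
    show ?thesis
    proof (rule influence_inequality_of_bound[OF linf_op_norm_pos _ _ p])
      fix i assume i: "i < n"
      then show "0 \<le> M.infl i" by (intro M.infl_nonneg) simp
      show "ennreal (M.infl i) \<le> coord_influence n \<mu> i X"
        unfolding infl by (rule coord_influence_ge[OF X]) (use down i in auto)
    next
      fix \<delta> assume "\<And>i. i < n \<Longrightarrow> linf_op_norm n S * M.infl i \<le> \<delta>" "0 < \<delta>" "\<delta> < 1"
      then have "(1 - ?p) * (1 - (1 - ?p)) * sqrt (ln (1 / \<delta>)) \<le> 1024 * linf_op_norm n S * (\<Sum>i<n. M.infl i)"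
        unfolding pY[symmetric] by (intro M.variance_bound) auto
      then show "?p * (1 - ?p) * sqrt (ln (1 / \<delta>)) \<le> 1024 * linf_op_norm n S * (\<Sum>i<n. M.infl i)"
        by (simp add: mult.commute)
    qed
  qed
qed

end

theorem theorem2p19:
  shows "\<exists>c::real. c > 0 \<and>
    (\<forall>(n::nat) (\<Sigma>::real mat) (S::real mat) (A::(nat \<Rightarrow> real) set).
      n > 0 \<longrightarrow>
      \<Sigma> \<in> carrier_mat n n \<longrightarrow> symmetric_mat \<Sigma> \<longrightarrow> positive_definite n \<Sigma> \<longrightarrow>
      S \<in> carrier_mat n n \<longrightarrow> symmetric_mat S \<longrightarrow> S * S = \<Sigma> \<longrightarrow>
      A \<in> sets (Rn n) \<longrightarrow> monotonic_set n A \<longrightarrow>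
      (let \<mu> = gaussian_measure n \<Sigma> in
        (\<Sum>i<n. coord_influence n \<mu> i A) \<ge>
          ennreal (c * inverse (linf_op_norm n S) * measure \<mu> A * (1 - measure \<mu> A)) *
          sqrt_ennreal (log_plus
            (1 / (ennreal (linf_op_norm n S) * (MAX i\<in>{..<n}. coord_influence n \<mu> i A))))))"
proof (intro exI[of _ "1 / 1024"] conjI allI impI)
  fix n :: nat and \<Sigma> S :: "real mat" and A :: "(nat \<Rightarrow> real) set"
  assume "0 < n" "\<Sigma> \<in> carrier_mat n n" "positive_definite n \<Sigma>"
    "S \<in> carrier_mat n n" "symmetric_mat S" "S * S = \<Sigma>" and A: "A \<in> sets (Rn n)" "monotonic_set n A"
  then interpret covariance_root n \<Sigma> S by unfold_locales simp_all
  show "let \<mu> = gaussian_measure n \<Sigma> in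
        (\<Sum>i<n. coord_influence n \<mu> i A) \<ge>
          ennreal (1 / 1024 * inverse (linf_op_norm n S) * measure \<mu> A * (1 - measure \<mu> A)) *
          sqrt_ennreal (log_plus
            (1 / (ennreal (linf_op_norm n S) * (MAX i\<in>{..<n}. coord_influence n \<mu> i A))))"
    unfolding Let_def by (rule influence_inequality[OF A])
qed simp

end
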